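(* Let $l$ be a positive integer and $\alpha=1+1/l$. \begin{itemize} \item Let $k\ge 4$ be an arbitrary integer. If $l\ge T(k+\log^*(k+1)+3)$, then the random graph $G(n,n^{-\alpha})$ obeys the MSO zero-one $k$-law. \item Let $k\ge 7$ be an arbitrary integer. If $l\leq 2T(k-4)$, then the random graph $G(n,n^{-\alpha})$ does not obey the FO zero-one $k$-law. \end{itemize}
   Context: $G(n,p)$ is the Erd\H{o}s--R\'enyi random graph on the vertex set $\{1,\ldots,n\}$, in which each of the $\binom n2$ edges appears independently with probability $p$. First order (FO) formulae of graphs are built from the relational symbols $\sim$ (adjacency) and $=$, logical connectives, variables ranging over vertices, and quantifiers $\forall,\exists$ over these variables. Monadic second order (MSO) formulae may in addition use variables ranging over unary predicates (i.e. sets of vertices) and quantifiers over them. The quantifier depth of a formula is the number of quantifiers (of both kinds) in its longest chain of nested quantifiers. $G(n,p)$, $p=p(n)$, obeys the FO (respectively MSO) zero-one $k$-law if for every FO (respectively MSO) sentence $\phi$ with quantifier depth at most $k$, the probability that $\phi$ is true on $G(n,p(n))$ tends to $0$ or tends to $1$ as $n\to\infty$. The tower function is defined by $T(1)=2$, $T(s)=2^{T(s-1)}$ for integers $s\ge 2$, and $\log^*(k)=\min\{i\geq 1:\,T(i)\geq k\}$. *)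

theory Defs
  imports "HOL-Probability.Probability"
begin

section \<open>Monadic second order formulae of graphs\<close>

text \<open>
  Vertex variables and set variables are both named by natural numbers, but live in
  separate name spaces.
\<close>

datatype formula =
    Adj nat nat
  | Eq nat nat
  | Mem nat nat  \<comment> \<open>\<open>Mem x X\<close>: vertex variable \<open>x\<close>, set variable \<open>X\<close>\<close>
  | Neg formula
  | Conj formula formula
  | Disj formula formula
  | Imp formula formula
  | Iff formula formula
  | Forall nat formula
  | Exists nat formula
  | ForallSet nat formula
  | ExistsSet nat formula

primrec qdepth :: "formula \<Rightarrow> nat" where
  "qdepth (Adj x y) = 0"
| "qdepth (Eq x y) = 0"
| "qdepth (Mem x X) = 0"
| "qdepth (Neg \<phi>) = qdepth \<phi>"
| "qdepth (Conj \<phi> \<psi>) = max (qdepth \<phi>) (qdepth \<psi>)"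
| "qdepth (Disj \<phi> \<psi>) = max (qdepth \<phi>) (qdepth \<psi>)"
| "qdepth (Imp \<phi> \<psi>) = max (qdepth \<phi>) (qdepth \<psi>)"
| "qdepth (Iff \<phi> \<psi>) = max (qdepth \<phi>) (qdepth \<psi>)"
| "qdepth (Forall x \<phi>) = Suc (qdepth \<phi>)"
| "qdepth (Exists x \<phi>) = Suc (qdepth \<phi>)"
| "qdepth (ForallSet X \<phi>) = Suc (qdepth \<phi>)"
| "qdepth (ExistsSet X \<phi>) = Suc (qdepth \<phi>)"

primrec free_vars :: "formula \<Rightarrow> nat set" where
  "free_vars (Adj x y) = {x, y}"
| "free_vars (Eq x y) = {x, y}"
| "free_vars (Mem x X) = {x}"
| "free_vars (Neg \<phi>) = free_vars \<phi>"
| "free_vars (Conj \<phi> \<psi>) = free_vars \<phi> \<union> free_vars \<psi>"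
| "free_vars (Disj \<phi> \<psi>) = free_vars \<phi> \<union> free_vars \<psi>"
| "free_vars (Imp \<phi> \<psi>) = free_vars \<phi> \<union> free_vars \<psi>"
| "free_vars (Iff \<phi> \<psi>) = free_vars \<phi> \<union> free_vars \<psi>"
| "free_vars (Forall x \<phi>) = free_vars \<phi> - {x}"
| "free_vars (Exists x \<phi>) = free_vars \<phi> - {x}"
| "free_vars (ForallSet X \<phi>) = free_vars \<phi>"
| "free_vars (ExistsSet X \<phi>) = free_vars \<phi>"

primrec free_set_vars :: "formula \<Rightarrow> nat set" where
  "free_set_vars (Adj x y) = {}"
| "free_set_vars (Eq x y) = {}"
| "free_set_vars (Mem x X) = {X}"
| "free_set_vars (Neg \<phi>) = free_set_vars \<phi>"
| "free_set_vars (Conj \<phi> \<psi>) = free_set_vars \<phi> \<union> free_set_vars \<psi>"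
| "free_set_vars (Disj \<phi> \<psi>) = free_set_vars \<phi> \<union> free_set_vars \<psi>"
| "free_set_vars (Imp \<phi> \<psi>) = free_set_vars \<phi> \<union> free_set_vars \<psi>"
| "free_set_vars (Iff \<phi> \<psi>) = free_set_vars \<phi> \<union> free_set_vars \<psi>"
| "free_set_vars (Forall x \<phi>) = free_set_vars \<phi>"
| "free_set_vars (Exists x \<phi>) = free_set_vars \<phi>"
| "free_set_vars (ForallSet X \<phi>) = free_set_vars \<phi> - {X}"
| "free_set_vars (ExistsSet X \<phi>) = free_set_vars \<phi> - {X}"

definition mso_sentence :: "formula \<Rightarrow> bool" where
  "mso_sentence \<phi> \<longleftrightarrow> free_vars \<phi> = {} \<and> free_set_vars \<phi> = {}"

primrec first_order :: "formula \<Rightarrow> bool" where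
  "first_order (Adj x y) = True"
| "first_order (Eq x y) = True"
| "first_order (Mem x X) = False"
| "first_order (Neg \<phi>) = first_order \<phi>"
| "first_order (Conj \<phi> \<psi>) = (first_order \<phi> \<and> first_order \<psi>)"
| "first_order (Disj \<phi> \<psi>) = (first_order \<phi> \<and> first_order \<psi>)"
| "first_order (Imp \<phi> \<psi>) = (first_order \<phi> \<and> first_order \<psi>)"
| "first_order (Iff \<phi> \<psi>) = (first_order \<phi> \<and> first_order \<psi>)"
| "first_order (Forall x \<phi>) = first_order \<phi>"
| "first_order (Exists x \<phi>) = first_order \<phi>"
| "first_order (ForallSet X \<phi>) = False"
| "first_order (ExistsSet X \<phi>) = False"

definition fo_sentence :: "formula \<Rightarrow> bool" where
  "fo_sentence \<phi> \<longleftrightarrow> mso_sentence \<phi> \<and> first_order \<phi>"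

text \<open>
  Truth in the graph with vertex set \<open>V\<close> and edge set \<open>E\<close>, an edge being a two-element set
  of vertices; \<open>s\<close> assigns vertices and \<open>S\<close> assigns sets of vertices to the variables.
\<close>

primrec sat :: "'v set \<Rightarrow> 'v set set \<Rightarrow> (nat \<Rightarrow> 'v) \<Rightarrow> (nat \<Rightarrow> 'v set) \<Rightarrow> formula \<Rightarrow> bool" where
  "sat V E s S (Adj x y) \<longleftrightarrow> {s x, s y} \<in> E"
| "sat V E s S (Eq x y) \<longleftrightarrow> s x = s y"
| "sat V E s S (Mem x X) \<longleftrightarrow> s x \<in> S X"
| "sat V E s S (Neg \<phi>) \<longleftrightarrow> \<not> sat V E s S \<phi>"
| "sat V E s S (Conj \<phi> \<psi>) \<longleftrightarrow> sat V E s S \<phi> \<and> sat V E s S \<psi>"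
| "sat V E s S (Disj \<phi> \<psi>) \<longleftrightarrow> sat V E s S \<phi> \<or> sat V E s S \<psi>"
| "sat V E s S (Imp \<phi> \<psi>) \<longleftrightarrow> (sat V E s S \<phi> \<longrightarrow> sat V E s S \<psi>)"
| "sat V E s S (Iff \<phi> \<psi>) \<longleftrightarrow> (sat V E s S \<phi> \<longleftrightarrow> sat V E s S \<psi>)"
| "sat V E s S (Forall x \<phi>) \<longleftrightarrow> (\<forall>v\<in>V. sat V E (s(x := v)) S \<phi>)"
| "sat V E s S (Exists x \<phi>) \<longleftrightarrow> (\<exists>v\<in>V. sat V E (s(x := v)) S \<phi>)"
| "sat V E s S (ForallSet X \<phi>) \<longleftrightarrow> (\<forall>A\<in>Pow V. sat V E s (S(X := A)) \<phi>)"
| "sat V E s S (ExistsSet X \<phi>) \<longleftrightarrow> (\<exists>A\<in>Pow V. sat V E s (S(X := A)) \<phi>)"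

lemma sat_cong:
  assumes "\<And>x. x \<in> free_vars \<phi> \<Longrightarrow> s x = s' x"
    and "\<And>X. X \<in> free_set_vars \<phi> \<Longrightarrow> S X = S' X"
  shows "sat V E s S \<phi> \<longleftrightarrow> sat V E s' S' \<phi>"
  using assms
proof (induction \<phi> arbitrary: s s' S S')
  case (Conj \<phi> \<psi>)
  have "sat V E s S \<phi> = sat V E s' S' \<phi>" "sat V E s S \<psi> = sat V E s' S' \<psi>"
    by (rule Conj.IH; use Conj.prems in simp)+
  then show ?case by simp
next
  case (Disj \<phi> \<psi>)
  have "sat V E s S \<phi> = sat V E s' S' \<phi>" "sat V E s S \<psi> = sat V E s' S' \<psi>"
    by (rule Disj.IH; use Disj.prems in simp)+
  then show ?case by simp
next
  case (Imp \<phi> \<psi>)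
  have "sat V E s S \<phi> = sat V E s' S' \<phi>" "sat V E s S \<psi> = sat V E s' S' \<psi>"
    by (rule Imp.IH; use Imp.prems in simp)+
  then show ?case by simp
next
  case (Iff \<phi> \<psi>)
  have "sat V E s S \<phi> = sat V E s' S' \<phi>" "sat V E s S \<psi> = sat V E s' S' \<psi>"
    by (rule Iff.IH; use Iff.prems in simp)+
  then show ?case by simp
next
  case (Forall x \<phi>)
  have "sat V E (s(x := v)) S \<phi> = sat V E (s'(x := v)) S' \<phi>" for v
    by (rule Forall.IH; use Forall.prems in auto)
  then show ?case by simp
next
  case (Exists x \<phi>)
  have "sat V E (s(x := v)) S \<phi> = sat V E (s'(x := v)) S' \<phi>" for v
    by (rule Exists.IH; use Exists.prems in auto)
  then show ?case by simp
next
  case (ForallSet X \<phi>)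
  have "sat V E s (S(X := A)) \<phi> = sat V E s' (S'(X := A)) \<phi>" for A
    by (rule ForallSet.IH; use ForallSet.prems in auto)
  then show ?case by simp
next
  case (ExistsSet X \<phi>)
  have "sat V E s (S(X := A)) \<phi> = sat V E s' (S'(X := A)) \<phi>" for A
    by (rule ExistsSet.IH; use ExistsSet.prems in auto)
  then show ?case by simp
next
  case (Neg \<phi>)
  have "sat V E s S \<phi> = sat V E s' S' \<phi>"
    by (rule Neg.IH; use Neg.prems in simp)
  then show ?case by simp
qed simp_all

definition models :: "'v set \<Rightarrow> 'v set set \<Rightarrow> formula \<Rightarrow> bool" where
  "models V E \<phi> \<longleftrightarrow> sat V E (\<lambda>_. undefined) (\<lambda>_. {}) \<phi>"

text \<open>The dummy assignment in \<open>models\<close> is immaterial for sentences.\<close>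

lemma models_iff_sat: "mso_sentence \<phi> \<Longrightarrow> models V E \<phi> \<longleftrightarrow> sat V E s S \<phi>"
  unfolding models_def mso_sentence_def by (rule sat_cong) simp_all


section \<open>The random graph and zero-one laws\<close>

definition all_edges :: "nat \<Rightarrow> nat set set" where
  "all_edges n = {e. e \<subseteq> {1..n} \<and> card e = 2}"

definition random_graph :: "nat \<Rightarrow> real \<Rightarrow> nat set set pmf" where
  "random_graph n p =
     map_pmf (\<lambda>f. {e \<in> all_edges n. f e}) (Pi_pmf (all_edges n) False (\<lambda>_. bernoulli_pmf p))"

definition graph_prob :: "nat \<Rightarrow> real \<Rightarrow> formula \<Rightarrow> real" where
  "graph_prob n p \<phi> = measure_pmf.prob (random_graph n p) {E. models {1..n} E \<phi>}"

definition mso_zero_one_law :: "nat \<Rightarrow> (nat \<Rightarrow> real) \<Rightarrow> bool" where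
  "mso_zero_one_law k p \<longleftrightarrow>
     (\<forall>\<phi>. mso_sentence \<phi> \<and> qdepth \<phi> \<le> k \<longrightarrow>
        (\<lambda>n. graph_prob n (p n) \<phi>) \<longlonglongrightarrow> 0 \<or> (\<lambda>n. graph_prob n (p n) \<phi>) \<longlonglongrightarrow> 1)"

definition fo_zero_one_law :: "nat \<Rightarrow> (nat \<Rightarrow> real) \<Rightarrow> bool" where
  "fo_zero_one_law k p \<longleftrightarrow>
     (\<forall>\<phi>. fo_sentence \<phi> \<and> qdepth \<phi> \<le> k \<longrightarrow>
        (\<lambda>n. graph_prob n (p n) \<phi>) \<longlonglongrightarrow> 0 \<or> (\<lambda>n. graph_prob n (p n) \<phi>) \<longlonglongrightarrow> 1)"


section \<open>The tower function\<close>

text \<open>The value at \<open>0\<close> is chosen so that \<open>tower 1 = 2\<close>.\<close>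

primrec tower :: "nat \<Rightarrow> nat" where
  "tower 0 = 1"
| "tower (Suc s) = 2 ^ tower s"

lemma tower_1: "tower 1 = 2"
  by simp

lemma tower_rec: "s \<ge> 2 \<Longrightarrow> tower s = 2 ^ tower (s - 1)"
  by (cases s) simp_all

definition log_star :: "nat \<Rightarrow> nat" where
  "log_star k = (LEAST i. i \<ge> 1 \<and> tower i \<ge> k)"

lemma less_tower: "s < tower s"
proof (induction s)
  case (Suc s)
  then have "Suc s \<le> tower s" by simp
  also have "\<dots> < 2 ^ tower s" by (rule less_exp)
  finally show ?case by simp
qed simp

lemma log_star_props: "log_star k \<ge> 1" "tower (log_star k) \<ge> k"
proof -
  have "Suc k \<ge> 1 \<and> tower (Suc k) \<ge> k"
    using less_tower[of "Suc k"] by linarith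
  then have "log_star k \<ge> 1 \<and> tower (log_star k) \<ge> k"
    unfolding log_star_def by (rule LeastI)
  then show "log_star k \<ge> 1" "tower (log_star k) \<ge> k" by simp_all
qed

end

theory Submission
  imports Defs
begin

text \<open>
  At \<open>p = n powr - (1 + 1 / l)\<close> the random graph is asymptotically almost surely a forest whose
  components have at most \<open>l + 1\<close> vertices. Every tree with at most \<open>l\<close> vertices occurs as a component
  arbitrarily often (second moment method), a given tree with \<open>l + 1\<close> vertices with a probability
  bounded away from 0 and 1.

  For the zero-one law, replacing a branch by an equivalent one preserves the MSO \<open>k\<close>-type of a tree.
  Every tree with at least two vertices is obtained by hanging one smaller tree below the root of
  another, so if there are fewer than \<open>M\<close> types, each type is realised by a tree with at most \<open>2 ^ M\<close>
  vertices. If \<open>l \<ge> 2 ^ M\<close>, the components with \<open>l + 1\<close> vertices are thus equivalent to smaller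
  ones, which are abundant anyway, and numbers of copies only matter up to a threshold.

  Against the law, the rooted trees with pairwise non-isomorphic branches at every vertex
  correspond to the hereditarily finite sets; those coded by numbers below \<open>tower i\<close> are described by
  first order formulae of depth \<open>i + 1\<close>. In a sparse graph such a formula forces a copy of the tree;
  take one with \<open>l + 1\<close> vertices. With positive probability it is missing, by Harris' inequality.
\<close>

section \<open>Types of MSO games\<close>

text \<open>At this exponent the expected number of copies of a tree with \<open>t\<close> vertices
  has order \<open>n\<close> to the power \<open>1 - (t - 1) / l\<close>: it diverges for
  \<open>t \<le> l\<close>, stays bounded for \<open>t = l + 1\<close>, and vanishes beyond. The
  tower heights count exponentials. For \<open>k\<close> moves there are at most
  \<open>2 ^ (k + 1)\<close> atoms, and \<open>k + 1 \<le> tower (log_star (k + 1))\<close>. One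
  exponential passes to \<open>2 ^ (k + 1)\<close>, one to sets of atoms, \<open>k\<close> to types
  of rank \<open>k\<close>, and a last one from the number of types to the size of a representative;
  together \<open>k + log_star (k + 1) + 3\<close>. In the other direction
  \<open>2 * t \<le> 2 ^ t\<close> gives \<open>l \<le> tower (k - 3)\<close>, so some tree with
  \<open>l + 1\<close> vertices has a code below \<open>tower (k - 2)\<close>. Describing it takes
  depth \<open>k - 1\<close>, and choosing the root takes one more quantifier. Pairwise different
  branches are what a formula can separate without counting. The price is that the description does
  not determine the component: it bounds no multiplicities. That the described vertices are distinct
  has to come from sparseness.\<close>

abbreviation sing_mem :: "'v set \<Rightarrow> 'v set \<Rightarrow> bool" where
  "sing_mem A B \<equiv> \<exists>v. A = {v} \<and> v \<in> B"

abbreviation sing_adj :: "'v set set \<Rightarrow> 'v set \<Rightarrow> 'v set \<Rightarrow> bool" where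
  "sing_adj E A B \<equiv> \<exists>u v. A = {u} \<and> B = {v} \<and> {u, v} \<in> E"

text \<open>
  All quantifiers are treated as set quantifiers, a vertex being a singleton; this costs nothing in
  depth. Emptiness is recorded because a union is a singleton iff one part is a singleton and the
  other one is empty, and membership of the root \<open>r\<close> because trees are joined at their roots. The
  coding by \<open>prod_encode\<close> makes the atoms of \<open>s\<close> sets an initial segment of length
  \<open>3 * triangle s\<close>, which is at most \<open>2 ^ (s + 1)\<close> for \<open>s \<ge> 4\<close>.
\<close>

definition atom :: "'v set set \<Rightarrow> 'v \<Rightarrow> 'v set list \<Rightarrow> nat \<Rightarrow> nat \<Rightarrow> nat \<Rightarrow> bool" where
  "atom E r As i j c \<longleftrightarrow>
     (if i = j then
        (if c = 0 then As ! i = {} else if c = 1 then is_singleton (As ! i) else r \<in> As ! i)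
      else
        (if c = 0 then sing_mem (As ! i) (As ! j)
         else if c = 1 then sing_mem (As ! j) (As ! i)
         else sing_adj E (As ! i) (As ! j)))"

definition atoms :: "'v set set \<Rightarrow> 'v \<Rightarrow> 'v set list \<Rightarrow> nat set" where
  "atoms E r As = {3 * prod_encode (i, d) + c | i d c. i + d < length As \<and> c < 3 \<and> atom E r As i (i + d) c}"

text \<open>The form of equality of \<open>atoms\<close> that is free of the coding: counting types
  uses \<open>atoms\<close>, the composition arguments use this.\<close>

definition agree :: "'v set set \<Rightarrow> 'v \<Rightarrow> 'v set list \<Rightarrow> 'w set set \<Rightarrow> 'w \<Rightarrow> 'w set list \<Rightarrow> bool" where
  "agree E r As E' r' As' \<longleftrightarrow> length As = length As' \<and>
     (\<forall>i<length As. (As ! i = {} \<longleftrightarrow> As' ! i = {}) \<and>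
        (is_singleton (As ! i) \<longleftrightarrow> is_singleton (As' ! i)) \<and> (r \<in> As ! i \<longleftrightarrow> r' \<in> As' ! i) \<and>
        (\<forall>j<length As. i \<noteq> j \<longrightarrow>
           (sing_mem (As ! i) (As ! j) \<longleftrightarrow> sing_mem (As' ! i) (As' ! j)) \<and>
           (sing_adj E (As ! i) (As ! j) \<longleftrightarrow> sing_adj E' (As' ! i) (As' ! j))))"

text \<open>\<open>prod_encode\<close> runs through the diagonals \<open>i + d = 0, 1, ...\<close>
  one after the other, so the pairs with \<open>i + d < s\<close> come first.\<close>

lemma prod_encode_less_triangle: "i + d < s \<Longrightarrow> prod_encode (i, d) < triangle s"
proof -
  assume "i + d < s"
  moreover have "mono triangle" by (simp add: mono_iff_le_Suc)
  ultimately have "triangle (Suc (i + d)) \<le> triangle s" by (simp add: monoD Suc_leI del: triangle_Suc)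
  then show ?thesis by (simp add: prod_encode_def)
qed

lemma atoms_bound: "b \<in> atoms E r As \<Longrightarrow> b < 3 * triangle (length As)"
  unfolding atoms_def using prod_encode_less_triangle by fastforce

lemma finite_atoms: "finite (atoms E r As)"
  by (rule finite_subset[of _ "{..<3 * triangle (length As)}"]) (auto dest: atoms_bound)

lemma mem_atoms_iff:
  assumes "i + d < length As" "c < 3"
  shows "3 * prod_encode (i, d) + c \<in> atoms E r As \<longleftrightarrow> atom E r As i (i + d) c"
proof -
  have *: "p = q \<and> c = c'" if "3 * p + c = 3 * q + c'" "c' < 3" for p q c' :: nat
    using that assms(2) by presburger
  show ?thesis
    unfolding atoms_def using assms by (auto dest!: *)
qed

lemma sing_adj_commute: "sing_adj E A B \<longleftrightarrow> sing_adj E B A"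
  by (auto simp: insert_commute)

text \<open>Atoms are stored for \<open>i \<le> j\<close> only. The pairs in the other order are
  recovered because both directions of membership are stored and adjacency is symmetric.\<close>

lemma atoms_eq_iff:
  assumes "length As = length As'"
  shows "atoms E r As = atoms E' r' As' \<longleftrightarrow> agree E r As E' r' As'"
proof -
  have "atoms E r As = atoms E' r' As' \<longleftrightarrow>
    (\<forall>i d c. i + d < length As \<and> c < 3 \<longrightarrow> atom E r As i (i + d) c = atom E' r' As' i (i + d) c)"
    (is "?L \<longleftrightarrow> ?R")
  proof
    assume ?L
    then show ?R using assms mem_atoms_iff by metis
  next
    assume ?R
    then show ?L unfolding atoms_def using assms by (intro Collect_cong) metis
  qed
  also have "\<dots> \<longleftrightarrow> (\<forall>i j c. i \<le> j \<and> j < length As \<and> c < 3 \<longrightarrow> atom E r As i j c = atom E' r' As' i j c)"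
    by (metis le_add1 le_add_diff_inverse)
  also have "\<dots> \<longleftrightarrow> (\<forall>i j. i \<le> j \<and> j < length As \<longrightarrow> atom E r As i j 0 = atom E' r' As' i j 0 \<and>
      atom E r As i j 1 = atom E' r' As' i j 1 \<and> atom E r As i j 2 = atom E' r' As' i j 2)"
    by (auto simp: numeral_3_eq_3 less_Suc_eq numeral_2_eq_2)
  also have "\<dots> \<longleftrightarrow> agree E r As E' r' As'"
  proof
    assume R: "agree E r As E' r' As'"
    show "\<forall>i j. i \<le> j \<and> j < length As \<longrightarrow> atom E r As i j 0 = atom E' r' As' i j 0 \<and>
      atom E r As i j 1 = atom E' r' As' i j 1 \<and> atom E r As i j 2 = atom E' r' As' i j 2"
      using R unfolding agree_def atom_def by (auto dest: order_le_less_trans)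
  next
    assume L: "\<forall>i j. i \<le> j \<and> j < length As \<longrightarrow> atom E r As i j 0 = atom E' r' As' i j 0 \<and>
      atom E r As i j 1 = atom E' r' As' i j 1 \<and> atom E r As i j 2 = atom E' r' As' i j 2"
    have 1: "(As ! i = {} \<longleftrightarrow> As' ! i = {}) \<and>
        (is_singleton (As ! i) \<longleftrightarrow> is_singleton (As' ! i)) \<and> (r \<in> As ! i \<longleftrightarrow> r' \<in> As' ! i)" if "i < length As" for i
      using L[rule_format, of i i] that by (auto simp: atom_def)
    let ?M = "\<lambda>i j. sing_mem (As ! i) (As ! j) \<longleftrightarrow> sing_mem (As' ! i) (As' ! j)"
      and ?N = "\<lambda>i j. sing_adj E (As ! i) (As ! j) \<longleftrightarrow> sing_adj E' (As' ! i) (As' ! j)"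
    have 2: "?M i j \<and> ?M j i \<and> ?N i j" if "i < j" "j < length As" for i j
      using L[rule_format, of i j] that by (auto simp: atom_def)
    have 3: "?M i j \<and> ?N i j" if "i \<noteq> j" "i < length As" "j < length As" for i j
    proof (cases "i < j")
      case True
      then show ?thesis using 2 that(3) by simp
    next
      case False
      then have "?M i j" "?N j i" using 2[of j i] that by simp_all
      moreover have "sing_adj E (As ! i) (As ! j) \<longleftrightarrow> sing_adj E (As ! j) (As ! i)"
        "sing_adj E' (As' ! i) (As' ! j) \<longleftrightarrow> sing_adj E' (As' ! j) (As' ! i)"
        by (rule sing_adj_commute)+
      ultimately show ?thesis by (simp only:)
    qed
    show "agree E r As E' r' As'"
      unfolding agree_def by (intro conjI allI impI assms; (rule 3[THEN conjunct1] 3[THEN conjunct2]; assumption)?; simp only: 1)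
  qed
  finally show ?thesis .
qed

section \<open>Types of bounded rank and their number\<close>

text \<open>Equal values mean that Duplicator wins \<open>j\<close> more rounds after the sets
  \<open>As\<close> have been chosen. Coding types as numbers makes them comparable across different
  vertex types, and turns counting them into a bound on a number.\<close>

primrec tp :: "nat \<Rightarrow> 'v set \<Rightarrow> 'v set set \<Rightarrow> 'v \<Rightarrow> 'v set list \<Rightarrow> nat" where
  "tp 0 V E r As = set_encode (atoms E r As)"
| "tp (Suc j) V E r As = set_encode ((\<lambda>B. tp j V E r (As @ [B])) ` Pow V)"

lemma tp_0_eq_iff:
  "length As = length As' \<Longrightarrow> tp 0 V E r As = tp 0 V' E' r' As' \<longleftrightarrow> agree E r As E' r' As'"
  by (simp add: set_encode_eq finite_atoms atoms_eq_iff)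

lemma tp_SucD:
  assumes "tp (Suc j) V E r As = tp (Suc j) V' E' r' As'" "finite V" "finite V'" "B \<subseteq> V"
  obtains B' where "B' \<subseteq> V'" "tp j V E r (As @ [B]) = tp j V' E' r' (As' @ [B'])"
proof -
  have "(\<lambda>B. tp j V E r (As @ [B])) ` Pow V = (\<lambda>B. tp j V' E' r' (As' @ [B])) ` Pow V'"
    using assms by (simp add: set_encode_eq)
  moreover have "tp j V E r (As @ [B]) \<in> (\<lambda>B. tp j V E r (As @ [B])) ` Pow V" using assms(4) by blast
  ultimately have "tp j V E r (As @ [B]) \<in> (\<lambda>B. tp j V' E' r' (As' @ [B])) ` Pow V'" by simp
  then show thesis using that by blast
qed

lemma tp_SucI:
  assumes "\<And>B. B \<subseteq> V \<Longrightarrow> \<exists>B'\<subseteq>V'. tp j V E r (As @ [B]) = tp j V' E' r' (As' @ [B'])"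
    and "\<And>B'. B' \<subseteq> V' \<Longrightarrow> \<exists>B\<subseteq>V. tp j V E r (As @ [B]) = tp j V' E' r' (As' @ [B'])"
  shows "tp (Suc j) V E r As = tp (Suc j) V' E' r' As'"
proof -
  have "(\<lambda>B. tp j V E r (As @ [B])) ` Pow V = (\<lambda>B. tp j V' E' r' (As' @ [B])) ` Pow V'"
  proof (intro equalityI image_subsetI)
    fix B assume "B \<in> Pow V"
    then show "tp j V E r (As @ [B]) \<in> (\<lambda>B. tp j V' E' r' (As' @ [B])) ` Pow V'"
      using assms(1)[of B] by auto
  next
    fix B assume "B \<in> Pow V'"
    then obtain B' where B': "B' \<subseteq> V" "tp j V E r (As @ [B']) = tp j V' E' r' (As' @ [B])"
      using assms(2)[of B] by auto
    show "tp j V' E' r' (As' @ [B]) \<in> (\<lambda>B. tp j V E r (As @ [B])) ` Pow V"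
      using B' by (intro image_eqI[of _ _ B']) simp_all
  qed
  then show ?thesis by simp
qed

lemma agree_butlast:
  assumes "agree E r (As @ [B]) E' r' (As' @ [B'])"
  shows "agree E r As E' r' As'"
proof -
  have len: "length As = length As'" using assms by (simp add: agree_def)
  have *: "(As @ [B]) ! i = As ! i" "(As' @ [B']) ! i = As' ! i" if "i < length As" for i
    using that len by (simp_all add: nth_append)
  have **: "i < length (As @ [B])" if "i < length As" for i using that by simp
  have "(As ! i = {} \<longleftrightarrow> As' ! i = {}) \<and>
        (is_singleton (As ! i) \<longleftrightarrow> is_singleton (As' ! i)) \<and> (r \<in> As ! i \<longleftrightarrow> r' \<in> As' ! i)"
    if "i < length As" for i
    using assms[unfolded agree_def, THEN conjunct2, rule_format, OF **[OF that]] *[OF that] by simp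
  moreover have "(sing_mem (As ! i) (As ! j) \<longleftrightarrow> sing_mem (As' ! i) (As' ! j)) \<and>
           (sing_adj E (As ! i) (As ! j) \<longleftrightarrow> sing_adj E' (As' ! i) (As' ! j))"
    if "i < length As" "j < length As" "i \<noteq> j" for i j
    using assms[unfolded agree_def, THEN conjunct2, rule_format, OF **[OF that(1)], THEN conjunct2,
      THEN conjunct2, THEN conjunct2, rule_format, OF **[OF that(2)] that(3)]
    unfolding *[OF that(1)] *[OF that(2)] .
  ultimately show ?thesis using len by (simp add: agree_def)
qed

text \<open>Further moves only add atoms, so a type of any rank still determines the atoms of the
  sets chosen so far.\<close>

lemma tp_agree:
  assumes "tp j V E r As = tp j V' E' r' As'" "length As = length As'" "finite V" "finite V'"
  shows "agree E r As E' r' As'"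
  using assms
proof (induction j arbitrary: As As')
  case 0
  then show ?case by (simp only: tp_0_eq_iff)
next
  case (Suc j)
  \<comment> \<open>The empty set serves as an idle move: it is available in every structure, even
    on no vertices.\<close>
  obtain B' where "tp j V E r (As @ [{}]) = tp j V' E' r' (As' @ [B'])"
    by (rule tp_SucD[OF Suc.prems(1,3,4) empty_subsetI])
  then have "agree E r (As @ [{}]) E' r' (As' @ [B'])"
    using Suc by simp
  then show ?case by (rule agree_butlast)
qed

lemma set_encode_less:
  assumes "A \<subseteq> {..<n}"
  shows "set_encode A < 2 ^ n"
proof -
  have "set_encode A \<le> set_encode {..<n}"
    unfolding set_encode_def by (rule sum_mono2) (use assms in auto)
  also have "set_encode {..<n} < 2 ^ n"
    by (induction n) (simp_all add: lessThan_Suc)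
  finally show ?thesis .
qed

abbreviation tp_bound :: "nat \<Rightarrow> nat \<Rightarrow> nat" where
  "tp_bound j k \<equiv> ((\<lambda>x. 2 ^ x) ^^ j) (2 ^ (3 * triangle k))"

text \<open>\<open>k\<close> is the total number of sets at the end of the game. A type of rank 0 is
  a set of at most \<open>3 * triangle k\<close> atoms; each move still to come adds an
  exponential.\<close>

lemma tp_less:
  "length As + j = k \<Longrightarrow> finite V \<Longrightarrow> tp j V E r As < tp_bound j k"
proof (induction j arbitrary: As)
  case 0
  have "atoms E r As \<subseteq> {..<3 * triangle k}" using atoms_bound[of _ E r As] 0 by auto
  then show ?case using set_encode_less by simp
next
  case (Suc j)
  let ?N = "tp_bound j k"
  have "(\<lambda>B. tp j V E r (As @ [B])) ` Pow V \<subseteq> {..<?N}" using Suc by auto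
  then show ?case using set_encode_less by simp
qed

text \<open>Being a singleton is an atom, so the reply to a singleton is again a singleton. This is
  why vertex quantifiers may be played as set moves.\<close>

lemma tp_vertex_move:
  assumes "tp (Suc j) V E r As = tp (Suc j) V' E' r' As'" "length As = length As'"
    and "finite V" "finite V'" "v \<in> V"
  obtains v' where "v' \<in> V'" "tp j V E r (As @ [{v}]) = tp j V' E' r' (As' @ [{v'}])"
proof -
  obtain B where B: "B \<subseteq> V'" "tp j V E r (As @ [{v}]) = tp j V' E' r' (As' @ [B])"
    using tp_SucD[OF assms(1,3,4), of "{v}"] assms(5) by blast
  have "agree E r (As @ [{v}]) E' r' (As' @ [B])"
    using tp_agree[OF B(2)] assms by simp
  then have "is_singleton B"
    using assms(2) by (auto simp: agree_def nth_append is_singleton_def dest!: spec[of _ "length As"])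
  then obtain v' where "B = {v'}" by (auto simp: is_singleton_def)
  with B that show thesis by auto
qed

section \<open>Equal types satisfy the same sentences\<close>

text \<open>Each relevant variable has its two values at a common position of the two lists.
  Rebinding a variable leaves its old value in the lists, which therefore only grow.\<close>

definition named :: "'v set list \<Rightarrow> (nat \<Rightarrow> 'v) \<Rightarrow> (nat \<Rightarrow> 'v set) \<Rightarrow>
    'w set list \<Rightarrow> (nat \<Rightarrow> 'w) \<Rightarrow> (nat \<Rightarrow> 'w set) \<Rightarrow> nat set \<Rightarrow> nat set \<Rightarrow> bool" where
  "named As s S As' s' S' U W \<longleftrightarrow> length As = length As' \<and>
     (\<forall>x\<in>U. \<exists>i<length As. As ! i = {s x} \<and> As' ! i = {s' x}) \<and>
     (\<forall>X\<in>W. \<exists>i<length As. As ! i = S X \<and> As' ! i = S' X)"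

lemma named_mono: "named As s S As' s' S' U W \<Longrightarrow> U' \<subseteq> U \<Longrightarrow> W' \<subseteq> W \<Longrightarrow> named As s S As' s' S' U' W'"
  unfolding named_def by (meson subsetD)

lemma named_append:
  assumes n: "named As s S As' s' S' U W"
  shows "named (As @ [B]) s S (As' @ [B']) s' S' U W"
proof -
  have ext: "\<exists>i<length (As @ [B]). (As @ [B]) ! i = X \<and> (As' @ [B']) ! i = X'"
    if "\<exists>i<length As. As ! i = X \<and> As' ! i = X'" for X X'
    using that n by (auto simp: named_def nth_append intro: less_SucI)
  show ?thesis using n unfolding named_def by (intro conjI ballI ext) (simp, blast+)
qed

lemma named_new:
  assumes "length As = length As'"
  shows "\<exists>i<length (As @ [B]). (As @ [B]) ! i = B \<and> (As' @ [B']) ! i = B'"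
  using assms by (intro exI[of _ "length As"]) (simp add: nth_append)

lemma named_vertex:
  assumes n: "named As s S As' s' S' (U - {x}) W"
  shows "named (As @ [{v}]) (s(x := v)) S (As' @ [{v'}]) (s'(x := v')) S' U W"
proof -
  have len: "length As = length As'" using n by (simp add: named_def)
  show ?thesis
    using named_append[OF n, of "{v}" "{v'}"] named_new[OF len, of "{v}" "{v'}"]
    unfolding named_def by (metis DiffI fun_upd_other fun_upd_same singletonD)
qed

lemma named_set:
  assumes n: "named As s S As' s' S' U (W - {X})"
  shows "named (As @ [B]) s (S(X := B)) (As' @ [B']) s' (S'(X := B')) U W"
proof -
  have len: "length As = length As'" using n by (simp add: named_def)
  show ?thesis
    using named_append[OF n, of B B'] named_new[OF len, of B B']
    unfolding named_def by (metis DiffI fun_upd_other fun_upd_same singletonD)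
qed

text \<open>The Ehrenfeucht-Fraisse argument. Two variables may be named by the same position, where
  \<open>agree\<close> says nothing on adjacency; excluding loops settles this case.\<close>

lemma sat_tp_eq:
  assumes "qdepth \<phi> \<le> j" "tp j V E r As = tp j V' E' r' As'"
    and fin: "finite V" "finite V'" and loop: "\<And>v. {v} \<notin> E" "\<And>v. {v} \<notin> E'"
    and "named As s S As' s' S' (free_vars \<phi>) (free_set_vars \<phi>)"
  shows "sat V E s S \<phi> \<longleftrightarrow> sat V' E' s' S' \<phi>"
  using assms(1,2,7)
proof (induction \<phi> arbitrary: j As As' s s' S S')
  case (Adj x y)
  have len: "length As = length As'" using Adj.prems(3) by (simp add: named_def)
  have ag: "agree E r As E' r' As'" by (rule tp_agree[OF Adj.prems(2) len fin])
  obtain a b where ab: "a < length As" "As ! a = {s x}" "As' ! a = {s' x}"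
    "b < length As" "As ! b = {s y}" "As' ! b = {s' y}"
    using Adj.prems(3) by (auto simp: named_def)
  show ?case
  proof (cases "a = b")
    case True
    then show ?thesis using ab loop by auto
  next
    case False
    then have "sing_adj E (As ! a) (As ! b) \<longleftrightarrow> sing_adj E' (As' ! a) (As' ! b)"
      using ag ab(1,4) unfolding agree_def by blast
    then show ?thesis using ab by simp
  qed
next
  case (Eq x y)
  have len: "length As = length As'" using Eq.prems(3) by (simp add: named_def)
  have ag: "agree E r As E' r' As'" by (rule tp_agree[OF Eq.prems(2) len fin])
  obtain a b where ab: "a < length As" "As ! a = {s x}" "As' ! a = {s' x}"
    "b < length As" "As ! b = {s y}" "As' ! b = {s' y}"
    using Eq.prems(3) by (auto simp: named_def)
  show ?case
  proof (cases "a = b")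
    case True
    then show ?thesis using ab loop by auto
  next
    case False
    then have "sing_mem (As ! a) (As ! b) \<longleftrightarrow> sing_mem (As' ! a) (As' ! b)"
      using ag ab(1,4) unfolding agree_def by blast
    then show ?thesis using ab by simp
  qed
next
  case (Mem x X)
  have len: "length As = length As'" using Mem.prems(3) by (simp add: named_def)
  have ag: "agree E r As E' r' As'" by (rule tp_agree[OF Mem.prems(2) len fin])
  obtain a b where ab: "a < length As" "As ! a = {s x}" "As' ! a = {s' x}"
    "b < length As" "As ! b = S X" "As' ! b = S' X"
    using Mem.prems(3) by (auto simp: named_def)
  show ?case
  proof (cases "a = b")
    case True
    then show ?thesis using ab loop by auto
  next
    case False
    then have "sing_mem (As ! a) (As ! b) \<longleftrightarrow> sing_mem (As' ! a) (As' ! b)"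
      using ag ab(1,4) unfolding agree_def by blast
    then show ?thesis using ab by simp
  qed
next
  case (Neg \<phi>)
  then show ?case by auto
next
  case (Conj \<phi> \<psi>)
  then show ?case by (simp add: Conj.IH[OF _ Conj.prems(2) named_mono[OF Conj.prems(3)]])
next
  case (Disj \<phi> \<psi>)
  then show ?case by (simp add: Disj.IH[OF _ Disj.prems(2) named_mono[OF Disj.prems(3)]])
next
  case (Imp \<phi> \<psi>)
  then show ?case by (simp add: Imp.IH[OF _ Imp.prems(2) named_mono[OF Imp.prems(3)]])
next
  case (Iff \<phi> \<psi>)
  then show ?case by (simp add: Iff.IH[OF _ Iff.prems(2) named_mono[OF Iff.prems(3)]])
next
  case (Forall x \<phi>)
  then obtain i where j: "j = Suc i" "qdepth \<phi> \<le> i" by (cases j) auto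
  have len: "length As = length As'" using Forall.prems(3) by (simp add: named_def)
  note step = Forall.IH[OF j(2) _ named_vertex[OF Forall.prems(3)[simplified]]]
  have "\<exists>v'\<in>V'. sat V E (s(x := v)) S \<phi> = sat V' E' (s'(x := v')) S' \<phi>" if "v \<in> V" for v
    by (rule tp_vertex_move[OF Forall.prems(2)[unfolded j] len fin that]) (use step in blast)
  moreover have "\<exists>v\<in>V. sat V E (s(x := v)) S \<phi> = sat V' E' (s'(x := v')) S' \<phi>" if "v' \<in> V'" for v'
    by (rule tp_vertex_move[OF Forall.prems(2)[unfolded j, symmetric] len[symmetric] fin(2,1) that])
      (use step[OF sym] in blast)
  ultimately show ?case by (simp only: sat.simps) blast
next
  case (Exists x \<phi>)
  then obtain i where j: "j = Suc i" "qdepth \<phi> \<le> i" by (cases j) auto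
  have len: "length As = length As'" using Exists.prems(3) by (simp add: named_def)
  note step = Exists.IH[OF j(2) _ named_vertex[OF Exists.prems(3)[simplified]]]
  have "\<exists>v'\<in>V'. sat V E (s(x := v)) S \<phi> = sat V' E' (s'(x := v')) S' \<phi>" if "v \<in> V" for v
    by (rule tp_vertex_move[OF Exists.prems(2)[unfolded j] len fin that]) (use step in blast)
  moreover have "\<exists>v\<in>V. sat V E (s(x := v)) S \<phi> = sat V' E' (s'(x := v')) S' \<phi>" if "v' \<in> V'" for v'
    by (rule tp_vertex_move[OF Exists.prems(2)[unfolded j, symmetric] len[symmetric] fin(2,1) that])
      (use step[OF sym] in blast)
  ultimately show ?case by (simp only: sat.simps) blast
next
  case (ForallSet X \<phi>)
  then obtain i where j: "j = Suc i" "qdepth \<phi> \<le> i" by (cases j) auto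
  note step = ForallSet.IH[OF j(2) _ named_set[OF ForallSet.prems(3)[simplified]]]
  have "\<exists>B'\<in>Pow V'. sat V E s (S(X := B)) \<phi> = sat V' E' s' (S'(X := B')) \<phi>" if "B \<subseteq> V" for B
    by (rule tp_SucD[OF ForallSet.prems(2)[unfolded j] fin that]) (use step in blast)
  moreover have "\<exists>B\<in>Pow V. sat V E s (S(X := B)) \<phi> = sat V' E' s' (S'(X := B')) \<phi>" if "B' \<subseteq> V'" for B'
    by (rule tp_SucD[OF ForallSet.prems(2)[unfolded j, symmetric] fin(2,1) that])
      (use step[OF sym] in blast)
  ultimately show ?case by (simp only: sat.simps) blast
next
  case (ExistsSet X \<phi>)
  then obtain i where j: "j = Suc i" "qdepth \<phi> \<le> i" by (cases j) auto
  note step = ExistsSet.IH[OF j(2) _ named_set[OF ExistsSet.prems(3)[simplified]]]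
  have "\<exists>B'\<in>Pow V'. sat V E s (S(X := B)) \<phi> = sat V' E' s' (S'(X := B')) \<phi>" if "B \<subseteq> V" for B
    by (rule tp_SucD[OF ExistsSet.prems(2)[unfolded j] fin that]) (use step in blast)
  moreover have "\<exists>B\<in>Pow V. sat V E s (S(X := B)) \<phi> = sat V' E' s' (S'(X := B')) \<phi>" if "B' \<subseteq> V'" for B'
    by (rule tp_SucD[OF ExistsSet.prems(2)[unfolded j, symmetric] fin(2,1) that])
      (use step[OF sym] in blast)
  ultimately show ?case by (simp only: sat.simps) blast
qed

section \<open>Types of compositions\<close>

lemma singleton_split:
  assumes "A \<subseteq> V1 \<union> V2" "V1 \<inter> V2 = {}"
  shows "A = {} \<longleftrightarrow> A \<inter> V1 = {} \<and> A \<inter> V2 = {}"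
    and "A = {u} \<longleftrightarrow> A \<inter> V1 = {u} \<and> A \<inter> V2 = {} \<or> A \<inter> V2 = {u} \<and> A \<inter> V1 = {}"
proof -
  have *: "A = (A \<inter> V1) \<union> (A \<inter> V2)" using assms by blast
  show "A = {} \<longleftrightarrow> A \<inter> V1 = {} \<and> A \<inter> V2 = {}" using * by blast
  show "A = {u} \<longleftrightarrow> A \<inter> V1 = {u} \<and> A \<inter> V2 = {} \<or> A \<inter> V2 = {u} \<and> A \<inter> V1 = {}"
  proof
    assume "A = {u}"
    then show "A \<inter> V1 = {u} \<and> A \<inter> V2 = {} \<or> A \<inter> V2 = {u} \<and> A \<inter> V1 = {}"
      using assms by auto
  qed (use * in auto)
qed

lemma is_singleton_split:
  assumes "A \<subseteq> V1 \<union> V2" "V1 \<inter> V2 = {}"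
  shows "is_singleton A \<longleftrightarrow>
    is_singleton (A \<inter> V1) \<and> A \<inter> V2 = {} \<or> is_singleton (A \<inter> V2) \<and> A \<inter> V1 = {}"
  unfolding is_singleton_def using singleton_split(2)[OF assms] by metis

lemma mem_split:
  assumes "A \<subseteq> V1 \<union> V2" "V1 \<inter> V2 = {}"
  shows "sing_mem A B \<longleftrightarrow>
    sing_mem (A \<inter> V1) (B \<inter> V1) \<and> A \<inter> V2 = {} \<or> sing_mem (A \<inter> V2) (B \<inter> V2) \<and> A \<inter> V1 = {}"
  unfolding singleton_split(2)[OF assms] by blast

text \<open>A pair across the two parts is adjacent only as \<open>{r1, r2}\<close>. It is therefore
  recognised from emptiness, being a singleton and containing the root, evaluated on the traces of
  \<open>A\<close> and \<open>B\<close> in the parts.\<close>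

lemma adj_split:
  assumes "A \<subseteq> V1 \<union> V2" "B \<subseteq> V1 \<union> V2" "V1 \<inter> V2 = {}"
    and cross: "\<forall>u\<in>V1. \<forall>v\<in>V2. {u, v} \<in> E \<longleftrightarrow> b \<and> u = r1 \<and> v = r2"
  shows "sing_adj E A B \<longleftrightarrow>
    sing_adj E (A \<inter> V1) (B \<inter> V1) \<and> A \<inter> V2 = {} \<and> B \<inter> V2 = {} \<or>
    sing_adj E (A \<inter> V2) (B \<inter> V2) \<and> A \<inter> V1 = {} \<and> B \<inter> V1 = {} \<or>
    b \<and> is_singleton (A \<inter> V1) \<and> r1 \<in> A \<inter> V1 \<and> A \<inter> V2 = {} \<and> is_singleton (B \<inter> V2) \<and> r2 \<in> B \<inter> V2 \<and> B \<inter> V1 = {} \<or>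
    b \<and> is_singleton (B \<inter> V1) \<and> r1 \<in> B \<inter> V1 \<and> B \<inter> V2 = {} \<and> is_singleton (A \<inter> V2) \<and> r2 \<in> A \<inter> V2 \<and> A \<inter> V1 = {}"
    (is "?L \<longleftrightarrow> ?a \<or> ?b \<or> ?c \<or> ?d")
proof -
  have c1: "sing_adj E (A \<inter> V1) (B \<inter> V2) \<longleftrightarrow>
    b \<and> is_singleton (A \<inter> V1) \<and> r1 \<in> A \<inter> V1 \<and> is_singleton (B \<inter> V2) \<and> r2 \<in> B \<inter> V2" for A B
  proof
    assume "sing_adj E (A \<inter> V1) (B \<inter> V2)"
    then obtain u v where uv: "A \<inter> V1 = {u}" "B \<inter> V2 = {v}" "{u, v} \<in> E" by blast
    then have "u \<in> V1" "v \<in> V2" by auto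
    then show "b \<and> is_singleton (A \<inter> V1) \<and> r1 \<in> A \<inter> V1 \<and> is_singleton (B \<inter> V2) \<and> r2 \<in> B \<inter> V2"
      using cross uv by (simp add: is_singleton_def)
  next
    assume R: "b \<and> is_singleton (A \<inter> V1) \<and> r1 \<in> A \<inter> V1 \<and> is_singleton (B \<inter> V2) \<and> r2 \<in> B \<inter> V2"
    then have "A \<inter> V1 = {r1}" "B \<inter> V2 = {r2}" by (metis is_singletonE singletonD)+
    moreover have "{r1, r2} \<in> E" using cross R by blast
    ultimately show "sing_adj E (A \<inter> V1) (B \<inter> V2)" by blast
  qed
  have c2: "(\<exists>v u. B \<inter> V1 = {v} \<and> A \<inter> V2 = {u} \<and> {u, v} \<in> E) \<longleftrightarrow>
      b \<and> is_singleton (B \<inter> V1) \<and> r1 \<in> B \<inter> V1 \<and> is_singleton (A \<inter> V2) \<and> r2 \<in> A \<inter> V2"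
    unfolding c1[of B A, symmetric] by (simp add: insert_commute)
  have L: "?L \<longleftrightarrow> ?a \<or> ?b \<or>
      sing_adj E (A \<inter> V1) (B \<inter> V2) \<and> A \<inter> V2 = {} \<and> B \<inter> V1 = {} \<or>
      (\<exists>v u. B \<inter> V1 = {v} \<and> A \<inter> V2 = {u} \<and> {u, v} \<in> E) \<and> B \<inter> V2 = {} \<and> A \<inter> V1 = {}"
    unfolding singleton_split(2)[OF assms(1,3)] singleton_split(2)[OF assms(2,3)]
    by (rule iffI; elim exE conjE disjE; blast)
  show ?thesis unfolding L c1 c2 by (simp only: conj_ac)
qed

abbreviation restr :: "'v set \<Rightarrow> 'v set list \<Rightarrow> 'v set list" where
  "restr V \<equiv> map (\<lambda>A. A \<inter> V)"

lemma agree_join: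
  assumes 1: "agree E r1 (restr V1 As) E' r1' (restr V1' As')"
    and 2: "agree E r2 (restr V2 As) E' r2' (restr V2' As')"
    and disj: "V1 \<inter> V2 = {}" "V1' \<inter> V2' = {}" and r: "r1 \<notin> V2" "r1' \<notin> V2'"
    and sub: "\<Union> (set As) \<subseteq> V1 \<union> V2" "\<Union> (set As') \<subseteq> V1' \<union> V2'"
    and cross: "\<forall>u\<in>V1. \<forall>v\<in>V2. {u, v} \<in> E \<longleftrightarrow> b \<and> u = r1 \<and> v = r2"
    and cross': "\<forall>u\<in>V1'. \<forall>v\<in>V2'. {u, v} \<in> E' \<longleftrightarrow> b \<and> u = r1' \<and> v = r2'"
  shows "agree E r1 As E' r1' As'"
proof -
  have len: "length As = length As'" using 1 by (simp add: agree_def)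
  define A where "A i = As ! i" for i
  define A' where "A' i = As' ! i" for i
  have *: "A i \<subseteq> V1 \<union> V2" "A' i \<subseteq> V1' \<union> V2'" if "i < length As" for i
    using order_trans[OF Union_upper[OF nth_mem] sub(1)] order_trans[OF Union_upper[OF nth_mem] sub(2)] that len
    by (simp_all add: A_def A'_def)
  have u1: "(A i \<inter> V1 = {} \<longleftrightarrow> A' i \<inter> V1' = {})" "(is_singleton (A i \<inter> V1) \<longleftrightarrow> is_singleton (A' i \<inter> V1'))"
    "(r1 \<in> A i \<inter> V1 \<longleftrightarrow> r1' \<in> A' i \<inter> V1')"
    "(A i \<inter> V2 = {} \<longleftrightarrow> A' i \<inter> V2' = {})" "(is_singleton (A i \<inter> V2) \<longleftrightarrow> is_singleton (A' i \<inter> V2'))"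
    "(r2 \<in> A i \<inter> V2 \<longleftrightarrow> r2' \<in> A' i \<inter> V2')"
    if "i < length As" for i
    using 1[unfolded agree_def, THEN conjunct2, rule_format, of i] 2[unfolded agree_def, THEN conjunct2, rule_format, of i]
      that len by (simp_all add: A_def A'_def)
  have u2: "sing_mem (A i \<inter> V1) (A j \<inter> V1) = sing_mem (A' i \<inter> V1') (A' j \<inter> V1')"
    "sing_mem (A i \<inter> V2) (A j \<inter> V2) = sing_mem (A' i \<inter> V2') (A' j \<inter> V2')"
    "sing_adj E (A i \<inter> V1) (A j \<inter> V1) = sing_adj E' (A' i \<inter> V1') (A' j \<inter> V1')"
    "sing_adj E (A i \<inter> V2) (A j \<inter> V2) = sing_adj E' (A' i \<inter> V2') (A' j \<inter> V2')"
    if "i < length As" "j < length As" "i \<noteq> j" for i j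
    using 1[unfolded agree_def, THEN conjunct2, rule_format, of i, THEN conjunct2, THEN conjunct2, THEN conjunct2, rule_format, of j]
      2[unfolded agree_def, THEN conjunct2, rule_format, of i, THEN conjunct2, THEN conjunct2, THEN conjunct2, rule_format, of j]
      that len by (simp_all add: A_def A'_def)
  have "A i = {} \<longleftrightarrow> A' i = {}" if "i < length As" for i
    unfolding singleton_split(1)[OF *(1)[OF that] disj(1)] singleton_split(1)[OF *(2)[OF that] disj(2)] u1[OF that] ..
  moreover have "is_singleton (A i) \<longleftrightarrow> is_singleton (A' i)" if "i < length As" for i
    unfolding is_singleton_split[OF *(1)[OF that] disj(1)] is_singleton_split[OF *(2)[OF that] disj(2)] u1[OF that] ..
  moreover have "r1 \<in> A i \<longleftrightarrow> r1' \<in> A' i" if "i < length As" for i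
    using u1(3)[OF that] r *[OF that] by blast
  moreover have "sing_mem (A i) (A j) = sing_mem (A' i) (A' j)"
    if "i < length As" "j < length As" "i \<noteq> j" for i j
    unfolding mem_split[OF *(1)[OF that(1)] disj(1)] mem_split[OF *(2)[OF that(1)] disj(2)] u1[OF that(1)] u2[OF that] ..
  moreover have "sing_adj E (A i) (A j) = sing_adj E' (A' i) (A' j)"
    if "i < length As" "j < length As" "i \<noteq> j" for i j
    unfolding adj_split[OF *(1)[OF that(1)] *(1)[OF that(2)] disj(1) cross]
      adj_split[OF *(2)[OF that(1)] *(2)[OF that(2)] disj(2) cross']
    unfolding u1[OF that(1)] u1[OF that(2)] u2[OF that] ..
  ultimately show ?thesis
    unfolding agree_def A_def A'_def using len by (intro conjI allI impI) simp_all
qed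

text \<open>The reply is the union of the replies in the two parts. The goal is an abstract
  \<open>P\<close> so that the same lemma serves both directions of the back-and-forth
  argument.\<close>

lemma tp_join_move:
  assumes e: "tp (Suc j) V1 E r1 (restr V1 As) = tp (Suc j) V1' E' r1' (restr V1' As')"
      "tp (Suc j) V2 E r2 (restr V2 As) = tp (Suc j) V2' E' r2' (restr V2' As')"
    and fin: "finite V1" "finite V2" "finite V1'" "finite V2'"
    and disj: "V1' \<inter> V2' = {}"
    and P: "\<And>B'. B' \<subseteq> V1' \<union> V2' \<Longrightarrow>
      tp j V1 E r1 (restr V1 (As @ [B])) = tp j V1' E' r1' (restr V1' (As' @ [B'])) \<Longrightarrow>
      tp j V2 E r2 (restr V2 (As @ [B])) = tp j V2' E' r2' (restr V2' (As' @ [B'])) \<Longrightarrow> P B'"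
  shows "\<exists>B'\<subseteq>V1' \<union> V2'. P B'"
proof -
  obtain B1 where B1: "B1 \<subseteq> V1'" "tp j V1 E r1 (restr V1 As @ [B \<inter> V1]) = tp j V1' E' r1' (restr V1' As' @ [B1])"
    using tp_SucD[OF e(1) fin(1,3), of "B \<inter> V1"] by blast
  obtain B2 where B2: "B2 \<subseteq> V2'" "tp j V2 E r2 (restr V2 As @ [B \<inter> V2]) = tp j V2' E' r2' (restr V2' As' @ [B2])"
    using tp_SucD[OF e(2) fin(2,4), of "B \<inter> V2"] by blast
  have eq: "(B1 \<union> B2) \<inter> V1' = B1" "(B1 \<union> B2) \<inter> V2' = B2" using B1(1) B2(1) disj by blast+
  have sub: "B1 \<union> B2 \<subseteq> V1' \<union> V2'" using B1(1) B2(1) by blast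
  have "P (B1 \<union> B2)" by (rule P[OF sub]) (simp_all add: eq B1 B2)
  then show ?thesis using sub by blast
qed

text \<open>Duplicator follows separate strategies in \<open>V1\<close> and \<open>V2\<close>.
  \<open>b = True\<close> hangs \<open>V2\<close> as a branch below \<open>r1\<close>,
  \<open>b = False\<close> leaves the parts unconnected; in both cases \<open>r1\<close> is the root
  of the whole.\<close>

lemma tp_join:
  assumes "tp j V1 E r1 (restr V1 As) = tp j V1' E' r1' (restr V1' As')"
    and "tp j V2 E r2 (restr V2 As) = tp j V2' E' r2' (restr V2' As')"
    and "length As = length As'"
    and "\<Union> (set As) \<subseteq> V1 \<union> V2" "\<Union> (set As') \<subseteq> V1' \<union> V2'"
    and fin: "finite V1" "finite V2" "finite V1'" "finite V2'"
    and disj: "V1 \<inter> V2 = {}" "V1' \<inter> V2' = {}" and r: "r1 \<notin> V2" "r1' \<notin> V2'"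
    and cross: "\<forall>u\<in>V1. \<forall>v\<in>V2. {u, v} \<in> E \<longleftrightarrow> b \<and> u = r1 \<and> v = r2"
    and cross': "\<forall>u\<in>V1'. \<forall>v\<in>V2'. {u, v} \<in> E' \<longleftrightarrow> b \<and> u = r1' \<and> v = r2'"
  shows "tp j (V1 \<union> V2) E r1 As = tp j (V1' \<union> V2') E' r1' As'"
  using assms(1-5)
proof (induction j arbitrary: As As')
  case 0
  have *: "length (restr V1 As) = length (restr V1' As')"
    "length (restr V2 As) = length (restr V2' As')"
    using 0(3) by simp_all
  show ?case
    unfolding tp_0_eq_iff[OF 0(3)]
    by (rule agree_join[OF 0(1,2)[unfolded tp_0_eq_iff[OF *(1)] tp_0_eq_iff[OF *(2)]]
        disj r 0(4,5) cross cross'])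
next
  case (Suc j)
  have IH: "tp j (V1 \<union> V2) E r1 (As @ [B]) = tp j (V1' \<union> V2') E' r1' (As' @ [B'])"
    if "B \<subseteq> V1 \<union> V2" "B' \<subseteq> V1' \<union> V2'"
      "tp j V1 E r1 (restr V1 (As @ [B])) = tp j V1' E' r1' (restr V1' (As' @ [B']))"
      "tp j V2 E r2 (restr V2 (As @ [B])) = tp j V2' E' r2' (restr V2' (As' @ [B']))" for B B'
    using that(1,2) Suc.prems(3-5) by (intro Suc.IH that(3,4)) auto
  show ?case
  proof (rule tp_SucI)
    fix B assume B: "B \<subseteq> V1 \<union> V2"
    show "\<exists>B'\<subseteq>V1' \<union> V2'. tp j (V1 \<union> V2) E r1 (As @ [B]) = tp j (V1' \<union> V2') E' r1' (As' @ [B'])"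
      by (intro tp_join_move[where B = B, OF Suc.prems(1,2) fin disj(2)] IH B; assumption)
  next
    fix B assume B: "B \<subseteq> V1' \<union> V2'"
    show "\<exists>B'\<subseteq>V1 \<union> V2. tp j (V1 \<union> V2) E r1 (As @ [B']) = tp j (V1' \<union> V2') E' r1' (As' @ [B])"
      by (intro tp_join_move[where B = B, OF Suc.prems(1,2)[symmetric] fin(3,4,1,2) disj(1)] IH B; (assumption | erule sym))
  qed
qed

section \<open>Disjoint unions, with parts counted up to a threshold\<close>

abbreviation cnt :: "('a \<Rightarrow> 'c) \<Rightarrow> 'a set \<Rightarrow> 'c \<Rightarrow> nat" where
  "cnt f A c \<equiv> card {x\<in>A. f x = c}"

text \<open>Duplicator's reply to a set move in a disjoint union: the colours of the components are
  the types that result from the move.\<close>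

lemma recolor:
  fixes f :: "'a \<Rightarrow> 'c" and A :: "'a set" and A' :: "'b set"
  assumes fin: "finite A" "finite A'" and "1 \<le> K" "1 \<le> m"
    and card: "min (K * m) (card A) = min (K * m) (card A')" and K: "card (f ` A) \<le> K"
  obtains f' where "f' ` A' \<subseteq> f ` A"
    "\<And>c. min m (cnt f A c) = min m (cnt f' A' c)"
proof (cases "card A = card A'")
  case True
  then obtain h where h: "bij_betw h A' A" using fin by (metis bij_betw_iff_card)
  have "bij_betw h {x\<in>A'. f (h x) = c} {x\<in>A. f x = c}" for c
    using h by (force simp: bij_betw_def inj_on_def)
  from bij_betw_same_card[OF this] have "cnt f A c = card {x\<in>A'. (f \<circ> h) x = c}" for c
    by simp
  then show thesis using h by (intro that[of "f \<circ> h"]) (auto simp: bij_betw_def)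
next
  case False
  then have big: "K * m \<le> card A" "K * m \<le> card A'" using card by (auto simp: min_def split: if_splits)
  \<comment> \<open>Up to \<open>m\<close> representatives of every colour are kept; they fix all
    counts up to \<open>m\<close>.\<close>
  define S where "S c = (SOME S. S \<subseteq> {x\<in>A. f x = c} \<and> card S = min m (cnt f A c))" for c
  have S: "S c \<subseteq> {x\<in>A. f x = c}" "card (S c) = min m (cnt f A c)" for c
  proof -
    have "\<exists>S. S \<subseteq> {x\<in>A. f x = c} \<and> card S = min m (cnt f A c)"
      by (meson min.cobounded2 obtain_subset_with_card_n)
    then have "S c \<subseteq> {x\<in>A. f x = c} \<and> card (S c) = min m (cnt f A c)"
      unfolding S_def by (rule someI_ex)
    then show "S c \<subseteq> {x\<in>A. f x = c}" "card (S c) = min m (cnt f A c)" by auto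
  qed
  \<comment> \<open>Pigeonhole: with fewer than \<open>m\<close> elements of each of at most
    \<open>K\<close> colours, \<open>A\<close> would have fewer than \<open>K * m\<close>
    elements.\<close>
  have "\<exists>c\<in>f ` A. m \<le> cnt f A c"
  proof (rule ccontr)
    assume *: "\<not> (\<exists>c\<in>f ` A. m \<le> cnt f A c)"
    have ne: "f ` A \<noteq> {}" using big(1) assms(3,4) by auto
    have "card A = (\<Sum>c\<in>f ` A. cnt f A c)"
      using sum.image_gen[OF fin(1), of "\<lambda>_. 1::nat" f] by simp
    also have "\<dots> < (\<Sum>c\<in>f ` A. m)"
      by (rule sum_strict_mono) (use fin * ne in auto)
    also have "\<dots> \<le> K * m" using K by simp
    finally show False using big(1) by simp
  qed
  then obtain c0 where c0: "c0 \<in> f ` A" "m \<le> cnt f A c0" by blast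
  define A0 where "A0 = (\<Union>c\<in>f ` A. S c)"
  have A0: "A0 \<subseteq> A" using S(1) by (auto simp: A0_def)
  have "card A0 \<le> (\<Sum>c\<in>f ` A. card (S c))"
    unfolding A0_def using fin by (intro card_UN_le) auto
  also have "\<dots> \<le> (\<Sum>c\<in>f ` A. m)" by (intro sum_mono) (simp add: S(2))
  also have "\<dots> \<le> card A'" using K big(2) by (simp add: le_trans[OF mult_le_mono1])
  finally obtain A0' where A0': "A0' \<subseteq> A'" "card A0' = card A0"
    by (meson obtain_subset_with_card_n)
  then obtain h where h: "bij_betw h A0' A0"
    using fin A0 by (metis bij_betw_iff_card finite_subset)
  \<comment> \<open>The surplus elements of \<open>A'\<close> get the colour \<open>c0\<close>,
    whose count has reached the threshold anyway.\<close>
  define f' where "f' x = (if x \<in> A0' then f (h x) else c0)" for x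
  show thesis
  proof (rule that)
    show "f' ` A' \<subseteq> f ` A" using h A0 c0 by (auto simp: f'_def bij_betw_def)
    fix c
    have Sc: "{x\<in>A0. f x = c} = S c" if "c \<in> f ` A"
    proof (intro equalityI subsetI)
      fix x assume "x \<in> {x\<in>A0. f x = c}"
      then obtain d where "x \<in> S d" "f x = c" by (auto simp: A0_def)
      moreover from this have "f x = d" using S(1)[of d] by blast
      ultimately show "x \<in> S c" by simp
    qed (use S(1)[of c] that in \<open>auto simp: A0_def\<close>)
    have "bij_betw h {x\<in>A0'. f (h x) = c} {x\<in>A0. f x = c}"
      using h by (force simp: bij_betw_def inj_on_def)
    then have eq: "card {x\<in>A0'. f (h x) = c} = cnt f A0 c"
      by (simp add: bij_betw_same_card)
    show "min m (cnt f A c) = min m (cnt f' A' c)"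
    proof (cases "c = c0")
      case True
      have "{x\<in>A0'. f (h x) = c} \<subseteq> {x\<in>A'. f' x = c}" using A0' by (auto simp: f'_def)
      then have "cnt f A0 c \<le> cnt f' A' c"
        unfolding eq[symmetric] using fin by (intro card_mono) auto
      then have "m \<le> cnt f' A' c" using S(2)[of c0] c0 Sc True by simp
      then show ?thesis using c0 True by simp
    next
      case False
      then have "{x\<in>A'. f' x = c} = {x\<in>A0'. f (h x) = c}" using A0' by (auto simp: f'_def)
      then have *: "cnt f' A' c = cnt f A0 c" using eq by simp
      show ?thesis
      proof (cases "c \<in> f ` A")
        case True
        then show ?thesis using * Sc S(2)[of c] by simp
      next
        case False
        then have "{x\<in>A. f x = c} = {}" "{x\<in>A0. f x = c} = {}" using A0 by auto
        then show ?thesis by (simp only: *)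
      qed
    qed
  qed
qed

lemma min_add_cong:
  fixes m :: nat
  shows "min m a = min m a' \<Longrightarrow> min m b = min m b' \<Longrightarrow> min m (a + b) = min m (a' + b')"
  by (auto simp: min_def split: if_splits)

lemma min_sum_cong:
  fixes m :: nat
  assumes "\<And>q. q \<in> Q \<Longrightarrow> min m (g q) = min m (g' q)"
  shows "min m (sum g Q) = min m (sum g' Q)"
  using assms by (induction Q rule: infinite_finite_induct) (auto intro: min_add_cong)

text \<open>A part can only be given a colour that occurs on a part of its own old type. Recolouring
  is therefore done inside each class of \<open>q\<close>, and equality of counts up to
  \<open>m\<close> survives summation over the classes.\<close>

lemma recolor_classes:
  fixes X :: "'a set" and X' :: "'b set" and q :: "'a \<Rightarrow> 'q" and f :: "'a \<Rightarrow> 'c"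
  assumes fin: "finite X" "finite X'" and Km: "1 \<le> K" "1 \<le> m"
    and cap: "\<And>t. min (K * m) (cnt q X t) = min (K * m) (cnt q' X' t)"
    and K: "card (f ` X) \<le> K"
  obtains f' where "\<And>x'. x' \<in> X' \<Longrightarrow> \<exists>x\<in>X. q x = q' x' \<and> f x = f' x'"
    "\<And>c. min m (cnt f X c) = min m (cnt f' X' c)"
proof -
  have "\<forall>t. \<exists>F. F ` {x\<in>X'. q' x = t} \<subseteq> f ` {x\<in>X. q x = t} \<and>
     (\<forall>c. min m (card {x\<in>{x\<in>X. q x = t}. f x = c}) = min m (card {x\<in>{x\<in>X'. q' x = t}. F x = c}))"
  proof
    fix t
    have le: "card (f ` {x\<in>X. q x = t}) \<le> K"
      using fin by (intro order_trans[OF card_mono K]) auto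
    have fin': "finite {x\<in>X. q x = t}" "finite {x\<in>X'. q' x = t}" using fin by auto
    obtain F where "F ` {x\<in>X'. q' x = t} \<subseteq> f ` {x\<in>X. q x = t}"
      "\<And>c. min m (card {x\<in>{x\<in>X. q x = t}. f x = c}) = min m (card {x\<in>{x\<in>X'. q' x = t}. F x = c})"
      by (rule recolor[OF fin' Km cap[of t] le]) (erule that, simp)
    then show "\<exists>F. F ` {x\<in>X'. q' x = t} \<subseteq> f ` {x\<in>X. q x = t} \<and>
     (\<forall>c. min m (card {x\<in>{x\<in>X. q x = t}. f x = c}) = min m (card {x\<in>{x\<in>X'. q' x = t}. F x = c}))"
      by (intro exI[of _ F] conjI allI)
  qed
  from choice[OF this] obtain F where "\<forall>t. F t ` {x\<in>X'. q' x = t} \<subseteq> f ` {x\<in>X. q x = t} \<and>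
     (\<forall>c. min m (card {x\<in>{x\<in>X. q x = t}. f x = c}) = min m (card {x\<in>{x\<in>X'. q' x = t}. F t x = c}))" ..
  then have F: "F t ` {x\<in>X'. q' x = t} \<subseteq> f ` {x\<in>X. q x = t}"
    "min m (card {x\<in>{x\<in>X. q x = t}. f x = c}) = min m (card {x\<in>{x\<in>X'. q' x = t}. F t x = c})" for t c
    by blast+
  define f' where "f' x = F (q' x) x" for x
  define T where "T = q ` X \<union> q' ` X'"
  have T: "finite T" using fin by (simp add: T_def)
  show thesis
  proof (rule that)
    fix x' assume "x' \<in> X'"
    then have "f' x' \<in> f ` {x\<in>X. q x = q' x'}" using F(1)[of "q' x'"] by (auto simp: f'_def)
    then show "\<exists>x\<in>X. q x = q' x' \<and> f x = f' x'" by auto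
  next
    fix c
    have 1: "cnt f X c = (\<Sum>t\<in>T. card {x\<in>{x\<in>X. q x = t}. f x = c})"
    proof -
      have "(\<Sum>t\<in>T. \<Sum>x | x \<in> {x\<in>X. f x = c} \<and> q x = t. 1::nat) = (\<Sum>x\<in>{x\<in>X. f x = c}. 1)"
        by (rule sum.group) (use fin T in \<open>auto simp: T_def\<close>)
      then show ?thesis by (simp add: conj_ac)
    qed
    have 2: "cnt f' X' c = (\<Sum>t\<in>T. card {x\<in>{x\<in>X'. q' x = t}. F t x = c})"
    proof -
      have "(\<Sum>t\<in>T. \<Sum>x | x \<in> {x\<in>X'. f' x = c} \<and> q' x = t. 1::nat) = (\<Sum>x\<in>{x\<in>X'. f' x = c}. 1)"
        by (rule sum.group) (use fin T in \<open>auto simp: T_def\<close>)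
      moreover have "{x \<in> {x\<in>X'. f' x = c}. q' x = t} = {x\<in>{x\<in>X'. q' x = t}. F t x = c}" for t
        by (auto simp: f'_def)
      ultimately show ?thesis by simp
    qed
    show "min m (cnt f X c) = min m (cnt f' X' c)"
      unfolding 1 2 by (rule min_sum_cong) (rule F(2))
  qed
qed

definition parts :: "'v set set \<Rightarrow> 'v set set \<Rightarrow> bool" where
  "parts E \<D> \<longleftrightarrow> finite \<D> \<and> (\<forall>D\<in>\<D>. finite D) \<and>
     (\<forall>D\<in>\<D>. \<forall>D'\<in>\<D>. D \<noteq> D' \<longrightarrow> D \<inter> D' = {} \<and> (\<forall>u\<in>D. \<forall>v\<in>D'. {u, v} \<notin> E))"

lemma parts_singleton_iff:
  assumes "parts E \<D>" "A \<subseteq> \<Union>\<D>"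
  shows "A = {v} \<longleftrightarrow> (\<exists>D\<in>\<D>. A \<inter> D = {v} \<and> (\<forall>F\<in>\<D> - {D}. A \<inter> F = {}))"
proof
  assume A: "A = {v}"
  then obtain D where "D \<in> \<D>" "v \<in> D" using assms by auto
  then show "\<exists>D\<in>\<D>. A \<inter> D = {v} \<and> (\<forall>F\<in>\<D> - {D}. A \<inter> F = {})"
    using assms(1) A unfolding parts_def by (intro bexI[of _ D]) auto
next
  assume "\<exists>D\<in>\<D>. A \<inter> D = {v} \<and> (\<forall>F\<in>\<D> - {D}. A \<inter> F = {})"
  then obtain D where D: "D \<in> \<D>" "A \<inter> D = {v}" "\<forall>F\<in>\<D> - {D}. A \<inter> F = {}" by blast
  have "x \<in> D" if x: "x \<in> A" for x
  proof -
    obtain F where F: "F \<in> \<D>" "x \<in> F" using x assms(2) by blast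
    then have "F = D" using D(3) x by (metis DiffI IntI empty_iff singletonD)
    then show ?thesis using F by simp
  qed
  then show "A = {v}" using D(2) by blast
qed

lemma ex_bex_swap: "(\<exists>v. \<exists>D\<in>X. P D v \<and> Q D) \<longleftrightarrow> (\<exists>D\<in>X. (\<exists>v. P D v) \<and> Q D)"
  and ex_bex_swap': "(\<exists>v. (\<exists>D\<in>X. P D v \<and> Q D) \<and> R v) \<longleftrightarrow> (\<exists>D\<in>X. (\<exists>v. P D v \<and> R v) \<and> Q D)"
  by blast+

lemma parts_is_singleton_iff:
  assumes "parts E \<D>" "A \<subseteq> \<Union>\<D>"
  shows "is_singleton A \<longleftrightarrow> (\<exists>D\<in>\<D>. is_singleton (A \<inter> D) \<and> (\<forall>F\<in>\<D> - {D}. A \<inter> F = {}))"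
  unfolding is_singleton_def parts_singleton_iff[OF assms]
  by (rule ex_bex_swap)

lemma parts_mem_iff:
  assumes "parts E \<D>" "A \<subseteq> \<Union>\<D>"
  shows "sing_mem A B \<longleftrightarrow>
    (\<exists>D\<in>\<D>. sing_mem (A \<inter> D) (B \<inter> D) \<and> (\<forall>F\<in>\<D> - {D}. A \<inter> F = {}))"
proof -
  have *: "A \<inter> D = {v} \<and> v \<in> B \<inter> D \<longleftrightarrow> A \<inter> D = {v} \<and> v \<in> B" for D v by auto
  show ?thesis unfolding parts_singleton_iff[OF assms] * by (rule ex_bex_swap')
qed

lemma parts_adj_iff:
  assumes "parts E \<D>" "A \<subseteq> \<Union>\<D>" "B \<subseteq> \<Union>\<D>"
  shows "sing_adj E A B \<longleftrightarrow>
    (\<exists>D\<in>\<D>. sing_adj E (A \<inter> D) (B \<inter> D) \<and>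
      (\<forall>F\<in>\<D> - {D}. A \<inter> F = {} \<and> B \<inter> F = {}))" (is "?L \<longleftrightarrow> ?R")
proof
  assume ?L
  then obtain u v where uv: "A = {u}" "B = {v}" "{u, v} \<in> E" by blast
  obtain D where D: "D \<in> \<D>" "A \<inter> D = {u}" "\<forall>F\<in>\<D> - {D}. A \<inter> F = {}"
    using iffD1[OF parts_singleton_iff[OF assms(1,2)] uv(1)] by blast
  obtain D' where D': "D' \<in> \<D>" "B \<inter> D' = {v}" "\<forall>F\<in>\<D> - {D'}. B \<inter> F = {}"
    using iffD1[OF parts_singleton_iff[OF assms(1,3)] uv(2)] by blast
  have "u \<in> D" "v \<in> D'" using D(2) D'(2) by blast+
  then have eq: "D' = D" using assms(1) uv(3) D(1) D'(1) unfolding parts_def by blast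
  show ?R
    by (rule bexI[OF _ D(1)]) (use D(2,3) D'(2,3) uv(3) in \<open>simp add: eq\<close>)
next
  assume ?R
  then obtain D u v where "D \<in> \<D>" "A \<inter> D = {u}" "B \<inter> D = {v}" "{u, v} \<in> E"
    "\<forall>F\<in>\<D> - {D}. A \<inter> F = {} \<and> B \<inter> F = {}" by blast
  then have "\<exists>D\<in>\<D>. A \<inter> D = {u} \<and> (\<forall>F\<in>\<D> - {D}. A \<inter> F = {})"
    "\<exists>D\<in>\<D>. B \<inter> D = {v} \<and> (\<forall>F\<in>\<D> - {D}. B \<inter> F = {})" by (intro bexI[of _ D]; simp)+
  then have "A = {u}" "B = {v}"
    by (simp_all only: parts_singleton_iff[OF assms(1,2)] parts_singleton_iff[OF assms(1,3)])
  then show ?L using \<open>{u, v} \<in> E\<close> by blast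
qed

text \<open>A threshold of 1 would not do: if a second part has the type of the witness,
  \<open>R\<close> is demanded of that type as well, so one and several parts of a type must be told
  apart.\<close>

lemma cap_ex_transfer:
  assumes fin: "finite X" "finite X'"
    and cap: "\<And>q. min 2 (cnt t X q) = min 2 (cnt t' X' q)"
    and P: "\<And>D D'. D \<in> X \<Longrightarrow> D' \<in> X' \<Longrightarrow> t D = t' D' \<Longrightarrow> P D \<Longrightarrow> P' D'"
    and R: "\<And>D D'. D \<in> X \<Longrightarrow> D' \<in> X' \<Longrightarrow> t D = t' D' \<Longrightarrow> R D \<Longrightarrow> R' D'"
    and ex: "\<exists>D\<in>X. P D \<and> (\<forall>F\<in>X - {D}. R F)"
  shows "\<exists>D\<in>X'. P' D \<and> (\<forall>F\<in>X' - {D}. R' F)"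
proof -
  obtain D where D: "D \<in> X" "P D" "\<forall>F\<in>X - {D}. R F" using ex by blast
  have "D \<in> {F\<in>X. t F = t D}" using D by simp
  then have "cnt t X (t D) \<noteq> 0" using fin by (simp add: card_eq_0_iff) blast
  then have "cnt t' X' (t D) \<noteq> 0" using cap[of "t D"] by auto
  then have "{F\<in>X'. t' F = t D} \<noteq> {}" by (metis card.empty)
  then obtain D' where D': "D' \<in> X'" "t' D' = t D" by blast
  have "R' F'" if F': "F' \<in> X' - {D'}" for F'
  proof -
    have "\<exists>F\<in>X - {D}. t F = t' F'"
    proof (cases "t' F' = t D")
      case False
      have "F' \<in> {F\<in>X'. t' F = t' F'}" using F' by simp
      then have "cnt t' X' (t' F') \<noteq> 0" using fin by (simp add: card_eq_0_iff) blast
      then have "cnt t X (t' F') \<noteq> 0" using cap[of "t' F'"] by auto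
      then have "{F\<in>X. t F = t' F'} \<noteq> {}" by (metis card.empty)
      then show ?thesis using False by auto
    next
      case True
      have "{D', F'} \<subseteq> {F\<in>X'. t' F = t D}" "D' \<noteq> F'" using True D' F' by auto
      then have "2 \<le> cnt t' X' (t D)"
        using card_mono[of "{F\<in>X'. t' F = t D}" "{D', F'}"] fin by simp
      then have "2 \<le> cnt t X (t D)" using cap[of "t D"] by auto
      then have "\<not> {F\<in>X. t F = t D} \<subseteq> {D}"
        using card_mono[of "{D}" "{F\<in>X. t F = t D}"] by auto
      then show ?thesis using True by auto
    qed
    then obtain F where "F \<in> X - {D}" "t F = t' F'" by blast
    then show ?thesis using R[of F F'] D(3) F' by simp
  qed
  then show ?thesis using P[of D D'] D D' by auto
qed

text \<open>Apart from root membership, which fails on both sides, each atom of a union or its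
  negation says that one part satisfies some \<open>P\<close> and all others some \<open>R\<close>,
  both determined by the atoms of the part.\<close>

lemma agree_parts:
  assumes parts: "parts E \<D>" "parts E' \<D>'" and len: "length As = length As'"
    and sub: "\<Union> (set As) \<subseteq> \<Union>\<D>" "\<Union> (set As') \<subseteq> \<Union>\<D>'" and r: "r \<notin> \<Union>\<D>" "r' \<notin> \<Union>\<D>'"
    and cap: "\<And>q. min 2 (card {D\<in>\<D>. tp 0 D E r (restr D As) = q}) =
        min 2 (card {D\<in>\<D>'. tp 0 D E' r' (restr D As') = q})"
  shows "agree E r As E' r' As'"
proof -
  define A where "A i = As ! i" for i
  define A' where "A' i = As' ! i" for i
  let ?t = "\<lambda>D. tp 0 D E r (restr D As)" and ?t' = "\<lambda>D. tp 0 D E' r' (restr D As')"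
  have fin: "finite \<D>" "finite \<D>'" using parts by (auto simp: parts_def)
  have * : "A i \<subseteq> \<Union>\<D>" "A' i \<subseteq> \<Union>\<D>'" if "i < length As" for i
    using order_trans[OF Union_upper[OF nth_mem] sub(1)] order_trans[OF Union_upper[OF nth_mem] sub(2)] that len
    by (simp_all add: A_def A'_def)
  have ag: "agree E r (restr D As) E' r' (restr D' As')" if "?t D = ?t' D'" for D D'
    using that tp_0_eq_iff[of "restr D As" "restr D' As'"] len by simp
  have u1: "(A i \<inter> D = {} \<longleftrightarrow> A' i \<inter> D' = {})" "(is_singleton (A i \<inter> D) \<longleftrightarrow> is_singleton (A' i \<inter> D'))"
    if "i < length As" "?t D = ?t' D'" for i D D'
    using ag[OF that(2), unfolded agree_def, THEN conjunct2, rule_format, of i]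
      that(1) len by (simp_all add: A_def A'_def)
  have u2: "sing_mem (A i \<inter> D) (A j \<inter> D) = sing_mem (A' i \<inter> D') (A' j \<inter> D')"
    "sing_adj E (A i \<inter> D) (A j \<inter> D) = sing_adj E' (A' i \<inter> D') (A' j \<inter> D')"
    if "i < length As" "j < length As" "i \<noteq> j" "?t D = ?t' D'" for i j D D'
    using ag[OF that(4), unfolded agree_def, THEN conjunct2, rule_format, of i, THEN conjunct2, THEN conjunct2, THEN conjunct2, rule_format, of j]
      that(1-3) len by (simp_all add: A_def A'_def)
  have transfer: "(\<exists>D\<in>\<D>. P D \<and> (\<forall>F\<in>\<D> - {D}. R F)) \<longleftrightarrow> (\<exists>D\<in>\<D>'. P' D \<and> (\<forall>F\<in>\<D>' - {D}. R' F))"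
    if "\<And>D D'. ?t D = ?t' D' \<Longrightarrow> P D = P' D'" "\<And>D D'. ?t D = ?t' D' \<Longrightarrow> R D = R' D'" for P P' R R'
  proof
    assume "\<exists>D\<in>\<D>. P D \<and> (\<forall>F\<in>\<D> - {D}. R F)"
    then show "\<exists>D\<in>\<D>'. P' D \<and> (\<forall>F\<in>\<D>' - {D}. R' F)"
      using that by (intro cap_ex_transfer[where t = ?t and t' = ?t' and P = P and R = R, OF fin cap]) blast+
  next
    assume "\<exists>D\<in>\<D>'. P' D \<and> (\<forall>F\<in>\<D>' - {D}. R' F)"
    then show "\<exists>D\<in>\<D>. P D \<and> (\<forall>F\<in>\<D> - {D}. R F)"
      by (intro cap_ex_transfer[where t = ?t' and t' = ?t and P = P' and R = R', OF fin(2,1) cap[symmetric]])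
        (use that[OF sym] in blast)+
  qed
  have "A i = {} \<longleftrightarrow> A' i = {}" if i: "i < length As" for i
  proof -
    \<comment> \<open>The trivial demand on the other parts only brings nonemptiness into the shape
      that \<open>transfer\<close> expects.\<close>
    have "A i = {} \<longleftrightarrow> \<not> (\<exists>D\<in>\<D>. A i \<inter> D \<noteq> {} \<and> (\<forall>F\<in>\<D> - {D}. True))" using *(1)[OF i] by auto
    also have "\<dots> \<longleftrightarrow> \<not> (\<exists>D\<in>\<D>'. A' i \<inter> D \<noteq> {} \<and> (\<forall>F\<in>\<D>' - {D}. True))"
      using u1(1)[OF i] by (intro arg_cong[where f = Not] transfer) simp_all
    also have "\<dots> \<longleftrightarrow> A' i = {}" using *(2)[OF i] by auto
    finally show ?thesis .
  qed
  moreover have "is_singleton (A i) \<longleftrightarrow> is_singleton (A' i)" if "i < length As" for i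
    unfolding parts_is_singleton_iff[OF parts(1) *(1)[OF that]] parts_is_singleton_iff[OF parts(2) *(2)[OF that]]
    by (rule transfer) (simp_all add: u1 that)
  moreover have "r \<in> A i \<longleftrightarrow> r' \<in> A' i" if "i < length As" for i
    using r *[OF that] by blast
  moreover have "sing_mem (A i) (A j) = sing_mem (A' i) (A' j)"
    if "i < length As" "j < length As" "i \<noteq> j" for i j
    unfolding parts_mem_iff[OF parts(1) *(1)[OF that(1)]] parts_mem_iff[OF parts(2) *(2)[OF that(1)]]
    by (rule transfer) (simp_all only: u1 u2 that not_False_eq_True)
  moreover have "sing_adj E (A i) (A j) = sing_adj E' (A' i) (A' j)"
    if "i < length As" "j < length As" "i \<noteq> j" for i j
    unfolding parts_adj_iff[OF parts(1) *(1)[OF that(1)] *(1)[OF that(2)]]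
      parts_adj_iff[OF parts(2) *(2)[OF that(1)] *(2)[OF that(2)]]
    by (rule transfer) (simp_all only: u1 u2 that not_False_eq_True)
  ultimately show ?thesis
    unfolding agree_def A_def A'_def using len by (intro conjI allI impI) simp_all
qed

text \<open>A whole graph has no root; a vertex outside of all parts takes its place in
  \<open>tp\<close>.\<close>

definition cap_equiv :: "nat \<Rightarrow> nat \<Rightarrow> 'v set set \<Rightarrow> 'v \<Rightarrow> 'v set set \<Rightarrow> 'v set list \<Rightarrow>
    'v set set \<Rightarrow> 'v \<Rightarrow> 'v set set \<Rightarrow> 'v set list \<Rightarrow> bool" where
  "cap_equiv j m E r \<D> As E' r' \<D>' As' \<longleftrightarrow> parts E \<D> \<and> parts E' \<D>' \<and> length As = length As' \<and>
     \<Union> (set As) \<subseteq> \<Union>\<D> \<and> \<Union> (set As') \<subseteq> \<Union>\<D>' \<and> r \<notin> \<Union>\<D> \<and> r' \<notin> \<Union>\<D>' \<and>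
     (\<forall>q. min m (card {D\<in>\<D>. tp j D E r (restr D As) = q}) =
        min m (card {D\<in>\<D>'. tp j D E' r' (restr D As') = q}))"

lemma cap_equiv_sym: "cap_equiv j m E r \<D> As E' r' \<D>' As' \<Longrightarrow> cap_equiv j m E' r' \<D>' As' E r \<D> As"
  by (simp add: cap_equiv_def)

text \<open>\<open>recolor_classes\<close> names for each part of the second union the type to aim
  at, and equality of types of rank \<open>Suc j\<close> makes this type attainable inside the part.
  The threshold shrinks by the factor \<open>K\<close> because the parts of one type spread over at
  most \<open>K\<close> types after the move.\<close>

lemma cap_equiv_step:
  assumes eqv: "cap_equiv (Suc j) (K * m) E r \<D> As E' r' \<D>' As'" and "1 \<le> K" "1 \<le> m"
    and K: "tp_bound j (Suc (length As + j)) \<le> K"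
    and B: "B \<subseteq> \<Union>\<D>"
  obtains B' where "B' \<subseteq> \<Union>\<D>'" "cap_equiv j m E r \<D> (As @ [B]) E' r' \<D>' (As' @ [B'])"
proof -
  note e = eqv[unfolded cap_equiv_def]
  have parts: "parts E \<D>" "parts E' \<D>'" using e by auto
  have fin: "finite \<D>" "finite \<D>'" "\<And>D. D \<in> \<D> \<Longrightarrow> finite D" "\<And>D. D \<in> \<D>' \<Longrightarrow> finite D"
    using parts by (auto simp: parts_def)
  define f where "f D = tp j D E r (restr D (As @ [B]))" for D
  have "f D < K" if "D \<in> \<D>" for D
    unfolding f_def by (rule less_le_trans[OF tp_less K]) (use that fin in auto)
  then have "f ` \<D> \<subseteq> {..<K}" by auto
  then have cardf: "card (f ` \<D>) \<le> K" using card_mono[of "{..<K}" "f ` \<D>"] by simp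
  obtain f' where f': "\<And>D'. D' \<in> \<D>' \<Longrightarrow> \<exists>D\<in>\<D>. tp (Suc j) D E r (restr D As) =
        tp (Suc j) D' E' r' (restr D' As') \<and> f D = f' D'"
    "\<And>c. min m (cnt f \<D> c) = min m (cnt f' \<D>' c)"
    using recolor_classes[of \<D> \<D>' K m "\<lambda>D. tp (Suc j) D E r (restr D As)"
        "\<lambda>D. tp (Suc j) D E' r' (restr D As')" f] fin(1,2) assms(2,3) e cardf by blast
  have "\<exists>C. C \<subseteq> D' \<and> tp j D' E' r' (restr D' As' @ [C]) = f' D'" if D': "D' \<in> \<D>'" for D'
  proof -
    obtain D where D: "D \<in> \<D>" "tp (Suc j) D E r (restr D As) =
        tp (Suc j) D' E' r' (restr D' As')" "f D = f' D'"
      using f'(1)[OF D'] by blast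
    obtain C where "C \<subseteq> D'" "tp j D E r (restr D As @ [B \<inter> D]) = tp j D' E' r' (restr D' As' @ [C])"
      by (rule tp_SucD[OF D(2), of "B \<inter> D"]) (use fin D(1) D' in auto)
    then show ?thesis using D(3) by (auto simp: f_def)
  qed
  then obtain C where C: "\<And>D'. D' \<in> \<D>' \<Longrightarrow> C D' \<subseteq> D'"
    "\<And>D'. D' \<in> \<D>' \<Longrightarrow> tp j D' E' r' (restr D' As' @ [C D']) = f' D'"
    by metis
  define B' where "B' = (\<Union>D\<in>\<D>'. C D)"
  have B': "B' \<subseteq> \<Union>\<D>'" using C(1) by (auto simp: B'_def)
  have "B' \<inter> D = C D" if D: "D \<in> \<D>'" for D
  proof (intro equalityI subsetI)
    fix x assume "x \<in> B' \<inter> D"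
    then obtain F where F: "F \<in> \<D>'" "x \<in> C F" "x \<in> D" by (auto simp: B'_def)
    then have "x \<in> F" using C(1) by blast
    then have "F = D" using parts(2) F D unfolding parts_def by blast
    then show "x \<in> C D" using F by simp
  qed (use D C(1) in \<open>auto simp: B'_def\<close>)
  then have "tp j D E' r' (restr D (As' @ [B'])) = f' D" if "D \<in> \<D>'" for D
    using C(2)[OF that] that by simp
  then have "{D\<in>\<D>'. tp j D E' r' (restr D (As' @ [B'])) = q} = {D\<in>\<D>'. f' D = q}" for q
    by auto
  then have "cap_equiv j m E r \<D> (As @ [B]) E' r' \<D>' (As' @ [B'])"
    unfolding cap_equiv_def using e B B' f'(2) by (simp add: f_def)
  with B' that show thesis by blast
qed

text \<open>The threshold must not depend on the graphs. It is 2 when no move is left, and each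
  earlier move multiplies it by a bound for the number of types after that move.\<close>

lemma tp_cap_equiv:
  "\<exists>m\<ge>1. \<forall>E r \<D> As E' r' \<D>' As'. cap_equiv j m E r \<D> As E' r' \<D>' As' \<and> length As = s \<longrightarrow>
     tp j (\<Union>\<D>) E r As = tp j (\<Union>\<D>') E' r' (As' :: 'v set list)"
proof (induction j arbitrary: s)
  case 0
  have "tp 0 (\<Union>\<D>) E r As = tp 0 (\<Union>\<D>') E' r' As'"
    if "cap_equiv 0 2 E r \<D> As E' r' \<D>' As'" for E r \<D> E' r' \<D>' and As As' :: "'v set list"
  proof -
    have "agree E r As E' r' As'"
      by (rule agree_parts[of E \<D> E' \<D>']) (use that in \<open>simp_all add: cap_equiv_def\<close>)
    then show ?thesis using that tp_0_eq_iff[of As As'] by (simp add: cap_equiv_def)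
  qed
  then show ?case by (intro exI[of _ 2] conjI allI impI) (simp, blast)
next
  case (Suc j)
  obtain m where m: "1 \<le> m" "\<And>E r \<D> As E' r' \<D>' As'. cap_equiv j m E r \<D> As E' r' \<D>' As' \<Longrightarrow> length As = Suc s \<Longrightarrow>
     tp j (\<Union>\<D>) E r As = tp j (\<Union>\<D>') E' r' (As' :: 'v set list)"
    using Suc.IH[of "Suc s"] by blast
  define K where "K = max 1 (tp_bound j (Suc (s + j)))"
  have K: "1 \<le> K" "tp_bound j (Suc (s + j)) \<le> K" by (auto simp: K_def)
  have "tp (Suc j) (\<Union>\<D>) E r As = tp (Suc j) (\<Union>\<D>') E' r' As'"
    if c: "cap_equiv (Suc j) (K * m) E r \<D> As E' r' \<D>' As'" and s: "length As = s"
    for E r \<D> E' r' \<D>' and As As' :: "'v set list"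
  proof (rule tp_SucI)
    have Ks: "tp_bound j (Suc (length As + j)) \<le> K" using K(2) s by simp
    fix B assume B: "B \<subseteq> \<Union>\<D>"
    obtain B' where "B' \<subseteq> \<Union>\<D>'" "cap_equiv j m E r \<D> (As @ [B]) E' r' \<D>' (As' @ [B'])"
      by (rule cap_equiv_step[OF c K(1) m(1) Ks B])
    then show "\<exists>B'\<subseteq>\<Union>\<D>'. tp j (\<Union>\<D>) E r (As @ [B]) = tp j (\<Union>\<D>') E' r' (As' @ [B'])"
      using m(2) s by (intro exI[of _ B']) simp
  next
    have s': "length As' = s" using c s by (simp add: cap_equiv_def)
    then have Ks: "tp_bound j (Suc (length As' + j)) \<le> K" using K(2) by simp
    fix B assume B: "B \<subseteq> \<Union>\<D>'"
    obtain B' where "B' \<subseteq> \<Union>\<D>" "cap_equiv j m E' r' \<D>' (As' @ [B]) E r \<D> (As @ [B'])"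
      by (rule cap_equiv_step[OF cap_equiv_sym[OF c] K(1) m(1) Ks B])
    then show "\<exists>B'\<subseteq>\<Union>\<D>. tp j (\<Union>\<D>) E r (As @ [B']) = tp j (\<Union>\<D>') E' r' (As' @ [B])"
      using m(2) s' by (intro exI[of _ B']) simp
  qed
  then show ?case using K(1) m(1) by (intro exI[of _ "K * m"]) auto
qed

section \<open>Rooted trees and their types\<close>

text \<open>\<open>Att a b\<close> hangs the tree \<open>b\<close> as a new branch below the root of \<open>a\<close>; a rooted tree is
  represented by several terms.\<close>

datatype bt = Leaf | Att bt bt

primrec nverts :: "bt \<Rightarrow> nat" where
  "nverts Leaf = 1"
| "nverts (Att a b) = nverts a + nverts b"

text \<open>Only edges inside \<open>V\<close> are constrained, so a component realizes its tree
  with the edge set of the whole graph.\<close>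

inductive realizes :: "bt \<Rightarrow> 'v set \<Rightarrow> 'v set set \<Rightarrow> 'v \<Rightarrow> bool" where
  Leaf: "{v} \<notin> E \<Longrightarrow> realizes Leaf {v} E v"
| Att: "realizes a V1 E r1 \<Longrightarrow> realizes b V2 E r2 \<Longrightarrow> V1 \<inter> V2 = {} \<Longrightarrow>
    (\<forall>u\<in>V1. \<forall>v\<in>V2. {u, v} \<in> E \<longleftrightarrow> u = r1 \<and> v = r2) \<Longrightarrow> realizes (Att a b) (V1 \<union> V2) E r1"

inductive_cases realizes_LeafE: "realizes Leaf V E r"
inductive_cases realizes_AttE: "realizes (Att a b) V E r"

lemma nverts_pos: "0 < nverts t"
  by (induction t) auto

lemma realizes_finite: "realizes t V E r \<Longrightarrow> finite V"
  by (induction rule: realizes.induct) auto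

lemma realizes_root: "realizes t V E r \<Longrightarrow> r \<in> V"
  by (induction rule: realizes.induct) auto

lemma realizes_card: "realizes t V E r \<Longrightarrow> card V = nverts t"
  by (induction rule: realizes.induct) (auto simp: card_Un_disjoint realizes_finite)

lemma realizes_cong:
  assumes "realizes t V E r" "\<And>u v. u \<in> V \<Longrightarrow> v \<in> V \<Longrightarrow> {u, v} \<in> E \<longleftrightarrow> {u, v} \<in> E'"
  shows "realizes t V E' r"
  using assms
proof (induction rule: realizes.induct)
  case (Leaf v E)
  then have "{v} \<notin> E'" using Leaf(2)[of v v] by simp
  then show ?case by (rule realizes.Leaf)
next
  case (Att a V1 E r1 b V2 r2)
  have "\<forall>u\<in>V1. \<forall>v\<in>V2. {u, v} \<in> E' \<longleftrightarrow> u = r1 \<and> v = r2"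
    using Att.hyps(4) Att.prems by simp
  then show ?case
    using Att.IH Att.prems Att.hyps(3) by (intro realizes.Att) auto
qed

text \<open>Connectedness without paths: a set that is closed under the edges inside
  \<open>V\<close> and meets \<open>V\<close> contains \<open>V\<close>.\<close>

lemma realizes_connected:
  assumes "realizes t V E r" "Z \<inter> V \<noteq> {}"
    and "\<And>u v. u \<in> V \<Longrightarrow> v \<in> V \<Longrightarrow> {u, v} \<in> E \<Longrightarrow> u \<in> Z \<Longrightarrow> v \<in> Z"
  shows "V \<subseteq> Z"
  using assms
proof (induction rule: realizes.induct)
  case (Att a V1 E r1 b V2 r2)
  have r: "r1 \<in> V1" "r2 \<in> V2" using Att.hyps(1,2) by (auto dest: realizes_root)
  then have "{r1, r2} \<in> E" "{r2, r1} \<in> E" using Att.hyps(4) by (auto simp: insert_commute)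
  then have rr: "r1 \<in> Z \<longleftrightarrow> r2 \<in> Z" using Att.prems(2) r by blast
  have 1: "V1 \<subseteq> Z" if "Z \<inter> V1 \<noteq> {}"
    using Att.IH(1)[OF that] Att.prems(2) by blast
  have 2: "V2 \<subseteq> Z" if "Z \<inter> V2 \<noteq> {}"
    using Att.IH(2)[OF that] Att.prems(2) by blast
  show ?case using 1 2 rr r Att.prems(1) by blast
qed auto

lemma realizes_card_edges:
  assumes "realizes t V E r" "\<And>e. e \<in> E \<Longrightarrow> card e = 2"
  shows "card (E \<inter> Pow V) + 1 = nverts t"
  using assms
proof (induction rule: realizes.induct)
  case (Leaf v E)
  have "E \<inter> Pow {v} = {}" using Leaf(1) Leaf(2)[of "{}"] by (auto simp: subset_singleton_iff)
  then show ?case by simp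
next
  case (Att a V1 E r1 b V2 r2)
  have r: "r1 \<in> V1" "r2 \<in> V2" using Att.hyps(1,2) by (auto dest: realizes_root)
  have fin: "finite V1" "finite V2" using Att.hyps(1,2) by (auto dest: realizes_finite)
  have "E \<inter> Pow (V1 \<union> V2) = insert {r1, r2} ((E \<inter> Pow V1) \<union> (E \<inter> Pow V2))"
  proof (intro equalityI subsetI)
    fix e assume e: "e \<in> E \<inter> Pow (V1 \<union> V2)"
    then obtain x y where xy: "e = {x, y}" using Att.prems by (metis IntD1 card_2_iff)
    then consider "x \<in> V1 \<and> y \<in> V1" | "x \<in> V2 \<and> y \<in> V2" | "x \<in> V1 \<and> y \<in> V2" | "y \<in> V1 \<and> x \<in> V2"
      using e by auto
    then show "e \<in> insert {r1, r2} ((E \<inter> Pow V1) \<union> (E \<inter> Pow V2))"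
    proof cases
      case 3
      then show ?thesis using Att.hyps(4) e xy by auto
    next
      case 4
      then have "y = r1 \<and> x = r2" using Att.hyps(4) e xy by (metis IntD1 insert_commute)
      then show ?thesis using xy by auto
    qed (use e xy in auto)
  next
    fix e assume "e \<in> insert {r1, r2} ((E \<inter> Pow V1) \<union> (E \<inter> Pow V2))"
    then show "e \<in> E \<inter> Pow (V1 \<union> V2)" using r Att.hyps(4) by auto
  qed
  moreover have "{r1, r2} \<notin> (E \<inter> Pow V1) \<union> (E \<inter> Pow V2)"
    using r Att.hyps(3) by auto
  moreover have "(E \<inter> Pow V1) \<inter> (E \<inter> Pow V2) = {}"
  proof -
    have "e = {}" if "e \<in> (E \<inter> Pow V1) \<inter> (E \<inter> Pow V2)" for e
      using that Att.hyps(3) by blast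
    then show ?thesis using Att.prems by fastforce
  qed
  ultimately show ?case
    using Att.IH[OF Att.prems] fin by (simp add: card_Un_disjoint)
qed

text \<open>Growth by a leaf at an arbitrary vertex, whereas \<open>Att\<close> only extends at the
  root; maximal trees are extended in this way.\<close>

lemma realizes_pendant:
  assumes "realizes t V E r" "w \<notin> V" "v \<in> V" "{w} \<notin> E"
    and "\<And>u. u \<in> V \<Longrightarrow> {u, w} \<in> E \<longleftrightarrow> u = v"
  shows "\<exists>t'. realizes t' (insert w V) E r"
  using assms
proof (induction rule: realizes.induct)
  case (Leaf x E)
  have "realizes (Att Leaf Leaf) ({x} \<union> {w}) E x"
    by (rule realizes.Att[OF realizes.Leaf realizes.Leaf])
      (use Leaf in auto)
  then show ?case by (auto simp: insert_commute)
next
  case (Att a V1 E r1 b V2 r2)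
  have r: "r1 \<in> V1" "r2 \<in> V2" using Att.hyps(1,2) by (auto dest: realizes_root)
  consider (1) "v \<in> V1" | (2) "v \<in> V2" using Att.prems by blast
  then show ?case
  proof cases
    case 1
    then obtain a' where a': "realizes a' (insert w V1) E r1"
      using Att.IH(1) Att.prems by auto
    have "v \<notin> V2" using 1 Att.hyps(3) by blast
    have "{w, u} \<notin> E" if "u \<in> V2" for u
      using Att.prems(4)[of u] that \<open>v \<notin> V2\<close> by (auto simp: insert_commute)
    then have "realizes (Att a' b) (insert w V1 \<union> V2) E r1"
      using Att.hyps Att.prems(1) r
      by (intro realizes.Att[OF a' Att.hyps(2)]) auto
    then show ?thesis by auto
  next
    case 2
    then obtain b' where b': "realizes b' (insert w V2) E r2"
      using Att.IH(2) Att.prems by auto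
    have "v \<notin> V1" using 2 Att.hyps(3) by blast
    have "{u, w} \<notin> E" if "u \<in> V1" for u
      using Att.prems(4)[of u] that \<open>v \<notin> V1\<close> by auto
    then have "realizes (Att a b') (V1 \<union> insert w V2) E r1"
      using Att.hyps Att.prems(1) r
      by (intro realizes.Att[OF Att.hyps(1) b']) auto
    then show ?thesis by auto
  qed
qed

lemma realizes_exists:
  assumes "finite V" "card V = nverts t"
  shows "\<exists>F r. realizes t V F r \<and> F \<subseteq> {e. e \<subseteq> V \<and> card e = 2}"
  using assms
proof (induction t arbitrary: V)
  case Leaf
  then obtain v where "V = {v}" by (auto simp: card_1_singleton_iff)
  then show ?case using realizes.Leaf[of v "{}"] by (intro exI[of _ "{}"] exI[of _ v]) auto
next
  case (Att a b)
  obtain V1 where V1: "V1 \<subseteq> V" "card V1 = nverts a"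
    by (rule obtain_subset_with_card_n[of "nverts a" V]) (use Att.prems in auto)
  define V2 where "V2 = V - V1"
  have V2: "card V2 = nverts b" "finite V1" "finite V2" "V1 \<inter> V2 = {}" "V = V1 \<union> V2"
    using V1 Att.prems finite_subset[OF V1(1)] by (auto simp: V2_def card_Diff_subset)
  obtain F1 r1 where 1: "realizes a V1 F1 r1" "F1 \<subseteq> {e. e \<subseteq> V1 \<and> card e = 2}"
    using Att.IH(1)[OF V2(2) V1(2)] by blast
  obtain F2 r2 where 2: "realizes b V2 F2 r2" "F2 \<subseteq> {e. e \<subseteq> V2 \<and> card e = 2}"
    using Att.IH(2)[OF V2(3,1)] by blast
  have r: "r1 \<in> V1" "r2 \<in> V2" using realizes_root[OF 1(1)] realizes_root[OF 2(1)] by auto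
  define F where "F = insert {r1, r2} (F1 \<union> F2)"
  have x: "{u, v} \<notin> F2" if "u \<in> V1" for u v using that 2(2) V2(4) by blast
  have y: "{u, v} \<notin> F1" if "v \<in> V2" for u v using that 1(2) V2(4) by blast
  have "realizes a V1 F r1"
    by (rule realizes_cong[OF 1(1)]) (use x r V2(4) in \<open>auto simp: F_def doubleton_eq_iff\<close>)
  moreover have "realizes b V2 F r2"
    by (rule realizes_cong[OF 2(1)]) (use y r V2(4) in \<open>auto simp: F_def doubleton_eq_iff\<close>)
  moreover have "\<forall>u\<in>V1. \<forall>v\<in>V2. {u, v} \<in> F \<longleftrightarrow> u = r1 \<and> v = r2"
    using x y r V2(4) by (auto simp: F_def doubleton_eq_iff)
  ultimately have "realizes (Att a b) V F r1"
    unfolding V2(5) using V2(4) by (intro realizes.Att)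
  moreover have "r1 \<noteq> r2" using r V2(4) by blast
  then have "F \<subseteq> {e. e \<subseteq> V \<and> card e = 2}" using 1(2) 2(2) r V2(5) by (auto simp: F_def)
  ultimately show ?case by blast
qed

lemma tp_single:
  assumes "length As = length As'" "{v} \<notin> E" "{v'} \<notin> E'"
    and "\<And>i. i < length As \<Longrightarrow> As ! i = {} \<and> As' ! i = {} \<or> As ! i = {v} \<and> As' ! i = {v'}"
  shows "tp j {v} E v As = tp j {v'} E' v' As'"
  using assms
proof (induction j arbitrary: As As')
  case 0
  have "agree E v As E' v' As'"
    unfolding agree_def
  proof (intro conjI allI impI)
    fix i j assume i: "i < length As" and j: "j < length As"
    show "(As ! i = {}) = (As' ! i = {})" "is_singleton (As ! i) = is_singleton (As' ! i)"
      "(v \<in> As ! i) = (v' \<in> As' ! i)"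
      using 0(4)[OF i] by (auto simp: is_singleton_def)
    show "sing_mem (As ! i) (As ! j) = sing_mem (As' ! i) (As' ! j)"
      using 0(4)[OF i] 0(4)[OF j] by auto
    show "sing_adj E (As ! i) (As ! j) = sing_adj E' (As' ! i) (As' ! j)"
      using 0(4)[OF i] 0(4)[OF j] 0(2,3) by auto
  qed (rule 0(1))
  then show ?case by (simp only: tp_0_eq_iff[OF 0(1)])
next
  case (Suc j)
  have step: "tp j {v} E v (As @ [B]) = tp j {v'} E' v' (As' @ [B'])"
    if "B = {} \<and> B' = {} \<or> B = {v} \<and> B' = {v'}" for B B'
  proof (rule Suc.IH)
    fix i assume "i < length (As @ [B])"
    then show "(As @ [B]) ! i = {} \<and> (As' @ [B']) ! i = {} \<or> (As @ [B]) ! i = {v} \<and> (As' @ [B']) ! i = {v'}"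
      using Suc.prems(1) Suc.prems(4)[of i] that by (cases "i < length As") (simp_all add: nth_append)
  qed (use Suc.prems in auto)
  show ?case
  proof (rule tp_SucI)
    fix B assume "B \<subseteq> {v}"
    then consider "B = {}" | "B = {v}" by auto
    then show "\<exists>B'\<subseteq>{v'}. tp j {v} E v (As @ [B]) = tp j {v'} E' v' (As' @ [B'])"
      using step[of "{}" "{}"] step[of "{v}" "{v'}"] by cases auto
  next
    fix B assume "B \<subseteq> {v'}"
    then consider "B = {}" | "B = {v'}" by auto
    then show "\<exists>B'\<subseteq>{v}. tp j {v} E v (As @ [B']) = tp j {v'} E' v' (As' @ [B])"
      using step[of "{}" "{}"] step[of "{v}" "{v'}"] by cases auto
  qed
qed

lemma tp_empty:
  assumes "length As = length As'" "\<Union> (set As) = {}" "\<Union> (set As') = {}"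
  shows "tp j {} E r As = tp j {} E' r' As'"
  using assms
proof (induction j arbitrary: As As')
  case 0
  have "As ! i = {}" "As' ! i = {}" if "i < length As" for i
    using 0 that by (metis Sup_bot_conv(1) nth_mem)+
  then have "agree E r As E' r' As'"
    using 0(1) by (auto simp: agree_def is_singleton_def)
  then show ?case by (simp only: tp_0_eq_iff[OF 0(1)])
next
  case (Suc j)
  have "tp j {} E r (As @ [{}]) = tp j {} E' r' (As' @ [{}])"
    by (rule Suc.IH) (use Suc.prems in auto)
  then show ?case by simp
qed

text \<open>Types of trees know the root, types of components must not. Joining the tree without an
  edge to an empty structure with root \<open>z\<close> makes \<open>z\<close> the root and forgets
  the old one.\<close>

lemma tp_rootless:
  assumes "tp j V E r [] = tp j V' E' r' []" "finite V" "finite V'" "z \<notin> V" "z' \<notin> V'"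
  shows "tp j V E z [] = tp j V' E' z' []"
proof -
  have "tp j ({} \<union> V) E z [] = tp j ({} \<union> V') E' z' []"
    by (rule tp_join[where b = False]) (use assms tp_empty[of "[]" "[]" j E z E' z'] in simp_all)
  then show ?thesis by simp
qed

lemma tp_Att:
  assumes V: "realizes (Att a b) V E r" "realizes (Att a' b') V' E' r'"
    and a: "\<And>V r V' r'. realizes a V E r \<Longrightarrow> realizes a' V' E' r' \<Longrightarrow> tp j V E r [] = tp j V' E' r' []"
    and b: "\<And>V r V' r'. realizes b V E r \<Longrightarrow> realizes b' V' E' r' \<Longrightarrow> tp j V E r [] = tp j V' E' r' []"
  shows "tp j V E r [] = tp j V' E' r' []"
proof -
  from V(1) obtain V1 V2 r2 where 1: "V = V1 \<union> V2" "realizes a V1 E r" "realizes b V2 E r2" "V1 \<inter> V2 = {}"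
      "\<forall>u\<in>V1. \<forall>v\<in>V2. {u, v} \<in> E \<longleftrightarrow> u = r \<and> v = r2" by (rule realizes_AttE)
  from V(2) obtain V1' V2' r2' where 2: "V' = V1' \<union> V2'" "realizes a' V1' E' r'" "realizes b' V2' E' r2'"
      "V1' \<inter> V2' = {}" "\<forall>u\<in>V1'. \<forall>v\<in>V2'. {u, v} \<in> E' \<longleftrightarrow> u = r' \<and> v = r2'" by (rule realizes_AttE)
  show ?thesis
    unfolding 1(1) 2(1)
  proof (rule tp_join[where b = True])
    show "r \<notin> V2" "r' \<notin> V2'" using 1(4) 2(4) realizes_root[OF 1(2)] realizes_root[OF 2(2)] by auto
  qed (use 1(4,5) 2(4,5) a[OF 1(2) 2(2)] b[OF 1(3) 2(3)] 1(2,3)[THEN realizes_finite]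
      2(2,3)[THEN realizes_finite] in auto)
qed

lemma realizes_tp_eq:
  assumes "realizes t V E r" "realizes t V' E' r'"
  shows "tp j V E r [] = tp j V' E' r' []"
  using assms
proof (induction t arbitrary: V r V' r')
  case Leaf
  then show ?case by (auto elim!: realizes_LeafE intro!: tp_single simp del: tp.simps)
next
  case (Att a b)
  show ?case by (rule tp_Att[OF Att.prems Att.IH])
qed

section \<open>Number of types and small representatives\<close>

text \<open>Independent of the choice, since all realizations of a term have the same type
  (\<open>realizes_tp_eq\<close>); the vertices are fixed to be numbers so that there is one carrier
  to choose from.\<close>

definition btype :: "nat \<Rightarrow> bt \<Rightarrow> nat" where
  "btype k t = (SOME n. \<exists>V E r. realizes t (V :: nat set) E r \<and> n = tp k V E r [])"

lemma btype_ex: "\<exists>V E r. realizes t (V :: nat set) E r \<and> btype k t = tp k V E r []"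
proof -
  have "\<exists>V E r. realizes t (V :: nat set) E r"
    using realizes_exists[of "{..<nverts t}" t] by auto
  then have "\<exists>n V E r. realizes t (V :: nat set) E r \<and> n = tp k V E r []" by blast
  then show ?thesis unfolding btype_def by (rule someI_ex)
qed

lemma tp_realizes: "realizes t V E r \<Longrightarrow> tp k V E r [] = btype k t" for V :: "nat set"
  using btype_ex[of t k] realizes_tp_eq by metis

lemma btype_Att:
  assumes "btype k a = btype k a'" "btype k b = btype k b'"
  shows "btype k (Att a b) = btype k (Att a' b')"
proof -
  obtain V :: "nat set" and E r where 1: "realizes (Att a b) V E r" using btype_ex by blast
  obtain V' :: "nat set" and E' r' where 2: "realizes (Att a' b') V' E' r'" using btype_ex by blast
  have "tp k V E r [] = tp k V' E' r' []"
    by (rule tp_Att[OF 1 2]) (simp_all only: tp_realizes assms)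
  then show ?thesis using 1 2 by (simp only: tp_realizes)
qed

text \<open>Joining two trees at most doubles the size, so the set of types realised by trees of size
  at most \<open>2 ^ d\<close> grows strictly with \<open>d\<close> until all types are realised.\<close>

lemma small_representative:
  fixes \<theta> :: "bt \<Rightarrow> nat"
  assumes less: "\<And>t. \<theta> t < M"
    and cong: "\<And>a a' b b'. \<theta> a = \<theta> a' \<Longrightarrow> \<theta> b = \<theta> b' \<Longrightarrow> \<theta> (Att a b) = \<theta> (Att a' b')"
  obtains t' where "\<theta> t' = \<theta> t" "nverts t' \<le> 2 ^ M"
proof -
  define S where "S d = \<theta> ` {t. nverts t \<le> 2 ^ d}" for d :: nat
  have S: "S d \<subseteq> {..<M}" for d using less by (auto simp: S_def)
  then have fin: "finite (S d)" for d by (rule finite_subset) simp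
  have mono: "S d \<subseteq> S (Suc d)" for d
    unfolding S_def by (intro image_mono Collect_mono impI) (erule order_trans, simp)
  \<comment> \<open>Subsets of an \<open>M\<close>-element set cannot grow strictly
    \<open>M + 1\<close> times.\<close>
  have "\<exists>d\<le>M. S (Suc d) = S d"
  proof (rule ccontr)
    assume *: "\<not> (\<exists>d\<le>M. S (Suc d) = S d)"
    have "d \<le> Suc M \<Longrightarrow> d \<le> card (S d)" for d
    proof (induction d)
      case (Suc d)
      then have "S d \<subset> S (Suc d)" using * mono by auto
      then have "card (S d) < card (S (Suc d))" using fin by (rule psubset_card_mono[rotated])
      then show ?case using Suc by simp
    qed simp
    from this[of "Suc M"] have "Suc M \<le> card (S (Suc M))" by simp
    also have "\<dots> \<le> M" using card_mono[OF _ S[of "Suc M"]] by simp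
    finally show False by simp
  qed
  then obtain d where d: "d \<le> M" "S (Suc d) = S d" by blast
  \<comment> \<open>Once the sets stop growing they contain every type: representatives of both
    constituents, joined, have at most \<open>2 ^ (d + 1)\<close> vertices, and
    \<open>S (Suc d)\<close> brings nothing new.\<close>
  have "\<theta> t \<in> S d" for t
  proof (induction t)
    case Leaf
    then show ?case by (auto simp: S_def)
  next
    case (Att a b)
    then obtain a' b' where ab: "\<theta> a = \<theta> a'" "nverts a' \<le> 2 ^ d" "\<theta> b = \<theta> b'" "nverts b' \<le> 2 ^ d"
      by (auto simp: S_def)
    then have "\<theta> (Att a' b') \<in> S (Suc d)" by (auto simp: S_def)
    then show ?case using d(2) cong[OF ab(1,3)] by simp
  qed
  from this[of t] obtain t' where "\<theta> t' = \<theta> t" "nverts t' \<le> 2 ^ d" unfolding S_def by auto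
  moreover have "(2::nat) ^ d \<le> 2 ^ M" using d(1) by simp
  ultimately show thesis using that order_trans by blast
qed

lemma tower_add: "tower (i + j) = ((\<lambda>x. 2 ^ x) ^^ i) (tower j)"
  by (induction i) simp_all

lemma iter_exp_mono:
  fixes x y :: nat
  assumes "x \<le> y"
  shows "((\<lambda>x::nat. 2 ^ x :: nat) ^^ i) x \<le> ((\<lambda>x::nat. 2 ^ x) ^^ i) y"
  using assms by (induction i) simp_all

text \<open>For \<open>k = 3\<close> the first bound reads 18 against 16 and fails, whence
  \<open>4 \<le> k\<close>. The second conjunct bounds the increment in the induction.\<close>

lemma triangle_bound: "4 \<le> k \<Longrightarrow> 3 * triangle k \<le> 2 ^ Suc k \<and> 3 * Suc k \<le> 2 ^ Suc k"
proof (induction k rule: dec_induct)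
  case base
  show ?case by (simp add: eval_nat_numeral)
next
  case (step k)
  then show ?case by simp
qed

text \<open>The summand 2 stands for two exponentials: from
  \<open>k + 1 \<le> tower (log_star (k + 1))\<close> to the number of atoms, and from there to sets
  of atoms.\<close>

lemma btype_less:
  assumes "4 \<le> k"
  shows "btype k t < tower (k + log_star (k + 1) + 2)"
proof -
  obtain V E r where V: "realizes t (V :: nat set) E r" "btype k t = tp k V E r []"
    using btype_ex by blast
  have "btype k t < tp_bound k k"
    unfolding V(2) by (rule tp_less) (use realizes_finite[OF V(1)] in auto)
  also have "\<dots> \<le> ((\<lambda>x. 2 ^ x) ^^ k) (2 ^ (2 ^ tower (log_star (k + 1))))"
  proof (rule iter_exp_mono)
    have "3 * triangle k \<le> 2 ^ (k + 1)" using triangle_bound[OF assms] by simp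
    also have "\<dots> \<le> 2 ^ tower (log_star (k + 1))"
      by (intro power_increasing log_star_props) simp
    finally show "(2::nat) ^ (3 * triangle k) \<le> 2 ^ (2 ^ tower (log_star (k + 1)))"
      by (intro power_increasing) auto
  qed
  also have "\<dots> = tower (k + log_star (k + 1) + 2)"
    using tower_add[of k "log_star (k + 1) + 2"] by (simp add: add.assoc)
  finally show ?thesis .
qed

section \<open>Components of sparse graphs\<close>

text \<open>The first clause excludes cycles on up to \<open>l + 1\<close> vertices, the second
  trees on \<open>l + 2\<close> vertices. Both only forbid too many edges on boundedly many
  vertices, so first moments suffice to establish them.\<close>

definition sparse :: "nat \<Rightarrow> 'v set \<Rightarrow> 'v set set \<Rightarrow> bool" where
  "sparse l V E \<longleftrightarrow> (\<forall>W\<subseteq>V. W \<noteq> {} \<and> card W \<le> l + 1 \<longrightarrow> card (E \<inter> Pow W) < card W) \<and>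
     (\<forall>W\<subseteq>V. card W = l + 2 \<longrightarrow> card (E \<inter> Pow W) \<le> l)"

text \<open>Only the components that are trees; in a sparse graph they cover all vertices
  (\<open>Union_comps\<close>).\<close>

definition comps :: "'v set \<Rightarrow> 'v set set \<Rightarrow> 'v set set" where
  "comps V E = {D. D \<subseteq> V \<and> (\<exists>t r. realizes t D E r) \<and> (\<forall>u\<in>D. \<forall>v\<in>V - D. {u, v} \<notin> E)}"

lemma comps_unique:
  assumes "D \<in> comps V E" "D' \<in> comps V E" "D \<inter> D' \<noteq> {}"
  shows "D = D'"
proof -
  have "A \<subseteq> B" if AB: "A \<in> comps V E" "B \<in> comps V E" "A \<inter> B \<noteq> {}" for A B
  proof -
    obtain t r where "realizes t A E r" using AB(1) by (auto simp: comps_def)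
    then show ?thesis
    proof (rule realizes_connected)
      fix u v assume "u \<in> A" "v \<in> A" "{u, v} \<in> E" "u \<in> B"
      then show "v \<in> B" using AB(1,2) unfolding comps_def by blast
    qed (use AB(3) in blast)
  qed
  then show ?thesis using assms by (metis Int_commute subset_antisym)
qed

lemma parts_comps:
  assumes "finite V"
  shows "parts E (comps V E)"
  unfolding parts_def
proof (intro conjI ballI impI)
  have "comps V E \<subseteq> Pow V" by (auto simp: comps_def)
  then show "finite (comps V E)" by (rule finite_subset) (simp add: assms)
  show "finite D" if "D \<in> comps V E" for D
    using that assms by (auto simp: comps_def intro: finite_subset)
next
  fix D D' assume D: "D \<in> comps V E" "D' \<in> comps V E" "D \<noteq> D'"
  then show disj: "D \<inter> D' = {}" using comps_unique by blast
  fix u v assume "u \<in> D" "v \<in> D'"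
  then show "{u, v} \<notin> E" using D disj unfolding comps_def by blast
qed

text \<open>A largest tree around \<open>r\<close> with at most \<open>l + 1\<close> vertices is
  closed under edges. An outside vertex joined to it twice would create too many edges; joined once,
  it gives a larger tree, against maximality or the second clause of \<open>sparse\<close>.\<close>

lemma sparse_comp:
  assumes fin: "finite V" and E: "\<And>e. e \<in> E \<Longrightarrow> card e = 2" and sparse: "sparse l V E" and r: "r \<in> V"
  obtains D t where "r \<in> D" "D \<in> comps V E" "realizes t D E r" "card D \<le> l + 1"
proof -
  define P where "P D \<longleftrightarrow> D \<subseteq> V \<and> card D \<le> l + 1 \<and> (\<exists>t. realizes t D E r)" for D
  have sp1: "card (E \<inter> Pow W) < card W" if "W \<subseteq> V" "W \<noteq> {}" "card W \<le> l + 1" for W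
    using sparse that unfolding sparse_def by blast
  have sp2: "card (E \<inter> Pow W) \<le> l" if "W \<subseteq> V" "card W = l + 2" for W
    using sparse that unfolding sparse_def by blast
  have loop: "{v} \<notin> E" for v using E[of "{v}"] by auto
  have "P {r}" using realizes.Leaf[of r E] loop r by (auto simp: P_def)
  moreover have "card D \<le> l + 1" if "P D" for D using that by (simp add: P_def)
  ultimately obtain D where D: "P D" "\<And>D'. P D' \<Longrightarrow> card D' \<le> card D"
    using ex_has_greatest_nat[of P "{r}" card "l + 2"] by (auto simp: less_Suc_eq_le)
  obtain t where t: "realizes t D E r" "D \<subseteq> V" "card D \<le> l + 1" using D(1) by (auto simp: P_def)
  have finD: "finite D" using t(2) fin by (rule finite_subset)
  have finE: "finite (E \<inter> Pow W)" if "W \<subseteq> V" for W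
    using that fin by (meson finite_Int finite_Pow_iff finite_subset)
  have "{u, w} \<notin> E" if u: "u \<in> D" and w: "w \<in> V - D" for u w
  proof
    assume uw: "{u, w} \<in> E"
    have sub: "insert w D \<subseteq> V" using t(2) w by auto
    have cardI: "card (insert w D) = card D + 1" using finD w by simp
    \<comment> \<open>Each size of \<open>D\<close> is covered by one clause of
      \<open>sparse\<close>; \<open>D\<close> itself already spans \<open>card D - 1\<close> edges,
      which leaves room for one.\<close>
    have bound: "card (E \<inter> Pow (insert w D)) \<le> card D"
    proof (cases "card D + 1 \<le> l + 1")
      case True
      then have "card (E \<inter> Pow (insert w D)) < card (insert w D)"
        using sp1[OF sub] cardI by simp
      then show ?thesis using cardI by simp
    next
      case False
      then have *: "card D = l + 1" using t(3) by simp
      then have "card (insert w D) = l + 2" using cardI by simp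
      then have "card (E \<inter> Pow (insert w D)) \<le> l"
        using sp2[OF sub] by simp
      then show ?thesis using * by simp
    qed
    have eD: "card (E \<inter> Pow D) + 1 = card D"
      using realizes_card_edges[OF t(1) E] realizes_card[OF t(1)] by simp
    have one: "v = u" if v: "v \<in> D" "{v, w} \<in> E" for v
    proof (rule ccontr)
      assume "v \<noteq> u"
      then have ne: "{v, w} \<noteq> {u, w}" using w v(1) by (auto simp: doubleton_eq_iff)
      have "insert {v, w} (insert {u, w} (E \<inter> Pow D)) \<subseteq> E \<inter> Pow (insert w D)"
        using v uw u by auto
      then have "card (insert {v, w} (insert {u, w} (E \<inter> Pow D))) \<le> card (E \<inter> Pow (insert w D))"
        using finE[OF sub] by (intro card_mono)
      moreover have "card (insert {v, w} (insert {u, w} (E \<inter> Pow D))) = card (E \<inter> Pow D) + 2"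
        using finE[OF t(2)] ne w by simp
      ultimately show False using bound eD by simp
    qed
    have "w \<notin> D" "\<And>v. v \<in> D \<Longrightarrow> {v, w} \<in> E \<longleftrightarrow> v = u" using w one uw by blast+
    from realizes_pendant[OF t(1) this(1) u loop this(2)]
    obtain t' where t': "realizes t' (insert w D) E r" ..
    show False
    proof (cases "card D + 1 \<le> l + 1")
      case True
      then have "P (insert w D)" using t' sub cardI by (auto simp: P_def)
      then show False using D(2)[of "insert w D"] cardI by simp
    next
      case False
      then have "card (insert w D) = l + 2" using t(3) cardI by simp
      then have "card (E \<inter> Pow (insert w D)) \<le> l" "nverts t' = l + 2"
        using sp2[OF sub] realizes_card[OF t'] by simp_all
      then show False using realizes_card_edges[OF t' E] by simp
    qed
  qed
  then have "D \<in> comps V E" using t by (auto simp: comps_def)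
  then show thesis using that t(1,3) realizes_root[OF t(1)] by blast
qed

lemma Union_comps:
  assumes "finite V" "\<And>e. e \<in> E \<Longrightarrow> card e = 2" "sparse l V E"
  shows "\<Union> (comps V E) = V"
proof
  show "V \<subseteq> \<Union> (comps V E)"
  proof
    fix r assume "r \<in> V"
    from sparse_comp[OF assms(1,2,3) this] show "r \<in> \<Union> (comps V E)" by auto
  qed
qed (auto simp: comps_def)

definition rich :: "nat \<Rightarrow> nat \<Rightarrow> 'v set \<Rightarrow> 'v set set \<Rightarrow> bool" where
  "rich l m V E \<longleftrightarrow> sparse l V E \<and>
     (\<forall>t. nverts t \<le> l \<longrightarrow> m \<le> card {D\<in>comps V E. \<exists>r. realizes t D E r})"

text \<open>A type that occurs on a component of one rich graph has a representative with at most
  \<open>l\<close> vertices, so it occurs at least \<open>m\<close> times in both. The counts capped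
  at \<open>m\<close> thus agree: both are 0 or both are \<open>m\<close>, even for components with
  \<open>l + 1\<close> vertices.\<close>

lemma rich_tp_eq:
  assumes "4 \<le> k" and l: "tower (k + log_star (k + 1) + 3) \<le> l"
  shows "\<exists>m. \<forall>V E V' E'. finite V \<and> finite V' \<and> (\<forall>e\<in>E. card e = 2) \<and> (\<forall>e\<in>E'. card e = 2) \<and>
      z \<notin> V \<and> z \<notin> V' \<and> rich l m V E \<and> rich l m V' E' \<longrightarrow> tp k V E z [] = tp k V' E' (z :: nat) []"
proof -
  from tp_cap_equiv[where s = 0 and j = k] obtain m where
    "\<forall>E r \<D> As E' r' \<D>' As'. cap_equiv k m E r \<D> As E' r' \<D>' As' \<and> length As = 0 \<longrightarrow>
     tp k (\<Union>\<D>) E r As = tp k (\<Union>\<D>') E' r' (As' :: nat set list)"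
    by (elim exE conjE)
  note m = this[rule_format, OF conjI]
  have half: "m \<le> card {D\<in>comps V E. tp k D E z [] = q} \<and> m \<le> card {D\<in>comps V' E'. tp k D E' z [] = q}"
    if fin: "finite V" "finite V'" and z: "z \<notin> V" "z \<notin> V'"
      and rich: "rich l m V E" "rich l m V' E'"
      and D: "D \<in> comps V E" "tp k D E z [] = q" for V V' E E' D q
  proof -
    obtain t r where t: "realizes t D E r" using D(1) by (auto simp: comps_def)
    obtain t' where t': "btype k t' = btype k t" "nverts t' \<le> 2 ^ tower (k + log_star (k + 1) + 2)"
      by (rule small_representative[of "btype k", OF btype_less[OF assms(1)] btype_Att])
    have "nverts t' \<le> l" using t'(2) l by (simp add: eval_nat_numeral)
    then have c: "m \<le> card {D\<in>comps V E. \<exists>r. realizes t' D E r}" "m \<le> card {D\<in>comps V' E'. \<exists>r. realizes t' D E' r}"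
      using rich by (auto simp: rich_def)
    have q: "tp k D' E'' z [] = q" if "realizes t' D' E'' r'" "z \<notin> D'" for D' E'' r'
    proof -
      have "tp k D' E'' r' [] = tp k D E r []" using tp_realizes[OF that(1)] tp_realizes[OF t] t'(1) by simp
      then have "tp k D' E'' z [] = tp k D E z []"
        by (rule tp_rootless) (use that D(1) z(1) realizes_finite[OF that(1)] realizes_finite[OF t] in \<open>auto simp: comps_def\<close>)
      then show ?thesis using D(2) by simp
    qed
    have fc: "finite (comps V E)" "finite (comps V' E')" using fin parts_comps by (auto simp: parts_def)
    have "card {D\<in>comps V E. \<exists>r. realizes t' D E r} \<le> card {D\<in>comps V E. tp k D E z [] = q}"
    proof (rule card_mono)
      show "finite {D\<in>comps V E. tp k D E z [] = q}" using fc by simp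
      show "{D\<in>comps V E. \<exists>r. realizes t' D E r} \<subseteq> {D\<in>comps V E. tp k D E z [] = q}"
        using q z unfolding comps_def by blast
    qed
    moreover have "card {D\<in>comps V' E'. \<exists>r. realizes t' D E' r} \<le> card {D\<in>comps V' E'. tp k D E' z [] = q}"
    proof (rule card_mono)
      show "finite {D\<in>comps V' E'. tp k D E' z [] = q}" using fc by simp
      show "{D\<in>comps V' E'. \<exists>r. realizes t' D E' r} \<subseteq> {D\<in>comps V' E'. tp k D E' z [] = q}"
        using q z unfolding comps_def by blast
    qed
    ultimately show ?thesis using c by linarith
  qed
  have "tp k V E z [] = tp k V' E' z []"
    if fin: "finite V" "finite V'" and E: "\<And>e. e \<in> E \<Longrightarrow> card e = 2" "\<And>e. e \<in> E' \<Longrightarrow> card e = 2"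
      and z: "z \<notin> V" "z \<notin> V'" and rich: "rich l m V E" "rich l m V' E'" for V V' E E'
  proof -
    have "min m (card {D\<in>comps V E. tp k D E z [] = q}) = min m (card {D\<in>comps V' E'. tp k D E' z [] = q})" for q
    proof (cases "{D\<in>comps V E. tp k D E z [] = q} = {} \<and> {D\<in>comps V' E'. tp k D E' z [] = q} = {}")
      case True
      then show ?thesis by (simp only: card.empty)
    next
      case False
      then consider D where "D \<in> comps V E" "tp k D E z [] = q" | D where "D \<in> comps V' E'" "tp k D E' z [] = q"
        by blast
      then have "m \<le> card {D\<in>comps V E. tp k D E z [] = q} \<and> m \<le> card {D\<in>comps V' E'. tp k D E' z [] = q}"
      proof cases
        case 1
        then show ?thesis using half[OF fin z rich] by blast
      next
        case 2
        then show ?thesis using half[OF fin(2,1) z(2,1) rich(2,1)] by blast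
      qed
      then show ?thesis by simp
    qed
    moreover have sp: "sparse l V E" "sparse l V' E'" using rich by (auto simp: rich_def)
    note U = Union_comps[OF fin(1) E(1) sp(1)] Union_comps[OF fin(2) E(2) sp(2)]
    ultimately have "cap_equiv k m E z (comps V E) [] E' z (comps V' E') []"
      using z parts_comps[OF fin(1)] parts_comps[OF fin(2)] U by (simp add: cap_equiv_def)
    from m[OF this] show ?thesis using U by simp
  qed
  then show ?thesis by (intro exI[of _ m]) blast
qed

section \<open>Probabilities in the random graph\<close>

abbreviation gprob :: "nat \<Rightarrow> real \<Rightarrow> nat set set set \<Rightarrow> real" where
  "gprob n p \<equiv> measure_pmf.prob (random_graph n p)"

abbreviation gexp :: "nat \<Rightarrow> real \<Rightarrow> (nat set set \<Rightarrow> real) \<Rightarrow> real" where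
  "gexp n p \<equiv> measure_pmf.expectation (random_graph n p)"

lemma finite_all_edges: "finite (all_edges n)"
  by (rule finite_subset[of _ "Pow {1..n}"]) (auto simp: all_edges_def)

lemma set_random_graph: "set_pmf (random_graph n p) \<subseteq> Pow (all_edges n)"
  by (auto simp: random_graph_def)

lemma finite_set_random_graph: "finite (set_pmf (random_graph n p))"
  by (rule finite_subset[OF set_random_graph]) (simp add: finite_all_edges)

lemma prob_random_graph_mono:
  assumes "\<And>E. E \<subseteq> all_edges n \<Longrightarrow> E \<in> A \<Longrightarrow> E \<in> B"
  shows "gprob n p A \<le> gprob n p B"
proof -
  have "gprob n p A = gprob n p (A \<inter> set_pmf (random_graph n p))"
    by (simp add: measure_Int_set_pmf)
  also have "\<dots> \<le> gprob n p B"
  proof (rule measure_pmf.finite_measure_mono)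
    show "A \<inter> set_pmf (random_graph n p) \<subseteq> B"
    proof
      fix E assume "E \<in> A \<inter> set_pmf (random_graph n p)"
      then have "E \<subseteq> all_edges n" "E \<in> A" using set_random_graph[of n p] by blast+
      then show "E \<in> B" by (rule assms)
    qed
  qed simp
  finally show ?thesis .
qed

lemma prob_cylinder:
  assumes "0 \<le> p" "p \<le> 1" "A \<subseteq> all_edges n" "B \<subseteq> all_edges n" "A \<inter> B = {}"
  shows "gprob n p {E. A \<subseteq> E \<and> E \<inter> B = {}} = p ^ card A * (1 - p) ^ card B"
proof -
  let ?U = "all_edges n" and ?M = "Pi_pmf (all_edges n) False (\<lambda>_. bernoulli_pmf p)"
  define C where "C e = (if e \<in> A then {True} else if e \<in> B then {False} else UNIV)" for e
  have "(\<lambda>f. {e \<in> ?U. f e}) -` {E. A \<subseteq> E \<and> E \<inter> B = {}} = Pi ?U C"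
  proof (intro equalityI subsetI)
    fix f assume f: "f \<in> (\<lambda>f. {e \<in> ?U. f e}) -` {E. A \<subseteq> E \<and> E \<inter> B = {}}"
    show "f \<in> Pi ?U C"
    proof
      fix e assume "e \<in> ?U"
      then show "f e \<in> C e" using f by (auto simp: C_def)
    qed
  next
    fix f assume f: "f \<in> Pi ?U C"
    have "f e" if "e \<in> A" for e using Pi_mem[OF f, of e] that assms(3) by (auto simp: C_def)
    moreover have "\<not> f e" if "e \<in> B" for e
    proof -
      have "e \<in> ?U" "e \<notin> A" using that assms(4,5) by auto
      then show ?thesis using Pi_mem[OF f, of e] that by (simp add: C_def)
    qed
    ultimately show "f \<in> (\<lambda>f. {e \<in> ?U. f e}) -` {E. A \<subseteq> E \<and> E \<inter> B = {}}" using assms(3) by auto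
  qed
  then have "gprob n p {E. A \<subseteq> E \<and> E \<inter> B = {}} = measure_pmf.prob ?M (Pi ?U C)"
    by (simp add: random_graph_def)
  also have "\<dots> = (\<Prod>e\<in>?U. measure_pmf.prob (bernoulli_pmf p) (C e))"
    by (rule measure_Pi_pmf_Pi) (rule finite_all_edges)
  also have "\<dots> = (\<Prod>e\<in>?U. (if e \<in> A then p else 1) * (if e \<in> B then 1 - p else 1))"
    using assms by (intro prod.cong refl) (auto simp: C_def measure_pmf_single)
  also have "\<dots> = (\<Prod>e\<in>?U. if e \<in> A then p else 1) * (\<Prod>e\<in>?U. if e \<in> B then 1 - p else 1)"
    by (rule prod.distrib)
  also have "(\<Prod>e\<in>?U. if e \<in> A then p else 1) = p ^ card A"
    using assms(3) finite_all_edges[of n] by (simp add: prod.If_cases Int_absorb1)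
  also have "(\<Prod>e\<in>?U. if e \<in> B then 1 - p else 1) = (1 - p) ^ card B"
    using assms(4) finite_all_edges[of n] by (simp add: prod.If_cases Int_absorb1)
  finally show ?thesis .
qed

lemma prob_contains:
  assumes "0 \<le> p" "p \<le> 1" "F \<subseteq> all_edges n"
  shows "gprob n p {E. F \<subseteq> E} = p ^ card F"
  using prob_cylinder[OF assms(1-3), of "{}"] by simp

section \<open>First moments of dense vertex sets\<close>

definition edge_subsets :: "nat \<Rightarrow> nat \<Rightarrow> nat \<Rightarrow> nat set set set" where
  "edge_subsets n w f = {F. F \<subseteq> all_edges n \<and> card F = f \<and> (\<exists>W\<subseteq>{1..n}. card W = w \<and> F \<subseteq> Pow W)}"

text \<open>The factor crudely counts all families of subsets of \<open>W\<close>; only its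
  independence of \<open>n\<close> matters.\<close>

lemma card_edge_subsets: "finite (edge_subsets n w f)" "card (edge_subsets n w f) \<le> 2 ^ 2 ^ w * n ^ w"
proof -
  let ?W = "{W. W \<subseteq> {1..n} \<and> card W = w}"
  have sub: "edge_subsets n w f \<subseteq> (\<Union>W\<in>?W. Pow (Pow W))"
    unfolding edge_subsets_def by blast
  have finW: "finite ?W" by (rule finite_subset[of _ "Pow {1..n}"]) auto
  have fin: "finite W" if "W \<in> ?W" for W using that finite_subset by auto
  then have finU: "finite (\<Union>W\<in>?W. Pow (Pow W))" using finW by auto
  then show "finite (edge_subsets n w f)" using sub by (rule finite_subset[rotated])
  have "card (edge_subsets n w f) \<le> card (\<Union>W\<in>?W. Pow (Pow W))" using finU sub by (rule card_mono)
  also have "\<dots> \<le> (\<Sum>W\<in>?W. card (Pow (Pow W)))" using finW by (rule card_UN_le)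
  also have "\<dots> = (\<Sum>W\<in>?W. 2 ^ 2 ^ w)" using fin by (intro sum.cong refl) (auto simp: card_Pow)
  also have "\<dots> = 2 ^ 2 ^ w * (n choose w)" using n_subsets[of "{1..n}" w] by simp
  also have "\<dots> \<le> 2 ^ 2 ^ w * n ^ w"
    using binomial_le_pow[of w n] by (cases "w \<le> n") (auto simp: binomial_eq_0)
  finally show "card (edge_subsets n w f) \<le> 2 ^ 2 ^ w * n ^ w" .
qed

abbreviation dense :: "nat \<Rightarrow> nat \<Rightarrow> nat \<Rightarrow> nat set set \<Rightarrow> bool" where
  "dense n w f E \<equiv> \<exists>W\<subseteq>{1..n}. card W = w \<and> f \<le> card (E \<inter> Pow W)"

lemma dense_edge_subsets:
  assumes "E \<subseteq> all_edges n"
  shows "dense n w f E \<longleftrightarrow> (\<exists>F\<in>edge_subsets n w f. F \<subseteq> E)"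
proof
  assume "dense n w f E"
  then obtain W where W: "W \<subseteq> {1..n}" "card W = w" "f \<le> card (E \<inter> Pow W)" by blast
  obtain F where F: "F \<subseteq> E \<inter> Pow W" "card F = f"
    by (rule obtain_subset_with_card_n[OF W(3)])
  then have "F \<subseteq> all_edges n" "F \<subseteq> Pow W" "F \<subseteq> E" using assms by auto
  then show "\<exists>F\<in>edge_subsets n w f. F \<subseteq> E"
    using F(2) W(1,2) by (intro bexI[of _ F]) (auto simp: edge_subsets_def)
next
  assume "\<exists>F\<in>edge_subsets n w f. F \<subseteq> E"
  then obtain F W where F: "F \<subseteq> E" "card F = f" "W \<subseteq> {1..n}" "card W = w" "F \<subseteq> Pow W"
    unfolding edge_subsets_def by blast
  have "finite E" using assms finite_all_edges finite_subset by blast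
  then have "card F \<le> card (E \<inter> Pow W)" using F by (intro card_mono) auto
  then show "dense n w f E" using F by blast
qed

lemma prob_dense:
  assumes "0 \<le> p" "p \<le> 1"
  shows "gprob n p {E. dense n w f E}
    \<le> 2 ^ 2 ^ w * (real n ^ w * p ^ f)"
proof -
  have "gprob n p {E. dense n w f E}
    \<le> gprob n p (\<Union>F\<in>edge_subsets n w f. {E. F \<subseteq> E})"
    by (rule prob_random_graph_mono) (use dense_edge_subsets in auto)
  also have "\<dots> \<le> (\<Sum>F\<in>edge_subsets n w f. gprob n p {E. F \<subseteq> E})"
    by (rule measure_pmf.finite_measure_subadditive_finite) (auto simp: card_edge_subsets)
  also have "\<dots> = (\<Sum>F\<in>edge_subsets n w f. p ^ f)"
    by (intro sum.cong refl) (auto simp: edge_subsets_def prob_contains assms)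
  also have "\<dots> = real (card (edge_subsets n w f)) * p ^ f" by simp
  also have "\<dots> \<le> real (2 ^ 2 ^ w * n ^ w) * p ^ f"
    using assms by (intro mult_right_mono) (simp_all only: of_nat_le_iff card_edge_subsets zero_le_power)
  finally show ?thesis by simp
qed

section \<open>Harris' inequality\<close>

text \<open>The expectation of \<open>f\<close> for independent edges. Being a finite sum over an
  arbitrary ground set, it allows induction edge by edge.\<close>

definition bweight :: "real \<Rightarrow> 'e set \<Rightarrow> ('e set \<Rightarrow> real) \<Rightarrow> real" where
  "bweight p U f = (\<Sum>E\<in>Pow U. p ^ card E * (1 - p) ^ card (U - E) * f E)"

lemma bweight_insert:
  assumes "finite U" "x \<notin> U"
  shows "bweight p (insert x U) f = (1 - p) * bweight p U f + p * bweight p U (\<lambda>E. f (insert x E))"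
proof -
  have inj: "inj_on (insert x) (Pow U)" using assms(2) by (auto simp: inj_on_def)
  have disj: "Pow U \<inter> insert x ` Pow U = {}" using assms(2) by auto
  have 1: "card (insert x U - E) = Suc (card (U - E))" if "E \<in> Pow U" for E
  proof -
    have "insert x U - E = insert x (U - E)" using that assms(2) by auto
    then show ?thesis using assms by simp
  qed
  have 2: "card (insert x E) = Suc (card E)" "insert x U - insert x E = U - E" if "E \<in> Pow U" for E
    using that assms by (auto intro: card_insert_disjoint finite_subset)
  have "bweight p (insert x U) f =
      (\<Sum>E\<in>Pow U. p ^ card E * (1 - p) ^ card (insert x U - E) * f E) +
      (\<Sum>E\<in>Pow U. p ^ card (insert x E) * (1 - p) ^ card (insert x U - insert x E) * f (insert x E))"
    unfolding bweight_def Pow_insert using assms disj inj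
    by (simp add: sum.union_disjoint sum.reindex o_def)
  also have "\<dots> = (\<Sum>E\<in>Pow U. (1 - p) * (p ^ card E * (1 - p) ^ card (U - E) * f E)) +
      (\<Sum>E\<in>Pow U. p * (p ^ card E * (1 - p) ^ card (U - E) * f (insert x E)))"
    by (intro arg_cong2[where f = "(+)"] sum.cong refl) (simp_all add: 1 2 Diff_insert0 assms(2))
  also have "\<dots> = (1 - p) * bweight p U f + p * bweight p U (\<lambda>E. f (insert x E))"
    by (simp add: bweight_def sum_distrib_left)
  finally show ?thesis .
qed

lemma bweight_mono:
  assumes "0 \<le> p" "p \<le> 1" "\<And>E. E \<subseteq> U \<Longrightarrow> f E \<le> g E"
  shows "bweight p U f \<le> bweight p U g"
  unfolding bweight_def using assms by (intro sum_mono mult_left_mono) auto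

lemma harris:
  assumes "finite U" "0 \<le> p" "p \<le> 1"
    and "\<And>E E'. E \<subseteq> E' \<Longrightarrow> E' \<subseteq> U \<Longrightarrow> f E' \<le> f E" "\<And>E E'. E \<subseteq> E' \<Longrightarrow> E' \<subseteq> U \<Longrightarrow> g E' \<le> g E"
  shows "bweight p U f * bweight p U g \<le> bweight p U (\<lambda>E. f E * g E)"
  using assms(1,4,5)
proof (induction U arbitrary: f g rule: finite_induct)
  case empty
  then show ?case by (simp add: bweight_def)
next
  case (insert x U)
  let ?f = "\<lambda>E. f (insert x E)" and ?g = "\<lambda>E. g (insert x E)"
  let ?F0 = "bweight p U f" and ?F1 = "bweight p U ?f" and ?G0 = "bweight p U g" and ?G1 = "bweight p U ?g"
  have 0: "?F0 * ?G0 \<le> bweight p U (\<lambda>E. f E * g E)"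
    by (rule insert.IH; rule insert.prems; blast)
  have 1: "?F1 * ?G1 \<le> bweight p U (\<lambda>E. ?f E * ?g E)"
    by (rule insert.IH; rule insert.prems; blast)
  have le: "?F1 \<le> ?F0" "?G1 \<le> ?G0"
    by (rule bweight_mono[OF assms(2,3)]; rule insert.prems; blast)+
  \<comment> \<open>Conditioning on the edge \<open>x\<close>. The last term is nonnegative because
    \<open>f\<close> and \<open>g\<close> both decrease when \<open>x\<close> is added: Chebyshev's
    inequality on two points.\<close>
  have "((1 - p) * ?F0 + p * ?F1) * ((1 - p) * ?G0 + p * ?G1) =
      (1 - p) * (?F0 * ?G0) + p * (?F1 * ?G1) - p * (1 - p) * ((?F0 - ?F1) * (?G0 - ?G1))"
    by (simp add: algebra_simps)
  also have "\<dots> \<le> (1 - p) * (?F0 * ?G0) + p * (?F1 * ?G1)"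
    using assms(2,3) le by simp
  also have "\<dots> \<le> (1 - p) * bweight p U (\<lambda>E. f E * g E) + p * bweight p U (\<lambda>E. ?f E * ?g E)"
    using assms(2,3) 0 1 by (intro add_mono mult_left_mono) auto
  finally show ?case using insert.hyps by (simp add: bweight_insert)
qed

lemma prob_eq_bweight:
  assumes "0 \<le> p" "p \<le> 1"
  shows "gprob n p A = bweight p (all_edges n) (\<lambda>E. if E \<in> A then 1 else 0)"
proof -
  let ?U = "all_edges n"
  have "gprob n p A = gprob n p (A \<inter> Pow ?U)"
    by (intro antisym prob_random_graph_mono) auto
  also have "\<dots> = (\<Sum>E\<in>A \<inter> Pow ?U. pmf (random_graph n p) E)"
    using finite_all_edges by (intro measure_measure_pmf_finite) auto
  also have "\<dots> = (\<Sum>E\<in>A \<inter> Pow ?U. p ^ card E * (1 - p) ^ card (?U - E))"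
  proof (rule sum.cong[OF refl])
    fix E assume E: "E \<in> A \<inter> Pow ?U"
    have "pmf (random_graph n p) E = gprob n p {E}"
      by (simp add: measure_pmf_single)
    also have "\<dots> = gprob n p {E'. E \<subseteq> E' \<and> E' \<inter> (?U - E) = {}}"
      using E by (intro antisym prob_random_graph_mono) auto
    also have "\<dots> = p ^ card E * (1 - p) ^ card (?U - E)"
      using E assms by (intro prob_cylinder) auto
    finally show "pmf (random_graph n p) E = p ^ card E * (1 - p) ^ card (?U - E)" .
  qed
  also have "\<dots> = (\<Sum>E\<in>Pow ?U. p ^ card E * (1 - p) ^ card (?U - E) * (if E \<in> A then 1 else 0))"
    using finite_all_edges by (intro sum.mono_neutral_cong_left) auto
  finally show ?thesis by (simp add: bweight_def)
qed

text \<open>Avoiding an edge set is a decreasing event, so by \<open>harris\<close> the avoidances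
  are positively correlated.\<close>

lemma prob_avoid_all:
  assumes p: "0 \<le> p" "p \<le> 1" and "finite \<F>" "\<And>F. F \<in> \<F> \<Longrightarrow> F \<subseteq> all_edges n \<and> card F = f"
  shows "(1 - p ^ f) ^ card \<F> \<le> gprob n p {E. \<forall>F\<in>\<F>. \<not> F \<subseteq> E}"
  using assms(3,4)
proof (induction \<F> rule: finite_induct)
  case (insert F \<F>)
  let ?P = "\<lambda>A. gprob n p A"
  let ?A = "{E. \<not> F \<subseteq> E}" and ?B = "{E. \<forall>F\<in>\<F>. \<not> F \<subseteq> E}"
  have "?A = UNIV - {E. F \<subseteq> E}" by auto
  then have A: "?P ?A = 1 - p ^ f"
    using insert.prems p by (simp add: measure_pmf.prob_compl[simplified] prob_contains)
  have "(1 - p ^ f) ^ card (insert F \<F>) = (1 - p ^ f) * (1 - p ^ f) ^ card \<F>"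
    using insert.hyps by simp
  also have "\<dots> \<le> ?P ?A * ?P ?B"
    unfolding A using insert p by (intro mult_left_mono insert.IH) (auto simp: power_le_one)
  also have "\<dots> \<le> bweight p (all_edges n) (\<lambda>E. (if E \<in> ?A then 1 else 0) * (if E \<in> ?B then 1 else 0))"
    unfolding prob_eq_bweight[OF p] by (rule harris) (use p in \<open>simp_all add: finite_all_edges\<close>, blast+)
  also have "(\<lambda>E. (if E \<in> ?A then 1 else 0 :: real) * (if E \<in> ?B then 1 else 0)) =
      (\<lambda>E. if E \<in> {E. \<forall>F\<in>insert F \<F>. \<not> F \<subseteq> E} then 1 else 0)" by auto
  also have "bweight p (all_edges n) \<dots> = ?P {E. \<forall>F\<in>insert F \<F>. \<not> F \<subseteq> E}"
    by (rule prob_eq_bweight[OF p, symmetric])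
  finally show ?case .
qed simp

lemma exp_le_one_minus_power:
  fixes x :: real
  assumes "0 \<le> x" "x \<le> 1 / 2" "real N * x \<le> C"
  shows "exp (- 2 * C) \<le> (1 - x) ^ N"
proof -
  \<comment> \<open>Turns the lower bound \<open>- x - 2 * x\<^sup>2\<close> for
    \<open>ln (1 - x)\<close> into \<open>- 2 * x\<close>.\<close>
  have "x\<^sup>2 \<le> x / 2" using assms mult_left_mono[of x "1/2" x] by (simp add: power2_eq_square)
  then have "- 2 * x \<le> ln (1 - x)" using ln_one_minus_pos_lower_bound[OF assms(1,2)] by simp
  then have "real N * (- 2 * x) \<le> real N * ln (1 - x)" by (rule mult_left_mono) simp
  then have "- 2 * C \<le> real N * ln (1 - x)" using assms(3) by simp
  then have "exp (- 2 * C) \<le> exp (real N * ln (1 - x))" by simp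
  also have "\<dots> = (1 - x) ^ N" using assms(2) by (simp add: exp_of_nat_mult)
  finally show ?thesis .
qed

text \<open>If the expected number of edge sets to be avoided is bounded, the product of the single
  probabilities stays above a constant, uniformly in \<open>n\<close>.\<close>

lemma prob_no_dense:
  assumes "0 \<le> p" "p \<le> 1" "p ^ f \<le> 1 / 2" "real n ^ w * p ^ f \<le> 1"
  shows "exp (- 2 * 2 ^ 2 ^ w) \<le>
    gprob n p {E. \<not> dense n w f E}"
proof -
  have "real (card (edge_subsets n w f)) * p ^ f \<le> real (2 ^ 2 ^ w * n ^ w) * p ^ f"
    using assms by (intro mult_right_mono) (simp_all only: of_nat_le_iff card_edge_subsets zero_le_power)
  also have "\<dots> = 2 ^ 2 ^ w * (real n ^ w * p ^ f)" by simp
  also have "\<dots> \<le> 2 ^ 2 ^ w * 1" using assms(4) by (intro mult_left_mono) auto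
  finally have "exp (- 2 * 2 ^ 2 ^ w) \<le> (1 - p ^ f) ^ card (edge_subsets n w f)"
    using assms by (intro exp_le_one_minus_power) auto
  also have "\<dots> \<le> gprob n p {E. \<forall>F\<in>edge_subsets n w f. \<not> F \<subseteq> E}"
    by (rule prob_avoid_all) (use assms card_edge_subsets in \<open>auto simp: edge_subsets_def\<close>)
  also have "\<dots> \<le> gprob n p {E. \<not> dense n w f E}"
  proof (rule prob_random_graph_mono)
    fix E assume E: "E \<subseteq> all_edges n" "E \<in> {E. \<forall>F\<in>edge_subsets n w f. \<not> F \<subseteq> E}"
    then show "E \<in> {E. \<not> dense n w f E}"
      unfolding mem_Collect_eq dense_edge_subsets[OF E(1)] by simp
  qed
  finally show ?thesis .
qed

section \<open>Second moment of the number of isolated copies\<close>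

definition vsets :: "nat \<Rightarrow> nat \<Rightarrow> nat set set" where
  "vsets n t = {W. W \<subseteq> {1..n} \<and> card W = t}"

definition touch :: "nat \<Rightarrow> nat set \<Rightarrow> nat set set" where
  "touch n W = {e \<in> all_edges n. e \<inter> W \<noteq> {}}"

text \<open>All edges meeting \<open>W\<close> are prescribed, including those to the rest of the
  graph. With connected \<open>F\<close> inside \<open>W\<close>, this makes \<open>W\<close> a
  component.\<close>

definition isolated :: "nat \<Rightarrow> nat set \<Rightarrow> nat set set \<Rightarrow> nat set set set" where
  "isolated n W F = {E. F \<subseteq> E \<and> E \<inter> (touch n W - F) = {}}"

lemma finite_vsets: "finite (vsets n t)"
  by (rule finite_subset[of _ "Pow {1..n}"]) (auto simp: vsets_def)

lemma card_vsets: "card (vsets n t) = n choose t"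
  using n_subsets[of "{1..n}" t] by (simp add: vsets_def)

lemma touch_subset: "touch n W \<subseteq> all_edges n"
  by (auto simp: touch_def)

lemma finite_touch: "finite (touch n W)"
  using touch_subset finite_all_edges by (rule finite_subset)

lemma card_touch_le:
  assumes "finite W"
  shows "card (touch n W) \<le> card W * n"
proof -
  have "touch n W \<subseteq> (\<lambda>(u, v). {u, v}) ` (W \<times> {1..n})"
  proof
    fix e assume e: "e \<in> touch n W"
    then obtain u where u: "u \<in> e" "u \<in> W" by (auto simp: touch_def)
    obtain x y where xy: "e = {x, y}" using e by (auto simp: touch_def all_edges_def card_2_iff)
    then have "x \<in> {1..n}" "y \<in> {1..n}" using e by (auto simp: touch_def all_edges_def)
    then obtain v where "v \<in> {1..n}" "e = {u, v}"
      using u xy by (cases "u = x") (auto simp: insert_commute)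
    then show "e \<in> (\<lambda>(u, v). {u, v}) ` (W \<times> {1..n})"
      using u(2) by (intro image_eqI[of _ _ "(u, v)"]) auto
  qed
  then have "card (touch n W) \<le> card ((\<lambda>(u, v). {u, v}) ` (W \<times> {1..n}))"
    using assms by (intro card_mono) auto
  also have "\<dots> \<le> card (W \<times> {1..n})" using assms by (intro card_image_le) auto
  finally show ?thesis by (simp add: card_cartesian_product)
qed

lemma card_touch_Int_le:
  assumes "finite W" "finite W'" "W \<inter> W' = {}"
  shows "card (touch n W \<inter> touch n W') \<le> card W * card W'"
proof -
  have "touch n W \<inter> touch n W' \<subseteq> (\<lambda>(u, v). {u, v}) ` (W \<times> W')"
  proof
    fix e assume e: "e \<in> touch n W \<inter> touch n W'"
    then obtain u v where u: "u \<in> e" "u \<in> W" and v: "v \<in> e" "v \<in> W'" by (auto simp: touch_def)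
    obtain x y where xy: "e = {x, y}" using e by (auto simp: touch_def all_edges_def card_2_iff)
    have "u \<noteq> v" using u v assms(3) by auto
    then have "e = {u, v}" using xy u v by auto
    then show "e \<in> (\<lambda>(u, v). {u, v}) ` (W \<times> W')" using u v by auto
  qed
  then have "card (touch n W \<inter> touch n W') \<le> card ((\<lambda>(u, v). {u, v}) ` (W \<times> W'))"
    using assms by (intro card_mono) auto
  also have "\<dots> \<le> card (W \<times> W')" using assms by (intro card_image_le) auto
  finally show ?thesis by (simp add: card_cartesian_product)
qed

text \<open>The last clause expresses that the graph \<open>F W\<close> chosen on \<open>W\<close> is connected.\<close>

definition copies :: "nat \<Rightarrow> nat \<Rightarrow> (nat set \<Rightarrow> nat set set) \<Rightarrow> bool" where
  "copies t f F \<longleftrightarrow> (\<forall>W. finite W \<and> card W = t \<longrightarrow> F W \<subseteq> {e. e \<subseteq> W \<and> card e = 2} \<and> card (F W) = f \<and>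
     (\<forall>Z. Z \<inter> W \<noteq> {} \<and> (\<forall>u\<in>W. \<forall>v\<in>W. {u, v} \<in> F W \<longrightarrow> u \<in> Z \<longrightarrow> v \<in> Z) \<longrightarrow> W \<subseteq> Z))"

lemma copiesD:
  assumes "copies t f F" "finite W" "card W = t"
  shows "F W \<subseteq> {e. e \<subseteq> W \<and> card e = 2}" "card (F W) = f"
    and "Z \<inter> W \<noteq> {} \<Longrightarrow> (\<And>u v. u \<in> W \<Longrightarrow> v \<in> W \<Longrightarrow> {u, v} \<in> F W \<Longrightarrow> u \<in> Z \<Longrightarrow> v \<in> Z) \<Longrightarrow> W \<subseteq> Z"
  using assms by (simp_all add: copies_def)

lemma copies_touch:
  assumes "copies t f F" "W \<in> vsets n t"
  shows "finite W" "F W \<subseteq> touch n W" "card (F W) = f" "card W = t"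
proof -
  show fin: "finite W" "card W = t" using assms(2) finite_subset by (auto simp: vsets_def)
  then have F: "F W \<subseteq> {e. e \<subseteq> W \<and> card e = 2}" "card (F W) = f" using assms(1) by (auto simp: copies_def)
  then show "card (F W) = f" by simp
  show "F W \<subseteq> touch n W"
  proof
    fix e assume "e \<in> F W"
    then have e: "e \<subseteq> W" "card e = 2" using F by auto
    then have "e \<noteq> {}" by auto
    then show "e \<in> touch n W" using e assms(2) by (auto simp: touch_def all_edges_def vsets_def)
  qed
qed

lemma prob_isolated:
  assumes p: "0 \<le> p" "p \<le> 1" and "copies t f F" "W \<in> vsets n t"
  shows "gprob n p (isolated n W (F W)) = p ^ f * (1 - p) ^ (card (touch n W) - f)"
proof -
  note c = copies_touch[OF assms(3,4)]
  have "gprob n p (isolated n W (F W)) =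
      p ^ card (F W) * (1 - p) ^ card (touch n W - F W)"
    unfolding isolated_def using c touch_subset[of n W] by (intro prob_cylinder p) auto
  also have "card (touch n W - F W) = card (touch n W) - f"
    using c finite_touch finite_subset by (metis card_Diff_subset)
  finally show ?thesis using c by simp
qed

text \<open>The events are independent up to the at most \<open>t * t\<close> pairs between
  \<open>W\<close> and \<open>W'\<close>, whose absence the product of the probabilities counts
  twice.\<close>

lemma prob_isolated_Int_disjoint:
  assumes p: "0 \<le> p" "p < 1" and "copies t f F" "W \<in> vsets n t" "W' \<in> vsets n t" "W \<inter> W' = {}"
  shows "gprob n p (isolated n W (F W) \<inter> isolated n W' (F W')) \<le>
    gprob n p (isolated n W (F W)) *
    gprob n p (isolated n W' (F W')) / (1 - p) ^ (t * t)"
proof -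
  note c = copies_touch[OF assms(3,4)] and c' = copies_touch[OF assms(3,5)]
  let ?T = "touch n W" and ?T' = "touch n W'"
  have sub: "F W \<subseteq> Pow W" "F W' \<subseteq> Pow W'"
    using copiesD(1)[OF assms(3) c(1,4)] copiesD(1)[OF assms(3) c'(1,4)] by auto
  have ne: "{} \<notin> touch n X" for X by (auto simp: touch_def)
  have x: "F W \<inter> ?T' = {}" "F W' \<inter> ?T = {}"
  proof -
    have "e \<inter> W' = {}" if "e \<in> F W" for e using sub(1) that assms(6) by blast
    moreover have "e \<inter> W = {}" if "e \<in> F W'" for e using sub(2) that assms(6) by blast
    ultimately show "F W \<inter> ?T' = {}" "F W' \<inter> ?T = {}" by (auto simp: touch_def)
  qed
  have disj: "F W \<inter> F W' = {}" using x c'(2) by auto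
  have finF: "finite (F W)" "finite (F W')" using c(2) c'(2) finite_touch finite_subset by blast+
  have eq: "isolated n W (F W) \<inter> isolated n W' (F W') =
      {E. F W \<union> F W' \<subseteq> E \<and> E \<inter> (?T \<union> ?T' - (F W \<union> F W')) = {}}"
    unfolding isolated_def using x by blast
  have le1: "f \<le> card ?T" "f \<le> card ?T'"
    using card_mono[OF finite_touch c(2)] card_mono[OF finite_touch c'(2)] c(3) c'(3) by simp_all
  have cU: "card (F W \<union> F W') = 2 * f" using finF disj c(3) c'(3) by (simp add: card_Un_disjoint)
  have cT: "card (?T \<union> ?T' - (F W \<union> F W')) = card (?T \<union> ?T') - 2 * f"
    using card_Diff_subset[of "F W \<union> F W'" "?T \<union> ?T'"] finF c(2) c'(2) cU by auto
  have "card ?T + card ?T' = card (?T \<union> ?T') + card (?T \<inter> ?T')"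
    by (rule card_Un_Int) (rule finite_touch)+
  also have "card (?T \<inter> ?T') \<le> t * t" using card_touch_Int_le[OF c(1) c'(1) assms(6)] c(4) c'(4) by simp
  finally have "(card ?T - f) + (card ?T' - f) \<le> (card (?T \<union> ?T') - 2 * f) + t * t" using le1 by simp
  then have "(1 - p) ^ ((card (?T \<union> ?T') - 2 * f) + t * t) \<le> (1 - p) ^ ((card ?T - f) + (card ?T' - f))"
    using p by (intro power_decreasing) auto
  then have le: "(1 - p) ^ (card (?T \<union> ?T') - 2 * f) \<le> (1 - p) ^ (card ?T - f) * (1 - p) ^ (card ?T' - f) / (1 - p) ^ (t * t)"
    using p by (simp add: power_add pos_le_divide_eq)
  have "gprob n p (isolated n W (F W) \<inter> isolated n W' (F W')) =
      p ^ card (F W \<union> F W') * (1 - p) ^ card (?T \<union> ?T' - (F W \<union> F W'))"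
    unfolding eq using p c(2) c'(2) touch_subset[of n W] touch_subset[of n W']
    by (intro prob_cylinder; (linarith | blast))
  also have "\<dots> = p ^ (2 * f) * (1 - p) ^ (card (?T \<union> ?T') - 2 * f)" by (simp only: cU cT)
  also have "\<dots> \<le> p ^ (2 * f) * ((1 - p) ^ (card ?T - f) * (1 - p) ^ (card ?T' - f) / (1 - p) ^ (t * t))"
    using le p by (intro mult_left_mono) auto
  also have "\<dots> = (p ^ f * (1 - p) ^ (card ?T - f)) * (p ^ f * (1 - p) ^ (card ?T' - f)) / (1 - p) ^ (t * t)"
    by (simp add: mult_2 power_add)
  also have "\<dots> = gprob n p (isolated n W (F W)) *
    gprob n p (isolated n W' (F W')) / (1 - p) ^ (t * t)"
    using p assms by (simp add: prob_isolated)
  finally show ?thesis .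
qed

text \<open>An edge of \<open>F A\<close> touching \<open>B\<close> belongs to \<open>F B\<close>
  and hence stays inside \<open>B\<close>; by connectedness all of \<open>A\<close> lies in
  \<open>B\<close>.\<close>

lemma isolated_overlap:
  assumes F: "copies t f F" and W: "W \<in> vsets n t" "W' \<in> vsets n t" and "W \<inter> W' \<noteq> {}"
    and E: "E \<in> isolated n W (F W)" "E \<in> isolated n W' (F W')"
  shows "W = W'"
proof -
  have "A \<subseteq> B" if A: "A \<in> vsets n t" "E \<in> isolated n A (F A)" and B: "B \<in> vsets n t" "E \<in> isolated n B (F B)"
    and "A \<inter> B \<noteq> {}" for A B
  proof -
    have "v \<in> B" if "u \<in> A" "v \<in> A" "{u, v} \<in> F A" "u \<in> B" for u v
    proof -
      have "{u, v} \<in> E" using A(2) that(3) by (auto simp: isolated_def)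
      moreover have "{u, v} \<in> touch n B"
        using copies_touch(2)[OF F A(1)] that(3,4) by (auto simp: touch_def)
      ultimately have "{u, v} \<in> F B" using B(2) by (auto simp: isolated_def)
      then have "{u, v} \<subseteq> B" using copiesD(1)[OF F copies_touch(1,4)[OF F B(1)]] by blast
      then show ?thesis by simp
    qed
    moreover have "B \<inter> A \<noteq> {}" using that by blast
    ultimately show "A \<subseteq> B" using copiesD(3)[OF F copies_touch(1,4)[OF F A(1)]] by simp
  qed
  then show ?thesis using assms by (metis Int_commute subset_antisym)
qed

definition ncopies :: "nat \<Rightarrow> nat \<Rightarrow> (nat set \<Rightarrow> nat set set) \<Rightarrow> nat set set \<Rightarrow> nat" where
  "ncopies n t F E = card {W \<in> vsets n t. E \<in> isolated n W (F W)}"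

definition mean_copies :: "nat \<Rightarrow> real \<Rightarrow> nat \<Rightarrow> (nat set \<Rightarrow> nat set set) \<Rightarrow> real" where
  "mean_copies n p t F = (\<Sum>W\<in>vsets n t. gprob n p (isolated n W (F W)))"

lemma ncopies_eq_sum: "real (ncopies n t F E) = (\<Sum>W\<in>vsets n t. indicator (isolated n W (F W)) E)"
proof -
  have "(\<Sum>W\<in>vsets n t. indicator (isolated n W (F W)) E) =
      (\<Sum>W\<in>{W \<in> vsets n t. E \<in> isolated n W (F W)}. 1 :: real)"
    using finite_vsets by (intro sum.mono_neutral_cong_right) auto
  then show ?thesis by (simp add: ncopies_def)
qed

lemma integrable_random_graph: "integrable (measure_pmf (random_graph n p)) (f :: _ \<Rightarrow> real)"
  by (rule integrable_measure_pmf_finite[OF finite_set_random_graph])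

lemma expectation_ncopies:
  "gexp n p (\<lambda>E. real (ncopies n t F E)) = mean_copies n p t F"
  unfolding ncopies_eq_sum mean_copies_def
  by (subst Bochner_Integration.integral_sum) (auto intro: integrable_random_graph)

text \<open>Equal sets contribute the mean, disjoint ones almost its square, and overlapping
  different ones nothing. Isolation is what removes the overlaps.\<close>

lemma expectation_ncopies_square:
  assumes p: "0 \<le> p" "p < 1" and F: "copies t f F"
  shows "gexp n p (\<lambda>E. (real (ncopies n t F E))\<^sup>2) \<le>
    mean_copies n p t F + (mean_copies n p t F)\<^sup>2 / (1 - p) ^ (t * t)"
proof -
  let ?P = "gprob n p" and ?I = "\<lambda>W. isolated n W (F W)"
  let ?c = "(1 - p) ^ (t * t)"
  have c: "0 < ?c" using p by simp
  have "(real (ncopies n t F E))\<^sup>2 = (\<Sum>W\<in>vsets n t. \<Sum>W'\<in>vsets n t. indicator (?I W \<inter> ?I W') E)" for E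
    unfolding ncopies_eq_sum power2_eq_square sum_product by (simp add: indicator_inter_arith)
  then have "gexp n p (\<lambda>E. (real (ncopies n t F E))\<^sup>2) =
      (\<Sum>W\<in>vsets n t. \<Sum>W'\<in>vsets n t. ?P (?I W \<inter> ?I W'))"
    by (simp add: Bochner_Integration.integral_sum integrable_random_graph)
  also have "\<dots> \<le> (\<Sum>W\<in>vsets n t. \<Sum>W'\<in>vsets n t. (if W' = W then ?P (?I W) else 0) + ?P (?I W) * ?P (?I W') / ?c)"
  proof (intro sum_mono)
    fix W W' assume W: "W \<in> vsets n t" "W' \<in> vsets n t"
    have nn: "0 \<le> ?P (?I W) * ?P (?I W') / ?c" using c by simp
    consider "W' = W" | "W' \<noteq> W" "W \<inter> W' = {}" | "W' \<noteq> W" "W \<inter> W' \<noteq> {}" by blast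
    then show "?P (?I W \<inter> ?I W') \<le> (if W' = W then ?P (?I W) else 0) + ?P (?I W) * ?P (?I W') / ?c"
    proof cases
      case 1
      then show ?thesis using nn by simp
    next
      case 2
      then show ?thesis using prob_isolated_Int_disjoint[OF p F W] by simp
    next
      case 3
      then have "?I W \<inter> ?I W' = {}" using isolated_overlap[OF F W] by blast
      then show ?thesis using 3 nn by simp
    qed
  qed
  also have "\<dots> = mean_copies n p t F + (\<Sum>W\<in>vsets n t. \<Sum>W'\<in>vsets n t. ?P (?I W) * ?P (?I W')) / ?c"
    by (simp add: sum.distrib finite_vsets mean_copies_def sum_divide_distrib)
  also have "(\<Sum>W\<in>vsets n t. \<Sum>W'\<in>vsets n t. ?P (?I W) * ?P (?I W')) = (mean_copies n p t F)\<^sup>2"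
    by (simp add: mean_copies_def power2_eq_square sum_product)
  finally show ?thesis .
qed

lemma mean_copies_bounds:
  assumes p: "0 \<le> p" "p \<le> 1" and F: "copies t f F"
  shows "mean_copies n p t F \<le> real (n choose t) * p ^ f"
    and "real (n choose t) * p ^ f * (1 - real (t * n) * p) \<le> mean_copies n p t F"
proof -
  have "mean_copies n p t F \<le> (\<Sum>W\<in>vsets n t. p ^ f)"
    unfolding mean_copies_def
  proof (rule sum_mono)
    fix W assume "W \<in> vsets n t"
    then have "gprob n p (isolated n W (F W)) = p ^ f * (1 - p) ^ (card (touch n W) - f)"
      by (rule prob_isolated[OF p F])
    also have "\<dots> \<le> p ^ f * 1" using p by (intro mult_left_mono power_le_one) auto
    finally show "gprob n p (isolated n W (F W)) \<le> p ^ f" by simp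
  qed
  then show "mean_copies n p t F \<le> real (n choose t) * p ^ f" by (simp add: card_vsets)
  have "real (n choose t) * p ^ f * (1 - real (t * n) * p) = (\<Sum>W\<in>vsets n t. p ^ f * (1 - real (t * n) * p))"
    by (simp add: card_vsets)
  also have "\<dots> \<le> mean_copies n p t F"
    unfolding mean_copies_def
  proof (rule sum_mono)
    fix W assume W: "W \<in> vsets n t"
    have "1 - real (t * n) * p \<le> (1 - p) ^ (t * n)"
      using Bernoulli_inequality[of "- p" "t * n"] p by simp
    also have "\<dots> \<le> (1 - p) ^ (card (touch n W) - f)"
      using card_touch_le[of W n] copies_touch[OF F W] p by (intro power_decreasing) auto
    finally have "p ^ f * (1 - real (t * n) * p) \<le> p ^ f * (1 - p) ^ (card (touch n W) - f)"
      using p by (intro mult_left_mono) auto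
    then show "p ^ f * (1 - real (t * n) * p) \<le> gprob n p (isolated n W (F W))"
      using prob_isolated[OF p F W] by simp
  qed
  finally show "real (n choose t) * p ^ f * (1 - real (t * n) * p) \<le> mean_copies n p t F" .
qed

text \<open>Chebyshev's inequality for the deviation from the mean down to \<open>m\<close>.\<close>

lemma prob_few_copies:
  assumes p: "0 \<le> p" "p < 1" and F: "copies t f F" and m: "real m < mean_copies n p t F"
  shows "gprob n p {E. ncopies n t F E < m} \<le>
    (mean_copies n p t F + (mean_copies n p t F)\<^sup>2 * (1 / (1 - p) ^ (t * t) - 1)) / (mean_copies n p t F - real m)\<^sup>2"
proof -
  let ?\<mu> = "mean_copies n p t F" and ?X = "\<lambda>E. real (ncopies n t F E)"
  have d: "0 < (?\<mu> - real m)\<^sup>2" using m by simp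
  have "gprob n p {E. ncopies n t F E < m} = gexp n p (indicator {E. ncopies n t F E < m})"
    by simp
  also have "\<dots> \<le> gexp n p (\<lambda>E. (?\<mu> - ?X E)\<^sup>2 / (?\<mu> - real m)\<^sup>2)"
  proof (rule integral_mono[OF integrable_random_graph integrable_random_graph])
    fix E
    show "indicator {E. ncopies n t F E < m} E \<le> (?\<mu> - ?X E)\<^sup>2 / (?\<mu> - real m)\<^sup>2"
    proof (cases "ncopies n t F E < m")
      case True
      then have "(?\<mu> - real m)\<^sup>2 \<le> (?\<mu> - ?X E)\<^sup>2" using m by (intro power_mono) auto
      then show ?thesis using True d by simp
    qed simp
  qed
  also have "\<dots> = gexp n p (\<lambda>E. (?X E)\<^sup>2 + (?\<mu>\<^sup>2 - 2 * ?\<mu> * ?X E)) / (?\<mu> - real m)\<^sup>2"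
    by (simp add: power2_diff algebra_simps)
  also have "gexp n p (\<lambda>E. (?X E)\<^sup>2 + (?\<mu>\<^sup>2 - 2 * ?\<mu> * ?X E)) =
      gexp n p (\<lambda>E. (?X E)\<^sup>2) - ?\<mu>\<^sup>2"
    by (simp add: Bochner_Integration.integral_add[OF integrable_random_graph integrable_random_graph]
        Bochner_Integration.integral_diff[OF integrable_random_graph integrable_random_graph]
        expectation_ncopies power2_eq_square)
  also have "\<dots> / (?\<mu> - real m)\<^sup>2 \<le> (?\<mu> + ?\<mu>\<^sup>2 * (1 / (1 - p) ^ (t * t) - 1)) / (?\<mu> - real m)\<^sup>2"
    using expectation_ncopies_square[OF p F, of n] d by (intro divide_right_mono) (auto simp: algebra_simps)
  finally show ?thesis .
qed

text \<open>Bonferroni: \<open>X - X (X - 1) / 2\<close> is at most the indicator of \<open>X \<ge> 1\<close>.\<close>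

lemma prob_some_copy:
  assumes p: "0 \<le> p" "p < 1" and F: "copies t f F"
  shows "mean_copies n p t F - (mean_copies n p t F)\<^sup>2 / (1 - p) ^ (t * t) / 2 \<le>
    gprob n p {E. 0 < ncopies n t F E}"
proof -
  let ?\<mu> = "mean_copies n p t F" and ?X = "\<lambda>E. real (ncopies n t F E)"
  have "?\<mu> - ?\<mu>\<^sup>2 / (1 - p) ^ (t * t) / 2 \<le> (3 * ?\<mu> - gexp n p (\<lambda>E. (?X E)\<^sup>2)) / 2"
    using expectation_ncopies_square[OF p F, of n] by simp
  also have "\<dots> = gexp n p (\<lambda>E. (3 * ?X E - (?X E)\<^sup>2) / 2)"
    by (simp add: Bochner_Integration.integral_diff[OF integrable_random_graph integrable_random_graph] expectation_ncopies)
  also have "\<dots> \<le> gexp n p (indicator {E. 0 < ncopies n t F E})"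
  proof (rule integral_mono[OF integrable_random_graph integrable_random_graph])
    fix E
    have *: "3 * x - x\<^sup>2 \<le> 2" if "x = 1 \<or> 2 \<le> x" for x :: real
    proof -
      have "0 \<le> (x - 1) * (x - 2)" using that by auto
      then show ?thesis by (simp add: power2_eq_square algebra_simps)
    qed
    consider "ncopies n t F E = 0" | "ncopies n t F E = 1" | "2 \<le> ncopies n t F E" by linarith
    then show "(3 * ?X E - (?X E)\<^sup>2) / 2 \<le> indicator {E. 0 < ncopies n t F E} E"
      using *[of "?X E"] by cases auto
  qed
  finally show ?thesis by simp
qed

section \<open>Limits at the critical edge probability\<close>

locale critical_p =
  fixes l :: nat and p :: "nat \<Rightarrow> real"
  assumes l: "1 \<le> l" and p_def: "p = (\<lambda>n. real n powr (- (1 + 1 / real l)))"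
begin

lemma p_bounds: "0 \<le> p n" "p n \<le> 1"
proof -
  show "0 \<le> p n" by (simp add: p_def)
  show "p n \<le> 1"
  proof (cases "n = 0")
    case False
    have "0 < 1 + 1 / real l" by (simp add: add_pos_nonneg)
    then have "real n powr (- (1 + 1 / real l)) \<le> real n powr 0"
      using False by (intro powr_mono) linarith+
    then show ?thesis using False by (simp add: p_def)
  qed (simp add: p_def)
qed

lemma p_less:
  assumes "2 \<le> n"
  shows "p n < 1"
proof -
  have "0 < 1 + 1 / real l" by (simp add: add_pos_nonneg)
  then have "real n powr (- (1 + 1 / real l)) < real n powr 0"
    using assms by (intro powr_less_mono) linarith+
  then show ?thesis using assms by (simp add: p_def)
qed

lemma power_p:
  assumes "1 \<le> n"
  shows "real n ^ w * p n ^ f = real n powr (real w - real f * (1 + 1 / real l))"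
proof -
  have "p n ^ f = (real n powr (- (1 + 1 / real l))) powr real f"
    using assms by (simp add: p_def powr_realpow)
  also have "\<dots> = real n powr (- (real f * (1 + 1 / real l)))"
    unfolding powr_powr by (simp only: mult_minus_left mult_minus_right mult.commute)
  finally have "real n ^ w * p n ^ f = real n powr real w * real n powr (- (real f * (1 + 1 / real l)))"
    using assms by (simp add: powr_realpow)
  then show ?thesis by (simp only: powr_add[symmetric] diff_conv_add_uminus)
qed

lemma power_p_tendsto_0:
  assumes "real w < real f * (1 + 1 / real l)"
  shows "(\<lambda>n. real n ^ w * p n ^ f) \<longlonglongrightarrow> 0"
proof -
  have "(\<lambda>n. real n powr (real w - real f * (1 + 1 / real l))) \<longlonglongrightarrow> 0"
    using assms by (intro tendsto_neg_powr filterlim_real_sequentially) simp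
  moreover have "eventually (\<lambda>n. real n ^ w * p n ^ f = real n powr (real w - real f * (1 + 1 / real l))) sequentially"
    using eventually_ge_at_top[of 1] by eventually_elim (rule power_p)
  ultimately show ?thesis by (simp only: tendsto_cong)
qed

lemma power_p_crit: "1 \<le> n \<Longrightarrow> real n ^ (l + 1) * p n ^ l = 1"
  using l by (subst power_p) (simp_all add: field_simps)

lemma np_tendsto_0: "(\<lambda>n. real n * p n) \<longlonglongrightarrow> 0"
  using power_p_tendsto_0[of 1 1] l by simp

lemma p_tendsto_0: "p \<longlonglongrightarrow> 0"
  using power_p_tendsto_0[of 0 1] l by (simp add: add_pos_nonneg)

lemma one_minus_p_tendsto: "(\<lambda>n. 1 / (1 - p n) ^ c) \<longlonglongrightarrow> 1"
proof -
  have "(\<lambda>n. 1 / (1 - p n) ^ c) \<longlonglongrightarrow> 1 / (1 - 0) ^ c"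
    by (intro tendsto_intros p_tendsto_0) simp
  then show ?thesis by simp
qed

text \<open>The binomial coefficient is at least \<open>(n / t) ^ t\<close>, and isolation costs at
  most a factor of 2 as soon as \<open>t * n * p n < 1 / 2\<close>.\<close>

lemma mean_copies_lower:
  assumes "copies t f F" "1 \<le> t"
  shows "eventually (\<lambda>n. (1 / real t) ^ t / 2 * (real n ^ t * p n ^ f) \<le> mean_copies n (p n) t F) sequentially"
proof -
  have "(\<lambda>n. real t * (real n * p n)) \<longlonglongrightarrow> real t * 0"
    by (intro tendsto_intros np_tendsto_0)
  then have "eventually (\<lambda>n. real t * (real n * p n) < 1 / 2) sequentially"
    by (intro order_tendstoD) auto
  then show ?thesis
    using eventually_ge_at_top[of t]
  proof eventually_elim
    case (elim n)
    have "(1 / real t) ^ t / 2 * (real n ^ t * p n ^ f) = (real n / real t) ^ t * p n ^ f * (1 / 2)"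
      by (simp add: power_divide)
    also have "\<dots> \<le> real (n choose t) * p n ^ f * (1 - real (t * n) * p n)"
      using elim p_bounds binomial_ge_n_over_k_pow_k[OF elim(2), where 'a = real]
      by (intro mult_mono) (auto simp: mult.assoc)
    also have "\<dots> \<le> mean_copies n (p n) t F"
      by (rule mean_copies_bounds(2)[OF p_bounds assms(1)])
    finally show ?case .
  qed
qed

lemma mean_copies_at_top:
  assumes "copies t (t - 1) F" "1 \<le> t" "t \<le> l"
  shows "filterlim (\<lambda>n. mean_copies n (p n) t F) at_top sequentially"
proof (rule filterlim_at_top_mono[OF _ mean_copies_lower[OF assms(1,2)]])
  \<comment> \<open>The exponent equals \<open>1 - (t - 1) / l\<close>, which is positive exactly
    for \<open>t \<le> l\<close>.\<close>
  let ?e = "real t - real (t - 1) * (1 + 1 / real l)"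
  have "real (t - 1) < real l" using assms by simp
  then have "real (t - 1) / real l < 1" using l by simp
  then have e: "0 < ?e" using assms(2) by (simp add: algebra_simps of_nat_diff)
  have "filterlim (\<lambda>n. real n powr ?e) at_top sequentially"
    by (rule filterlim_compose[OF real_powr_at_top[OF e] filterlim_real_sequentially])
  then have "filterlim (\<lambda>n. (1 / real t) ^ t / 2 * (real n powr ?e)) at_top sequentially"
    using assms(2) by (intro filterlim_tendsto_pos_mult_at_top[OF tendsto_const]) auto
  moreover have "eventually (\<lambda>n. (1 / real t) ^ t / 2 * (real n powr ?e) =
      (1 / real t) ^ t / 2 * (real n ^ t * p n ^ (t - 1))) sequentially"
    using eventually_ge_at_top[of 1] by eventually_elim (simp only: power_p)
  ultimately show "filterlim (\<lambda>n. (1 / real t) ^ t / 2 * (real n ^ t * p n ^ (t - 1))) at_top sequentially"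
    using filterlim_cong[OF refl refl] by fast
qed

lemma few_copies_tendsto_0:
  assumes "copies t (t - 1) F" "1 \<le> t" "t \<le> l"
  shows "(\<lambda>n. gprob n (p n) {E. ncopies n t F E < m}) \<longlonglongrightarrow> 0"
proof -
  define \<mu> where "\<mu> n = mean_copies n (p n) t F" for n
  define c where "c n = 1 / (1 - p n) ^ (t * t)" for n
  have \<mu>: "filterlim \<mu> at_top sequentially" unfolding \<mu>_def by (rule mean_copies_at_top[OF assms])
  then have inv: "(\<lambda>n. 1 / \<mu> n) \<longlonglongrightarrow> 0"
    using tendsto_inverse_0_at_top[OF \<mu>] by (simp add: inverse_eq_divide)
  have c: "c \<longlonglongrightarrow> 1" unfolding c_def by (rule one_minus_p_tendsto)
  \<comment> \<open>Chebyshev's bound after division of numerator and denominator by the square of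
    the mean.\<close>
  have "(\<lambda>n. (1 / \<mu> n + (c n - 1)) / (1 - real m * (1 / \<mu> n))\<^sup>2) \<longlonglongrightarrow> (0 + (1 - 1)) / (1 - real m * 0)\<^sup>2"
    by (intro tendsto_intros inv c) simp
  then have lim: "(\<lambda>n. (1 / \<mu> n + (c n - 1)) / (1 - real m * (1 / \<mu> n))\<^sup>2) \<longlonglongrightarrow> 0" by simp
  have "eventually (\<lambda>n. real m + 1 < \<mu> n) sequentially"
    using \<mu> by (simp add: filterlim_at_top_dense)
  then have "eventually (\<lambda>n. gprob n (p n) {E. ncopies n t F E < m} \<le>
      (1 / \<mu> n + (c n - 1)) / (1 - real m * (1 / \<mu> n))\<^sup>2) sequentially"
    using eventually_ge_at_top[of 2]
  proof eventually_elim
    case (elim n)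
    have pos: "0 < \<mu> n" "\<mu> n \<noteq> real m" using elim(1) by auto
    have "gprob n (p n) {E. ncopies n t F E < m} \<le>
        (\<mu> n + (\<mu> n)\<^sup>2 * (c n - 1)) / (\<mu> n - real m)\<^sup>2"
      unfolding \<mu>_def c_def
      by (rule prob_few_copies[OF p_bounds(1) p_less[OF elim(2)] assms(1)]) (use elim(1) in \<open>simp add: \<mu>_def\<close>)
    also have "\<dots> = ((1 / \<mu> n + (c n - 1)) * (\<mu> n)\<^sup>2) / ((1 - real m * (1 / \<mu> n))\<^sup>2 * (\<mu> n)\<^sup>2)"
    proof -
      have "\<mu> n + (\<mu> n)\<^sup>2 * (c n - 1) = (1 / \<mu> n + (c n - 1)) * (\<mu> n)\<^sup>2"
        using pos by (simp add: field_simps power2_eq_square)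
      moreover have "\<mu> n - real m = (1 - real m * (1 / \<mu> n)) * \<mu> n"
        using pos(1) by (simp add: left_diff_distrib)
      ultimately show ?thesis by (simp only: power_mult_distrib)
    qed
    also have "\<dots> = (1 / \<mu> n + (c n - 1)) / (1 - real m * (1 / \<mu> n))\<^sup>2"
      using pos by simp
    finally show ?case .
  qed
  then show ?thesis
    by (intro real_tendsto_sandwich[OF _ _ tendsto_const lim]) auto
qed

lemma some_copy_lower:
  assumes "copies (l + 1) l F"
  shows "\<exists>\<delta>>0. eventually (\<lambda>n. \<delta> \<le> gprob n (p n) {E. 0 < ncopies n (l + 1) F E}) sequentially"
proof -
  let ?t = "l + 1"
  \<comment> \<open>Half of the lower bound for the mean; the other half absorbs the Bonferroni
    correction.\<close>
  define \<delta> where "\<delta> = (1 / real ?t) ^ ?t / 2 / 2"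
  have "eventually (\<lambda>n. 1 / (1 - p n) ^ (?t * ?t) < 2) sequentially"
    using one_minus_p_tendsto[of "?t * ?t"] by (rule order_tendstoD) simp
  moreover have "1 \<le> ?t" by simp
  note mean_copies_lower[OF assms this]
  moreover note eventually_ge_at_top[of 2]
  ultimately have "eventually (\<lambda>n. \<delta> \<le> gprob n (p n) {E. 0 < ncopies n ?t F E}) sequentially"
  proof eventually_elim
    case (elim n)
    let ?\<mu> = "mean_copies n (p n) ?t F" and ?c = "1 / (1 - p n) ^ (?t * ?t)"
    have crit: "real n ^ ?t * p n ^ l = 1" using power_p_crit elim(3) by simp
    have "?\<mu> \<le> real (n choose ?t) * p n ^ l" by (rule mean_copies_bounds(1)[OF p_bounds assms])
    also have "\<dots> \<le> (real n ^ ?t / 2) * p n ^ l"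
    proof (intro mult_right_mono)
      have "(2::nat) \<le> fact ?t" using fact_ge_self[of ?t] l by simp
      then have "(n choose ?t) * 2 \<le> (n choose ?t) * fact ?t" by (rule mult_le_mono2)
      also have "\<dots> \<le> n ^ ?t" by (rule binomial_fact_pow)
      finally have "real ((n choose ?t) * 2) \<le> real (n ^ ?t)" by (simp only: of_nat_le_iff)
      then show "real (n choose ?t) \<le> real n ^ ?t / 2" by simp
    qed (use p_bounds in simp)
    finally have up: "?\<mu> \<le> 1 / 2" using crit by simp
    have lo: "2 * \<delta> \<le> ?\<mu>" using elim(2)[unfolded crit] unfolding \<delta>_def by linarith
    have pos: "0 < \<delta>" by (simp add: \<delta>_def)
    \<comment> \<open>Here \<open>l \<ge> 1\<close> enters through \<open>(l + 1)! \<ge> 2\<close>: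
      the mean is at most 1/2, and as the correlation factor is below 2, the correction takes away
      at most half of the mean.\<close>
    have "?\<mu>\<^sup>2 * ?c \<le> (?\<mu> * (1 / 2)) * 2"
      using up lo pos elim(1) p_bounds by (intro mult_mono) (auto simp: power2_eq_square)
    then have "?\<mu>\<^sup>2 / (1 - p n) ^ (?t * ?t) \<le> ?\<mu> * (1 / 2) * 2"
      by (simp only: times_divide_eq_right mult_1_right)
    moreover define q where "q = ?\<mu>\<^sup>2 / (1 - p n) ^ (?t * ?t)"
    ultimately have "q \<le> ?\<mu>" by simp
    then have "\<delta> \<le> ?\<mu> - q / 2" using lo by linarith
    then have "\<delta> \<le> ?\<mu> - ?\<mu>\<^sup>2 / (1 - p n) ^ (?t * ?t) / 2" by (simp only: q_def)
    also have "\<dots> \<le> gprob n (p n) {E. 0 < ncopies n ?t F E}"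
      by (rule prob_some_copy[OF p_bounds(1) p_less[OF elim(3)] assms])
    finally show ?case .
  qed
  moreover have "0 < \<delta>" by (simp add: \<delta>_def)
  ultimately show ?thesis by blast
qed

text \<open>The exponents of \<open>n\<close> in the two first moment bounds are
  \<open>- w / l\<close> for \<open>w\<close> edges on \<open>w\<close> vertices and
  \<open>- 1 / l\<close> for \<open>l + 1\<close> edges on \<open>l + 2\<close> vertices.\<close>

lemma not_sparse_tendsto_0:
  "(\<lambda>n. gprob n (p n) {E. \<not> sparse l {1..n} E}) \<longlonglongrightarrow> 0"
proof -
  let ?b = "\<lambda>n w f. 2 ^ 2 ^ w * (real n ^ w * p n ^ f)"
  have b0: "(\<lambda>n. ?b n w f) \<longlonglongrightarrow> 0" if "real w < real f * (1 + 1 / real l)" for w f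
    using tendsto_mult_left[OF power_p_tendsto_0[OF that], of "2 ^ 2 ^ w"] by simp
  have "(\<lambda>n. (\<Sum>w\<in>{1..l + 1}. ?b n w w) + ?b n (l + 2) (l + 1)) \<longlonglongrightarrow> (\<Sum>w\<in>{1..l + 1}. 0) + 0"
    using l by (intro tendsto_add tendsto_sum b0) (auto simp: field_simps)
  then have lim: "(\<lambda>n. (\<Sum>w\<in>{1..l + 1}. ?b n w w) + ?b n (l + 2) (l + 1)) \<longlonglongrightarrow> 0" by simp
  have "gprob n (p n) {E. \<not> sparse l {1..n} E} \<le>
      (\<Sum>w\<in>{1..l + 1}. ?b n w w) + ?b n (l + 2) (l + 1)" for n
  proof -
    let ?P = "gprob n (p n)"
    let ?A = "\<lambda>w f. {E. dense n w f E}"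
    have "{E. \<not> sparse l {1..n} E} \<subseteq> (\<Union>w\<in>{1..l + 1}. ?A w w) \<union> ?A (l + 2) (l + 1)"
    proof
      fix E assume "E \<in> {E. \<not> sparse l {1..n} E}"
      then have "(\<exists>W\<subseteq>{1..n}. (W \<noteq> {} \<and> card W \<le> l + 1) \<and> card W \<le> card (E \<inter> Pow W)) \<or>
        (\<exists>W\<subseteq>{1..n}. card W = l + 2 \<and> l + 1 \<le> card (E \<inter> Pow W))"
        unfolding sparse_def mem_Collect_eq de_Morgan_conj not_all not_imp not_less not_le Suc_eq_plus1[symmetric] Suc_le_eq
        by blast
      then consider W where "W \<subseteq> {1..n}" "W \<noteq> {}" "card W \<le> l + 1" "card W \<le> card (E \<inter> Pow W)"
        | W where "W \<subseteq> {1..n}" "card W = l + 2" "l + 1 \<le> card (E \<inter> Pow W)"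
        by blast
      then show "E \<in> (\<Union>w\<in>{1..l + 1}. ?A w w) \<union> ?A (l + 2) (l + 1)"
      proof cases
        case 1
        then have "card W \<noteq> 0" using finite_subset[of W "{1..n}"] by auto
        then have "card W \<in> {1..l + 1}" using 1(3) by simp
        then show ?thesis using 1 by blast
      qed blast
    qed
    then have "?P {E. \<not> sparse l {1..n} E} \<le> ?P ((\<Union>w\<in>{1..l + 1}. ?A w w) \<union> ?A (l + 2) (l + 1))"
      by (intro measure_pmf.finite_measure_mono) auto
    also have "\<dots> \<le> ?P (\<Union>w\<in>{1..l + 1}. ?A w w) + ?P (?A (l + 2) (l + 1))"
      by (rule measure_Un_le) auto
    also have "?P (\<Union>w\<in>{1..l + 1}. ?A w w) \<le> (\<Sum>w\<in>{1..l + 1}. ?P (?A w w))"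
      by (rule measure_pmf.finite_measure_subadditive_finite) auto
    also have "\<dots> \<le> (\<Sum>w\<in>{1..l + 1}. ?b n w w)"
      by (intro sum_mono prob_dense p_bounds)
    also have "?P (?A (l + 2) (l + 1)) \<le> ?b n (l + 2) (l + 1)"
      by (intro prob_dense p_bounds)
    finally show ?thesis by simp
  qed
  then show ?thesis
    by (intro real_tendsto_sandwich[OF _ _ tendsto_const lim]) auto
qed

end

section \<open>The MSO zero-one law\<close>

definition copy_of :: "bt \<Rightarrow> nat set \<Rightarrow> nat set set" where
  "copy_of t W = (SOME F. F \<subseteq> {e. e \<subseteq> W \<and> card e = 2} \<and> (\<exists>r. realizes t W F r))"

lemma copy_of:
  assumes "finite W" "card W = nverts t"
  shows "copy_of t W \<subseteq> {e. e \<subseteq> W \<and> card e = 2}" "\<exists>r. realizes t W (copy_of t W) r"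
proof -
  have "\<exists>F. F \<subseteq> {e. e \<subseteq> W \<and> card e = 2} \<and> (\<exists>r. realizes t W F r)"
    using realizes_exists[OF assms] by blast
  then have "copy_of t W \<subseteq> {e. e \<subseteq> W \<and> card e = 2} \<and> (\<exists>r. realizes t W (copy_of t W) r)"
    unfolding copy_of_def by (rule someI_ex)
  then show "copy_of t W \<subseteq> {e. e \<subseteq> W \<and> card e = 2}" "\<exists>r. realizes t W (copy_of t W) r" by auto
qed

lemma copies_copy_of: "copies (nverts t) (nverts t - 1) (copy_of t)"
  unfolding copies_def
proof (intro allI impI conjI)
  fix W :: "nat set" assume W: "finite W \<and> card W = nverts t"
  then show F: "copy_of t W \<subseteq> {e. e \<subseteq> W \<and> card e = 2}" by (intro copy_of) auto
  obtain r where r: "realizes t W (copy_of t W) r" using copy_of(2) W by blast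
  have "copy_of t W \<inter> Pow W = copy_of t W" using F by auto
  then show "card (copy_of t W) = nverts t - 1"
    using realizes_card_edges[OF r] F by fastforce
  fix Z assume Z: "Z \<inter> W \<noteq> {} \<and> (\<forall>u\<in>W. \<forall>v\<in>W. {u, v} \<in> copy_of t W \<longrightarrow> u \<in> Z \<longrightarrow> v \<in> Z)"
  show "W \<subseteq> Z" by (rule realizes_connected[OF r]) (use Z in auto)
qed

lemma isolated_nbr:
  assumes E: "E \<subseteq> all_edges n" "E \<in> isolated n W F" and F: "F \<subseteq> Pow W" and u: "u \<in> W"
  shows "{u, v} \<in> E \<longleftrightarrow> {u, v} \<in> F"
  using E u by (auto simp: isolated_def touch_def)

lemma isolated_comps:
  assumes E: "E \<subseteq> all_edges n" and W: "W \<in> vsets n (nverts t)" "E \<in> isolated n W (copy_of t W)"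
  shows "W \<in> comps {1..n} E \<and> (\<exists>r. realizes t W E r)"
proof -
  note c = copies_touch(1,4)[OF copies_copy_of W(1)]
  have F: "copy_of t W \<subseteq> Pow W" using copy_of(1)[OF c] by auto
  note nbr = isolated_nbr[OF E W(2) F]
  obtain r where "realizes t W (copy_of t W) r" using copy_of(2)[OF c] by blast
  then have r: "realizes t W E r" by (rule realizes_cong) (simp add: nbr)
  have "{u, v} \<notin> E" if "u \<in> W" "v \<in> {1..n} - W" for u v
    using nbr[OF that(1), of v] F that(2) by auto
  then show ?thesis using r W(1) by (auto simp: comps_def vsets_def)
qed

lemma ncopies_le_comps:
  assumes "E \<subseteq> all_edges n"
  shows "ncopies n (nverts t) (copy_of t) E \<le> card {D\<in>comps {1..n} E. \<exists>r. realizes t D E r}"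
  unfolding ncopies_def
proof (rule card_mono)
  have "finite (comps {1..n} E)" using parts_comps[of "{1..n}" E] by (simp add: parts_def)
  then show "finite {D\<in>comps {1..n} E. \<exists>r. realizes t D E r}" by simp
  show "{W \<in> vsets n (nverts t). E \<in> isolated n W (copy_of t W)} \<subseteq> {D\<in>comps {1..n} E. \<exists>r. realizes t D E r}"
    using isolated_comps[OF assms] by blast
qed

text \<open>Keeps the union bound over all trees with at most \<open>l\<close> vertices
  finite.\<close>

lemma finite_small_bt: "finite {t. nverts t \<le> s}"
proof (induction s)
  case 0
  have "nverts t \<noteq> 0" for t using nverts_pos[of t] by simp
  then have "{t. nverts t \<le> 0} = {}" by auto
  then show ?case by (simp only: finite.emptyI)
next
  case (Suc s)
  have "{t. nverts t \<le> Suc s} \<subseteq> insert Leaf ((\<lambda>(a, b). Att a b) ` ({t. nverts t \<le> s} \<times> {t. nverts t \<le> s}))"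
  proof
    fix t assume t: "t \<in> {t. nverts t \<le> Suc s}"
    show "t \<in> insert Leaf ((\<lambda>(a, b). Att a b) ` ({t. nverts t \<le> s} \<times> {t. nverts t \<le> s}))"
    proof (cases t)
      case (Att a b)
      then have "nverts a \<le> s" "nverts b \<le> s" using t nverts_pos[of a] nverts_pos[of b] by auto
      then show ?thesis using Att by auto
    qed simp
  qed
  then show ?case by (rule finite_subset) (simp add: Suc.IH)
qed

lemma models_tp_eq:
  assumes "mso_sentence \<phi>" "qdepth \<phi> \<le> k" "tp k V E z [] = tp k V' E' z' []"
    and "finite V" "finite V'" "\<And>e. e \<in> E \<Longrightarrow> card e = 2" "\<And>e. e \<in> E' \<Longrightarrow> card e = 2"
  shows "models V E \<phi> \<longleftrightarrow> models V' E' \<phi>"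
  unfolding models_def
proof (rule sat_tp_eq[OF assms(2,3)])
  show "{v} \<notin> E" for v using assms(6)[of "{v}"] by auto
  show "{v} \<notin> E'" for v using assms(7)[of "{v}"] by auto
qed (use assms(1,4,5) in \<open>simp_all add: mso_sentence_def named_def\<close>)

context critical_p
begin

lemma not_rich_tendsto_0:
  "(\<lambda>n. gprob n (p n) {E. \<not> rich l m {1..n} E}) \<longlonglongrightarrow> 0"
proof -
  let ?S = "{t. nverts t \<le> l}"
  let ?P = "\<lambda>n. gprob n (p n)"
  let ?A = "\<lambda>n t. {E. ncopies n (nverts t) (copy_of t) E < m}"
  have "(\<lambda>n. ?P n {E. \<not> sparse l {1..n} E} + (\<Sum>t\<in>?S. ?P n (?A n t))) \<longlonglongrightarrow> 0 + (\<Sum>t\<in>?S. 0)"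
    using nverts_pos
    by (intro tendsto_add not_sparse_tendsto_0 tendsto_sum few_copies_tendsto_0 copies_copy_of) (auto simp: Suc_le_eq)
  then have lim: "(\<lambda>n. ?P n {E. \<not> sparse l {1..n} E} + (\<Sum>t\<in>?S. ?P n (?A n t))) \<longlonglongrightarrow> 0" by simp
  have "?P n {E. \<not> rich l m {1..n} E} \<le> ?P n {E. \<not> sparse l {1..n} E} + (\<Sum>t\<in>?S. ?P n (?A n t))" for n
  proof -
    have "?P n {E. \<not> rich l m {1..n} E} \<le> ?P n ({E. \<not> sparse l {1..n} E} \<union> (\<Union>t\<in>?S. ?A n t))"
    proof (rule prob_random_graph_mono)
      fix E assume E: "E \<subseteq> all_edges n" "E \<in> {E. \<not> rich l m {1..n} E}"
      show "E \<in> {E. \<not> sparse l {1..n} E} \<union> (\<Union>t\<in>?S. ?A n t)"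
      proof (cases "sparse l {1..n} E")
        case True
        then obtain t where "nverts t \<le> l" "card {D\<in>comps {1..n} E. \<exists>r. realizes t D E r} < m"
        using E(2) by (auto simp: rich_def not_le)
        then show ?thesis using ncopies_le_comps[OF E(1), of t] by (auto intro: le_less_trans)
      qed simp
    qed
    also have "\<dots> \<le> ?P n {E. \<not> sparse l {1..n} E} + ?P n (\<Union>t\<in>?S. ?A n t)"
      by (rule measure_Un_le) auto
    also have "?P n (\<Union>t\<in>?S. ?A n t) \<le> (\<Sum>t\<in>?S. ?P n (?A n t))"
      by (rule measure_pmf.finite_measure_subadditive_finite) (auto simp: finite_small_bt)
    finally show ?thesis by simp
  qed
  then show ?thesis
    by (intro real_tendsto_sandwich[OF _ _ tendsto_const lim]) auto
qed

theorem mso_law: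
  assumes k: "4 \<le> k" and large: "tower (k + log_star (k + 1) + 3) \<le> l"
  shows "mso_zero_one_law k p"
  unfolding mso_zero_one_law_def
proof (intro allI impI, elim conjE)
  fix \<phi> assume \<phi>: "mso_sentence \<phi>" "qdepth \<phi> \<le> k"
  \<comment> \<open>0 is no vertex of any \<open>{1..n}\<close>, so it can serve as the outside root
    for all graphs at once.\<close>
  from rich_tp_eq[OF k large, where z = 0] obtain m where m: "\<forall>V E V' E'. finite V \<and> finite V' \<and>
      (\<forall>e\<in>E. card e = 2) \<and> (\<forall>e\<in>E'. card e = 2) \<and> 0 \<notin> V \<and> 0 \<notin> V' \<and>
      rich l m V E \<and> rich l m V' E' \<longrightarrow> tp k V E (0 :: nat) [] = tp k V' E' (0 :: nat) []"
    by (elim exE)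
  let ?P = "\<lambda>n. gprob n (p n)"
  let ?R = "\<lambda>n. {E. \<not> rich l m {1..n} E}"
  \<comment> \<open>The orders \<open>n\<close> and \<open>n'\<close> may differ: the truth value is
    common to all rich graphs, so a single rich graph decides which limit occurs.\<close>
  have same: "models {1..n} E \<phi> \<longleftrightarrow> models {1..n'} E' \<phi>"
    if "E \<subseteq> all_edges n" "E' \<subseteq> all_edges n'" "rich l m {1..n} E" "rich l m {1..n'} E'" for n n' E E'
  proof (rule models_tp_eq[OF \<phi>])
    have "\<forall>e\<in>E. card e = 2" "\<forall>e\<in>E'. card e = 2" using that(1,2) by (auto simp: all_edges_def)
    then show "tp k {1..n} E 0 [] = tp k {1..n'} E' 0 []" "\<And>e. e \<in> E \<Longrightarrow> card e = 2" "\<And>e. e \<in> E' \<Longrightarrow> card e = 2"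
      using m[rule_format, of "{1..n}" "{1..n'}" E E'] that(3,4) by auto
  qed auto
  have R: "(\<lambda>n. ?P n (?R n)) \<longlonglongrightarrow> 0" by (rule not_rich_tendsto_0)
  show "(\<lambda>n. graph_prob n (p n) \<phi>) \<longlonglongrightarrow> 0 \<or> (\<lambda>n. graph_prob n (p n) \<phi>) \<longlonglongrightarrow> 1"
  proof (cases "\<exists>n E. E \<subseteq> all_edges n \<and> rich l m {1..n} E \<and> models {1..n} E \<phi>")
    case True
    then obtain n0 E0 where 0: "E0 \<subseteq> all_edges n0" "rich l m {1..n0} E0" "models {1..n0} E0 \<phi>" by blast
    have lower: "1 - ?P n (?R n) \<le> graph_prob n (p n) \<phi>" for n
    proof -
      have "1 - ?P n (?R n) = ?P n (UNIV - ?R n)"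
        by (simp add: measure_pmf.prob_compl[simplified])
      also have "\<dots> \<le> graph_prob n (p n) \<phi>"
        unfolding graph_prob_def
      proof (rule prob_random_graph_mono)
        fix E assume "E \<subseteq> all_edges n" "E \<in> UNIV - ?R n"
        then show "E \<in> {E. models {1..n} E \<phi>}" using same[OF 0(1) _ 0(2), of E n] 0(3) by simp
      qed
      finally show ?thesis .
    qed
    have upper: "graph_prob n (p n) \<phi> \<le> 1" for n by (simp add: graph_prob_def)
    have "(\<lambda>n. 1 - ?P n (?R n)) \<longlonglongrightarrow> 1" using tendsto_diff[OF tendsto_const R, of 1] by simp
    then have "(\<lambda>n. graph_prob n (p n) \<phi>) \<longlonglongrightarrow> 1"
      by (rule real_tendsto_sandwich[OF _ _ _ tendsto_const, rotated 2])
        (intro always_eventually allI lower upper)+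
    then show ?thesis ..
  next
    case False
    have "graph_prob n (p n) \<phi> \<le> ?P n (?R n)" for n
      unfolding graph_prob_def
    proof (rule prob_random_graph_mono)
      fix E assume "E \<subseteq> all_edges n" "E \<in> {E. models {1..n} E \<phi>}"
      then have "\<not> rich l m {1..n} E" using False unfolding mem_Collect_eq by metis
      then show "E \<in> ?R n" by simp
    qed
    then have "(\<lambda>n. graph_prob n (p n) \<phi>) \<longlonglongrightarrow> 0"
      by (intro real_tendsto_sandwich[OF _ _ tendsto_const R]) (auto simp: graph_prob_def)
    then show ?thesis ..
  qed
qed

end

section \<open>Failure of the first order zero-one law\<close>

lemma set_decode_less: "i \<in> set_decode m \<Longrightarrow> i < m"
proof -
  assume i: "i \<in> set_decode m"
  have "i < 2 ^ i" by (rule less_exp)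
  also have "2 ^ i = set_encode {i}" by simp
  also have "\<dots> \<le> set_encode (set_decode m)"
    unfolding set_encode_def by (rule sum_mono2) (use i in auto)
  finally show ?thesis by simp
qed

text \<open>Passing from a code to its elements strips one exponential, that is, one level of the
  tower.\<close>

lemma set_decode_less_exp: "i \<in> set_decode m \<Longrightarrow> m < 2 ^ n \<Longrightarrow> i < n"
proof (rule ccontr)
  assume i: "i \<in> set_decode m" and m: "m < 2 ^ n" and "\<not> i < n"
  then have "(2::nat) ^ n \<le> 2 ^ i" by simp
  also have "2 ^ i = set_encode {i}" by simp
  also have "\<dots> \<le> set_encode (set_decode m)"
    unfolding set_encode_def by (rule sum_mono2) (use i in auto)
  finally show False using m by simp
qed

text \<open>A number \<open>c\<close> codes, via Ackermann's bijection, the rooted tree whose root has the trees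
  coded by the elements of \<open>set_decode c\<close> as its branches. Its vertices are the lists
  \<open>[i\<^sub>r, \<dots>, i\<^sub>1, c]\<close> describing the paths from the root, with \<open>tl\<close> as the parent map.\<close>

inductive_set nodes :: "nat \<Rightarrow> nat list set" for c where
  root: "[c] \<in> nodes c"
| child: "p \<in> nodes c \<Longrightarrow> i \<in> set_decode (hd p) \<Longrightarrow> i # p \<in> nodes c"

lemma nodes_not_Nil: "p \<in> nodes c \<Longrightarrow> p \<noteq> []"
  by (induction rule: nodes.induct) auto

lemma nodes_last: "p \<in> nodes c \<Longrightarrow> last p = c"
  by (induction rule: nodes.induct) (auto simp: nodes_not_Nil)

lemma nodes_tl: "p \<in> nodes c \<Longrightarrow> p \<noteq> [c] \<Longrightarrow> tl p \<in> nodes c \<and> hd p \<in> set_decode (hd (tl p))"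
  by (cases rule: nodes.cases) auto

text \<open>The inductive definition grows the tree at its leaves; this is the decomposition into
  branches at the root, needed for counting.\<close>

lemma nodes_unfold: "nodes c = insert [c] (\<Union>i\<in>set_decode c. (\<lambda>p. p @ [c]) ` nodes i)"
proof (intro equalityI subsetI)
  fix p assume "p \<in> nodes c"
  then show "p \<in> insert [c] (\<Union>i\<in>set_decode c. (\<lambda>p. p @ [c]) ` nodes i)"
  proof (induction rule: nodes.induct)
    case (child p i)
    show ?case
    proof (cases "p = [c]")
      case True
      then have "i \<in> set_decode c" "i # p = [i] @ [c]" using child.hyps(2) by auto
      then show ?thesis using nodes.root by blast
    next
      case False
      then obtain j q where j: "j \<in> set_decode c" "q \<in> nodes j" "p = q @ [c]" using child.IH by auto
      then have "i \<in> set_decode (hd q)" using child.hyps(2) nodes_not_Nil[OF j(2)] by simp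
      then have "i # q \<in> nodes j" using j(2) nodes.child by blast
      then show ?thesis using j by force
    qed
  qed simp
next
  fix p assume "p \<in> insert [c] (\<Union>i\<in>set_decode c. (\<lambda>p. p @ [c]) ` nodes i)"
  then consider "p = [c]" | j q where "j \<in> set_decode c" "q \<in> nodes j" "p = q @ [c]" by auto
  then show "p \<in> nodes c"
  proof cases
    case 1
    then show ?thesis by (simp add: nodes.root)
  next
    case (2 j q)
    have "q @ [c] \<in> nodes c"
      using 2(2)
    proof (induction rule: nodes.induct)
      case root
      then show ?case using nodes.child[OF nodes.root] 2(1) by simp
    next
      case (child q i)
      then show ?case using nodes.child[OF child.IH, of i] nodes_not_Nil[OF child.hyps(1)] by simp
    qed
    then show ?thesis using 2(3) by simp
  qed
qed

lemma finite_nodes: "finite (nodes c)"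
proof (induction c rule: less_induct)
  case (less c)
  then show ?case
    by (subst nodes_unfold) (auto dest: set_decode_less)
qed

lemma card_nodes: "card (nodes c) = 1 + (\<Sum>i\<in>set_decode c. card (nodes i))"
proof -
  let ?N = "\<lambda>i. (\<lambda>p. p @ [c]) ` nodes i"
  have "[c] \<notin> (\<Union>i\<in>set_decode c. ?N i)" by (auto dest: nodes_not_Nil)
  then have "card (nodes c) = 1 + card (\<Union>i\<in>set_decode c. ?N i)"
    by (subst nodes_unfold) (simp add: finite_nodes)
  also have "card (\<Union>i\<in>set_decode c. ?N i) = (\<Sum>i\<in>set_decode c. card (?N i))"
  proof (rule card_UN_disjoint)
    show "\<forall>i\<in>set_decode c. \<forall>j\<in>set_decode c. i \<noteq> j \<longrightarrow> ?N i \<inter> ?N j = {}"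
    proof (intro ballI impI)
      fix i j :: nat assume "i \<noteq> j"
      then show "?N i \<inter> ?N j = {}" using nodes_last[of _ i] nodes_last[of _ j] by auto
    qed
  qed (auto simp: finite_nodes)
  also have "\<dots> = (\<Sum>i\<in>set_decode c. card (nodes i))"
    by (intro sum.cong refl card_image) (auto simp: inj_on_def)
  finally show ?thesis .
qed

text \<open>The sizes form a complete sequence, because the size of a tree exceeds by one the sum of the
  sizes of some trees with smaller codes.\<close>

lemma code_of_size:
  assumes "l \<le> M"
  obtains c where "c < 2 ^ M" "card (nodes c) = l + 1"
proof -
  let ?s = "\<lambda>m. card (nodes m)"
  \<comment> \<open>Strengthened for the induction: every number up to the total is a sum of
    distinct sizes.\<close>
  have "\<exists>A\<subseteq>{..<M}. (\<Sum>i\<in>A. ?s i) = l" if "l \<le> (\<Sum>m<M. ?s m)" for l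
    using that
  proof (induction M arbitrary: l)
    case (Suc M)
    show ?case
    proof (cases "l \<le> (\<Sum>m<M. ?s m)")
      case True
      then show ?thesis using Suc.IH[of l] by (meson lessThan_subset_iff le_SucI order_refl subset_trans)
    next
      case False
      \<comment> \<open>The size of tree \<open>M\<close> is one plus a partial sum of the earlier
        sizes, so it fits into any \<open>l\<close> exceeding their total, and the remainder is
        again a sum of earlier sizes.\<close>
      have "set_decode M \<subseteq> {..<M}" using set_decode_less by auto
      then have "(\<Sum>i\<in>set_decode M. ?s i) \<le> (\<Sum>m<M. ?s m)" by (intro sum_mono2) auto
      then have le: "?s M \<le> l" using False card_nodes[of M] by simp
      have "l - ?s M \<le> (\<Sum>m<M. ?s m)" using Suc.prems by simp
      then obtain A where A: "A \<subseteq> {..<M}" "(\<Sum>i\<in>A. ?s i) = l - ?s M"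
        using Suc.IH[of "l - ?s M"] by blast
      moreover have "finite A" "M \<notin> A" using A(1) finite_subset by auto
      ultimately have "(\<Sum>i\<in>insert M A. ?s i) = l" using le by simp
      moreover have "insert M A \<subseteq> {..<Suc M}" using A(1) by auto
      ultimately show ?thesis by blast
    qed
  qed simp
  moreover have "l \<le> (\<Sum>m<M. ?s m)"
  proof -
    have "1 \<le> ?s m" for m using card_nodes[of m] by linarith
    then have "(\<Sum>m<M. 1) \<le> (\<Sum>m<M. ?s m)" by (intro sum_mono)
    then show ?thesis using assms by simp
  qed
  ultimately obtain A where A: "A \<subseteq> {..<M}" "(\<Sum>i\<in>A. ?s i) = l" by blast
  have fin: "finite A" using A(1) by (rule finite_subset) simp
  show thesis
  proof
    show "set_encode A < 2 ^ M" using A(1) by (rule set_encode_less)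
    show "card (nodes (set_encode A)) = l + 1" using A(2) fin by (subst card_nodes) simp
  qed
qed

section \<open>First order description of coded trees\<close>

text \<open>\<open>m\<close> is the set of the codes found at the neighbours of \<open>x\<close>
  other than \<open>y\<close>. Several neighbours may share a code, so this is a bisimulation
  condition rather than an isomorphism.\<close>

function code_at :: "'v set \<Rightarrow> 'v set set \<Rightarrow> nat \<Rightarrow> 'v \<Rightarrow> 'v \<Rightarrow> bool" where
  "code_at V E m y x \<longleftrightarrow>
     (\<forall>i\<in>set_decode m. \<exists>z\<in>V. {z, x} \<in> E \<and> z \<noteq> y \<and> code_at V E i x z) \<and>
     (\<forall>z\<in>V. {z, x} \<in> E \<and> z \<noteq> y \<longrightarrow> (\<exists>i\<in>set_decode m. code_at V E i x z))"
  by auto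
termination
  by (relation "Wellfounded.measure (\<lambda>(V, E, m, y, x). m)") (auto dest: set_decode_less)

declare code_at.simps [simp del]

text \<open>Extensionality of hereditarily finite sets. It will show that different siblings of the
  coded tree lead to different vertices.\<close>

lemma code_at_unique: "code_at V E m y x \<Longrightarrow> code_at V E m' y x \<Longrightarrow> m = m'"
proof (induction m arbitrary: m' y x rule: less_induct)
  case (less m)
  note 1 = less.prems(1)[unfolded code_at.simps[of V E m]] and 2 = less.prems(2)[unfolded code_at.simps[of V E m']]
  have "set_decode m = set_decode m'"
  proof (intro equalityI subsetI)
    fix i assume i: "i \<in> set_decode m"
    then obtain z where z: "z \<in> V" "{z, x} \<in> E" "z \<noteq> y" "code_at V E i x z" using 1 by blast
    then obtain j where "j \<in> set_decode m'" "code_at V E j x z" using 2 by blast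
    then show "i \<in> set_decode m'" using less.IH[OF set_decode_less[OF i] z(4)] by simp
  next
    fix i assume i: "i \<in> set_decode m'"
    then obtain z where z: "z \<in> V" "{z, x} \<in> E" "z \<noteq> y" "code_at V E i x z" using 2 by blast
    then obtain j where "j \<in> set_decode m" "code_at V E j x z" using 1 by blast
    then show "i \<in> set_decode m" using less.IH[OF set_decode_less _ z(4), of j] by simp
  qed
  then show ?case by (metis set_decode_inverse)
qed

text \<open>\<open>form m e d\<close> says that the branch at the vertex \<open>d\<close> pointing away from its parent \<open>e\<close> has
  code \<open>m\<close>; for the root we take \<open>e = d\<close>, so that the parent imposes no restriction.\<close>

function form :: "nat \<Rightarrow> nat \<Rightarrow> nat \<Rightarrow> formula" where
  "form m e d = Conj
     (foldr Conj (map (\<lambda>i. Exists (Suc d) (Conj (Conj (Adj (Suc d) d) (Neg (Eq (Suc d) e))) (form i d (Suc d))))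
        (sorted_list_of_set (set_decode m))) (Eq d d))
     (Forall (Suc d) (Imp (Conj (Adj (Suc d) d) (Neg (Eq (Suc d) e)))
        (foldr Disj (map (\<lambda>i. form i d (Suc d)) (sorted_list_of_set (set_decode m))) (Neg (Eq d d)))))"
  by auto
termination
  by (relation "Wellfounded.measure (\<lambda>(m, e, d). m)") (auto dest: set_decode_less)

declare form.simps [simp del]

lemma sat_foldr_Conj: "sat V E s S (foldr Conj fs f) \<longleftrightarrow> (\<forall>g\<in>set fs. sat V E s S g) \<and> sat V E s S f"
  by (induction fs) auto

lemma sat_foldr_Disj: "sat V E s S (foldr Disj fs f) \<longleftrightarrow> (\<exists>g\<in>set fs. sat V E s S g) \<or> sat V E s S f"
  by (induction fs) auto

text \<open>\<open>e \<le> d\<close> ensures that binding \<open>Suc d\<close> overwrites neither of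
  the two vertices still referred to.\<close>

lemma sat_form: "e \<le> d \<Longrightarrow> sat V E s S (form m e d) \<longleftrightarrow> code_at V E m (s e) (s d)"
proof (induction m arbitrary: e d s rule: less_induct)
  case (less m)
  have IH: "sat V E (s(Suc d := z)) S (form i d (Suc d)) \<longleftrightarrow> code_at V E i (s d) z" if "i \<in> set_decode m" for i z
    using less.IH[OF set_decode_less[OF that], of d "Suc d" "s(Suc d := z)"] by (simp add: fun_upd_def)
  show ?case
    using less.prems
    by (subst form.simps, subst code_at.simps)
      (auto simp: sat_foldr_Conj sat_foldr_Disj IH insert_commute)
qed

lemma free_vars_foldr:
  "free_vars (foldr Conj fs f) = (\<Union>g\<in>set fs. free_vars g) \<union> free_vars f"
  "free_vars (foldr Disj fs f) = (\<Union>g\<in>set fs. free_vars g) \<union> free_vars f"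
  "free_set_vars (foldr Conj fs f) = (\<Union>g\<in>set fs. free_set_vars g) \<union> free_set_vars f"
  "free_set_vars (foldr Disj fs f) = (\<Union>g\<in>set fs. free_set_vars g) \<union> free_set_vars f"
  by (induction fs) auto

lemma first_order_foldr:
  "first_order (foldr Conj fs f) \<longleftrightarrow> (\<forall>g\<in>set fs. first_order g) \<and> first_order f"
  "first_order (foldr Disj fs f) \<longleftrightarrow> (\<forall>g\<in>set fs. first_order g) \<and> first_order f"
  by (induction fs) auto

lemma qdepth_foldr:
  "qdepth (foldr Conj fs f) \<le> q \<longleftrightarrow> (\<forall>g\<in>set fs. qdepth g \<le> q) \<and> qdepth f \<le> q"
  "qdepth (foldr Disj fs f) \<le> q \<longleftrightarrow> (\<forall>g\<in>set fs. qdepth g \<le> q) \<and> qdepth f \<le> q"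
  by (induction fs) auto

lemma form_syntax:
  "free_vars (form m e d) \<subseteq> {e, d} \<and> free_set_vars (form m e d) = {} \<and> first_order (form m e d)"
proof (induction m arbitrary: e d rule: less_induct)
  case (less m)
  have IH: "free_vars (form i d (Suc d)) \<subseteq> {d, Suc d}" "free_set_vars (form i d (Suc d)) = {}"
    "first_order (form i d (Suc d))" if "i \<in> set_decode m" for i
    using less.IH[OF set_decode_less[OF that]] by blast+
  show ?case
    using IH(1) by (subst (1 2 3) form.simps) (auto simp: free_vars_foldr first_order_foldr IH(2,3))
qed

text \<open>One quantifier per level of the tower. Below \<open>tower 0\<close> only the code 0 of a
  single vertex is left, and excluding further neighbours takes the one quantifier of the base
  case.\<close>

lemma qdepth_form: "m < tower i \<Longrightarrow> qdepth (form m e d) \<le> Suc i"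
proof (induction i arbitrary: m e d)
  case 0
  then show ?case by (subst form.simps) simp
next
  case (Suc i)
  have "qdepth (form j d (Suc d)) \<le> Suc i" if "j \<in> set_decode m" for j
    using Suc.IH[OF set_decode_less_exp[OF that]] Suc.prems by simp
  then show ?case by (subst form.simps) (simp add: qdepth_foldr)
qed

lemma code_sentence:
  assumes "c < tower i"
  shows "fo_sentence (Exists 0 (form c 0 0))" "qdepth (Exists 0 (form c 0 0)) \<le> i + 2"
    "models V E (Exists 0 (form c 0 0)) \<longleftrightarrow> (\<exists>x\<in>V. code_at V E c x x)"
  using form_syntax[of c 0 0] qdepth_form[OF assms, of 0 0]
  by (auto simp: fo_sentence_def mso_sentence_def models_def sat_form)

section \<open>Isolated copies satisfy the description\<close>

definition code_copy :: "nat \<Rightarrow> nat set \<Rightarrow> nat set set" where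
  "code_copy c W = (let g = SOME g. bij_betw g (nodes c) W in (\<lambda>p. {g p, g (tl p)}) ` (nodes c - {[c]}))"

text \<open>Each node but the root owns the edge to its parent. Two nodes cannot be each other's
  parent because \<open>tl\<close> shortens paths. \<open>S\<close> may be any part of the tree
  closed under parents, as needed in \<open>walk_inj\<close>.\<close>

lemma inj_on_tree_edges:
  assumes "inj_on g S" "S \<subseteq> nodes c" "\<And>p. p \<in> S \<Longrightarrow> p \<noteq> [c] \<Longrightarrow> tl p \<in> S"
  shows "inj_on (\<lambda>p. {g p, g (tl p)}) (S - {[c]})"
proof (rule inj_onI)
  fix p q assume p: "p \<in> S - {[c]}" and q: "q \<in> S - {[c]}" and eq: "{g p, g (tl p)} = {g q, g (tl q)}"
  have inj: "a = b" if "g a = g b" "a \<in> S" "b \<in> S" for a b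
    using that assms(1) by (auto dest: inj_onD)
  have tl: "tl p \<in> S" "tl q \<in> S" using p q assms(3) by auto
  have ne: "p \<noteq> []" "q \<noteq> []" using p q assms(2) nodes_not_Nil by auto
  from eq consider "g p = g q" | "g p = g (tl q)" "g q = g (tl p)" by (auto simp: doubleton_eq_iff)
  then show "p = q"
  proof cases
    case 1
    then show ?thesis using inj p q by auto
  next
    case 2
    then have "p = tl q" "q = tl p" using inj p q tl by auto
    then have "length p = length p - 1 - 1" by (metis length_tl)
    then show ?thesis using ne by (cases p) auto
  qed
qed

lemma code_copy:
  assumes "finite W" "card W = card (nodes c)"
  obtains g where "bij_betw g (nodes c) W" "code_copy c W = (\<lambda>p. {g p, g (tl p)}) ` (nodes c - {[c]})"
proof -
  have "\<exists>g. bij_betw g (nodes c) W" using assms finite_nodes by (metis bij_betw_iff_card)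
  then have "bij_betw (SOME g. bij_betw g (nodes c) W) (nodes c) W" by (rule someI_ex)
  then show thesis using that by (simp add: code_copy_def Let_def)
qed

lemma copies_code_copy:
  "copies (card (nodes c)) (card (nodes c) - 1) (code_copy c)"
  unfolding copies_def
proof (intro allI impI conjI)
  fix W :: "nat set" assume "finite W \<and> card W = card (nodes c)"
  then obtain g where g: "bij_betw g (nodes c) W" and F: "code_copy c W = (\<lambda>p. {g p, g (tl p)}) ` (nodes c - {[c]})"
    by (auto elim: code_copy)
  have inj: "inj_on g (nodes c)" and im: "g ` nodes c = W" using g by (auto simp: bij_betw_def)
  have tl: "tl p \<in> nodes c" if "p \<in> nodes c - {[c]}" for p using nodes_tl[of p c] that by auto
  show "code_copy c W \<subseteq> {e. e \<subseteq> W \<and> card e = 2}"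
  proof
    fix e assume "e \<in> code_copy c W"
    then obtain p where p: "p \<in> nodes c - {[c]}" "e = {g p, g (tl p)}" using F by auto
    have "p \<noteq> tl p" using p(1) nodes_not_Nil by (metis DiffD1 neq_Nil_conv list.sel(3) not_Cons_self)
    then have "g p \<noteq> g (tl p)" using inj p(1) tl[OF p(1)] by (auto dest: inj_onD)
    then show "e \<in> {e. e \<subseteq> W \<and> card e = 2}" using p im tl[OF p(1)] by auto
  qed
  show "card (code_copy c W) = card (nodes c) - 1"
    unfolding F using card_image[OF inj_on_tree_edges[OF inj order_refl]] tl finite_nodes nodes.root[of c]
    by simp
  fix Z assume Z: "Z \<inter> W \<noteq> {} \<and> (\<forall>u\<in>W. \<forall>v\<in>W. {u, v} \<in> code_copy c W \<longrightarrow> u \<in> Z \<longrightarrow> v \<in> Z)"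
  have iff: "g p \<in> Z \<longleftrightarrow> g [c] \<in> Z" if "p \<in> nodes c" for p
    using that
  proof (induction rule: nodes.induct)
    case (child p i)
    have q: "i # p \<in> nodes c - {[c]}"
      using nodes.child[OF child.hyps] nodes_not_Nil[OF child.hyps(1)] by auto
    then have "{g (i # p), g p} \<in> code_copy c W" unfolding F by (rule rev_image_eqI) simp
    then have "{g (i # p), g p} \<in> code_copy c W" "{g p, g (i # p)} \<in> code_copy c W" by (simp_all add: insert_commute)
    moreover have "g (i # p) \<in> W" "g p \<in> W" using im q child.hyps(1) by auto
    ultimately have "g (i # p) \<in> Z \<longleftrightarrow> g p \<in> Z" using Z by blast
    then show ?case using child.IH by simp
  qed simp
  then show "W \<subseteq> Z" using Z im by blast
qed

text \<open>Isolation leaves \<open>g p\<close> no neighbours but its parent and children in the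
  coded tree, so both clauses of \<open>code_at\<close> follow by induction on the code.\<close>

lemma isolated_code_at:
  assumes E: "E \<subseteq> all_edges n" and W: "W \<in> vsets n (card (nodes c))" "E \<in> isolated n W (code_copy c W)"
  shows "\<exists>x\<in>{1..n}. code_at {1..n} E c x x"
proof -
  let ?V = "{1..n}"
  note cW = copies_touch(1,4)[OF copies_code_copy W(1)]
  obtain g where g: "bij_betw g (nodes c) W" and F: "code_copy c W = (\<lambda>p. {g p, g (tl p)}) ` (nodes c - {[c]})"
    using code_copy[OF cW] .
  have inj: "inj_on g (nodes c)" and im: "g ` nodes c = W" using g by (auto simp: bij_betw_def)
  have WV: "W \<subseteq> ?V" using W(1) by (auto simp: vsets_def)
  have "code_copy c W \<subseteq> Pow W" using copiesD(1)[OF copies_code_copy cW] by auto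
  note nbr = isolated_nbr[OF E W(2) this]
  have edge: "{g (i # p), g p} \<in> E" if "p \<in> nodes c" "i \<in> set_decode (hd p)" for p i
  proof -
    have "i # p \<in> nodes c" using that by (rule nodes.child)
    moreover have "i # p \<noteq> [c]" using nodes_not_Nil[OF that(1)] by simp
    ultimately have "{g (i # p), g (tl (i # p))} \<in> code_copy c W" unfolding F by blast
    then show ?thesis using nbr[of "g (i # p)" "g p"] im \<open>i # p \<in> nodes c\<close> by auto
  qed
  \<comment> \<open>The root counts as its own parent, in accordance with
    \<open>code_at V E c x x\<close>.\<close>
  define parent where "parent p = (if p = [c] then g p else g (tl p))" for p
  have nbrs: "\<exists>i\<in>set_decode (hd p). z = g (i # p)"
    if p: "p \<in> nodes c" and z: "{z, g p} \<in> E" "z \<noteq> parent p" for p z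
  proof -
    have "g p \<in> W" using im p by auto
    then have "{g p, z} \<in> code_copy c W" using nbr[of "g p" z] z(1) by (simp add: insert_commute)
    then obtain q where q: "q \<in> nodes c" "q \<noteq> [c]" "{g p, z} = {g q, g (tl q)}" using F by auto
    have tlq: "tl q \<in> nodes c" "hd q \<in> set_decode (hd (tl q))" using nodes_tl[OF q(1,2)] by auto
    from q(3) consider "g p = g q" "z = g (tl q)" | "g p = g (tl q)" "z = g q" by (auto simp: doubleton_eq_iff)
    then show ?thesis
    proof cases
      case 1
      then have "p = q" using inj p q(1) by (auto dest: inj_onD)
      then show ?thesis using 1 q(2) z(2) by (simp add: parent_def)
    next
      case 2
      then have "p = tl q" using inj p tlq(1) by (auto dest: inj_onD)
      then have "q = hd q # p" using nodes_not_Nil[OF q(1)] by simp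
      then show ?thesis using 2(2) tlq(2) \<open>p = tl q\<close> by metis
    qed
  qed
  have "code_at ?V E (hd p) (parent p) (g p)" if "p \<in> nodes c" for p
    using that
  proof (induction "hd p" arbitrary: p rule: less_induct)
    case less
    have child: "i # p \<in> nodes c" "code_at ?V E i (g p) (g (i # p))" if i: "i \<in> set_decode (hd p)" for i
    proof -
      show c: "i # p \<in> nodes c" using less.prems i by (rule nodes.child)
      have "i # p \<noteq> [c]" using nodes_not_Nil[OF less.prems] by simp
      then have "parent (i # p) = g p" unfolding parent_def by (simp only: if_False list.sel)
      then show "code_at ?V E i (g p) (g (i # p))"
        using less.hyps[OF _ c] set_decode_less[OF i] by simp
    qed
    show ?case
      unfolding code_at.simps[of ?V E "hd p"]
    proof (intro conjI ballI impI)
      fix i assume i: "i \<in> set_decode (hd p)"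
      \<comment> \<open>A parent is never also a child: the two paths have different
        lengths.\<close>
      have par: "parent p \<noteq> g (i # p)"
      proof
        assume eq: "parent p = g (i # p)"
        have ne: "p \<noteq> []" by (rule nodes_not_Nil[OF less.prems])
        show False
        proof (cases "p = [c]")
        case True
        then have "p = i # p" using eq inj less.prems child(1)[OF i] by (auto simp: parent_def dest: inj_onD)
        then show False by simp
        next
        case False
        then have "tl p = i # p" using eq inj nodes_tl[OF less.prems] child(1)[OF i] by (auto simp: parent_def dest: inj_onD)
        then have "length (tl p) = Suc (length p)" by simp
        then show False by simp
        qed
      qed
      show "\<exists>z\<in>?V. {z, g p} \<in> E \<and> z \<noteq> parent p \<and> code_at ?V E i (g p) z"
      proof (intro bexI conjI)
        show "g (i # p) \<in> ?V" using child(1)[OF i] im WV by auto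
      qed (use edge[OF less.prems i] par child(2)[OF i] in auto)
    next
      fix z assume "{z, g p} \<in> E \<and> z \<noteq> parent p"
      then obtain i where "i \<in> set_decode (hd p)" "z = g (i # p)" using nbrs[OF less.prems] by blast
      then show "\<exists>i\<in>set_decode (hd p). code_at ?V E i (g p) z" using child(2) by blast
    qed
  qed
  from this[OF nodes.root] have "code_at ?V E c (g [c]) (g [c])" by (simp add: parent_def)
  moreover have "g [c] \<in> W" using nodes.root[of c] im by blast
  then have "g [c] \<in> ?V" using WV by blast
  ultimately show ?thesis by blast
qed

section \<open>Recovering the tree from its description\<close>

text \<open>Witnesses for the existential clause of \<open>code_at\<close>, chosen along the paths
  of the coded tree. \<open>[]\<close>, the tail of the root, is also sent to \<open>x\<close>, so
  that the root again is its own parent.\<close>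

fun walk :: "'v set \<Rightarrow> 'v set set \<Rightarrow> 'v \<Rightarrow> nat list \<Rightarrow> 'v" where
  "walk V E x [] = x"
| "walk V E x [i] = x"
| "walk V E x (i # j # p) = (SOME z. z \<in> V \<and> {z, walk V E x (j # p)} \<in> E \<and> z \<noteq> walk V E x p \<and>
     code_at V E i (walk V E x (j # p)) z)"

lemma walk:
  assumes "x \<in> V" "code_at V E c x x" "p \<in> nodes c"
  shows "walk V E x p \<in> V \<and> code_at V E (hd p) (walk V E x (tl p)) (walk V E x p) \<and>
    (p \<noteq> [c] \<longrightarrow> {walk V E x p, walk V E x (tl p)} \<in> E \<and> walk V E x p \<noteq> walk V E x (tl (tl p)))"
  using assms(3)
proof (induction rule: nodes.induct)
  case root
  then show ?case using assms by simp
next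
  case (child p i)
  obtain j q where p: "p = j # q" using nodes_not_Nil[OF child.hyps(1)] by (cases p) auto
  have "code_at V E j (walk V E x q) (walk V E x p)" using child.IH p by simp
  then have "\<exists>z. z \<in> V \<and> {z, walk V E x p} \<in> E \<and> z \<noteq> walk V E x q \<and> code_at V E i (walk V E x p) z"
    using child.hyps(2) p unfolding code_at.simps[of V E j] by auto
  then have "walk V E x (i # p) \<in> V \<and> {walk V E x (i # p), walk V E x p} \<in> E \<and>
      walk V E x (i # p) \<noteq> walk V E x q \<and> code_at V E i (walk V E x p) (walk V E x (i # p))"
    unfolding p walk.simps by (rule someI_ex)
  then show ?case using p by simp
qed

text \<open>The first repetition along the paths of the code would close a cycle.\<close>

lemma walk_inj:
  assumes finE: "finite E" and sparse: "sparse l V E" and size: "card (nodes c) \<le> l + 1"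
    and x: "x \<in> V" "code_at V E c x x"
    and S: "S \<subseteq> nodes c" "\<And>p. p \<in> S \<Longrightarrow> p \<noteq> [c] \<Longrightarrow> tl p \<in> S"
  shows "inj_on (walk V E x) S"
  using S
proof (induction "card S" arbitrary: S)
  case 0
  then have "S = {}" using finite_subset[OF 0(2) finite_nodes] by simp
  then show ?case by simp
next
  case (Suc k)
  let ?f = "walk V E x"
  note w = walk[OF x]
  have finS: "finite S" using Suc.prems(1) finite_nodes by (rule finite_subset)
  have "S \<noteq> {}" using Suc.hyps(2) by auto
  then have "Max (length ` S) \<in> length ` S" using finS by (intro Max_in) auto
  then obtain q where q: "q \<in> S" "length q = Max (length ` S)" by auto
  have qmax: "length p \<le> length q" if "p \<in> S" for p
    unfolding q(2) using that finS by (intro Max_ge) auto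
  \<comment> \<open>A longest path is nobody's parent, so what remains is closed under
    \<open>tl\<close>.\<close>
  define S' where "S' = S - {q}"
  have S'S: "S' \<subseteq> S" "S' \<subseteq> nodes c" "S = insert q S'" "q \<notin> S'" "finite S'"
    using q(1) Suc.prems(1) finS by (auto simp: S'_def)
  have tlS': "tl p \<in> S'" if p: "p \<in> S" "p \<noteq> [c]" for p
  proof -
    have "p \<noteq> []" using p Suc.prems(1) nodes_not_Nil by auto
    then have "length (tl p) < length p" by simp
    then have "tl p \<noteq> q" using qmax[OF p(1)] by auto
    then show ?thesis using Suc.prems(2)[OF p] by (simp add: S'_def)
  qed
  have inj': "inj_on ?f S'"
  proof (rule Suc.hyps(1))
    show "k = card S'" using Suc.hyps(2) q(1) finS by (simp add: S'_def)
  qed (use S'S tlS' in auto)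
  have "?f q \<notin> ?f ` S'"
  proof
    assume "?f q \<in> ?f ` S'"
    then obtain r where r: "r \<in> S'" "?f q = ?f r" by auto
    show False
    proof (cases "q = [c]")
      case True
      have "length r \<le> 1" using qmax[of r] r(1) S'S(1) True by auto
      then obtain i where "r = [i]" using r(1) S'S(2) nodes_not_Nil[of r c] by (cases r) auto
      then have "r = [c]" using nodes_last[of r c] r(1) S'S(2) by auto
      then show False using True r(1) S'S(4) by simp
    next
      case qc: False
      \<comment> \<open>If \<open>q\<close> repeats a vertex, the edge to its parent lies inside
        \<open>?W\<close>. Together with the \<open>card S' - 1\<close> tree edges it makes as many
        edges as vertices, which \<open>sparse\<close> forbids.\<close>
      let ?W = "?f ` S'"
      let ?D = "(\<lambda>p. {?f p, ?f (tl p)}) ` (S' - {[c]})"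
      have tq: "tl q \<in> S'" using tlS'[OF q(1) qc] .
      have qn: "q \<in> nodes c" using q(1) Suc.prems(1) by blast
      have cardW: "card ?W = card S'" by (rule card_image[OF inj'])
      have "?W \<subseteq> V" using w S'S(2) by auto
      moreover have "?W \<noteq> {}" using r(1) by auto
      moreover have "card S' \<le> l + 1" using card_mono[OF finite_nodes S'S(2)] size by simp
      ultimately have dens: "card (E \<inter> Pow ?W) < card S'"
        using sparse cardW unfolding sparse_def by (metis (no_types, lifting))
      have D: "?D \<subseteq> E \<inter> Pow ?W"
      proof
        fix e assume "e \<in> ?D"
        then obtain p where p: "p \<in> S'" "p \<noteq> [c]" "e = {?f p, ?f (tl p)}" by auto
        have "tl p \<in> S'" using tlS' p(1,2) S'S(1) by auto
        then show "e \<in> E \<inter> Pow ?W" using p w[of p] S'S(2) by auto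
      qed
      have "card ?D = card (S' - {[c]})"
        by (rule card_image, rule inj_on_tree_edges[OF inj' S'S(2)]) (use tlS' S'S(1) in blast)
      then have cardD: "card S' \<le> card ?D + 1" using card_Suc_Diff1[OF S'S(5), of "[c]"] by (cases "[c] \<in> S'") auto
      \<comment> \<open>An old edge would either lead to a sibling of \<open>q\<close>, which by
        \<open>code_at_unique\<close> has the same code and hence equals \<open>q\<close>, or lead
        back to the grandparent, which \<open>walk\<close> avoids.\<close>
      have new: "{?f q, ?f (tl q)} \<notin> ?D"
      proof
        assume "{?f q, ?f (tl q)} \<in> ?D"
        then obtain p where p: "p \<in> S'" "p \<noteq> [c]" "{?f r, ?f (tl q)} = {?f p, ?f (tl p)}" using r(2) by auto
        have tp: "tl p \<in> S'" using tlS' p(1,2) S'S(1) by auto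
        have pn: "p \<in> nodes c" using p(1) S'S(2) by blast
        from p(3) consider "?f r = ?f p" "?f (tl q) = ?f (tl p)" | "?f r = ?f (tl p)" "?f (tl q) = ?f p"
        by (auto simp: doubleton_eq_iff)
        then show False
        proof cases
        case 1
        then have "tl q = tl p" "r = p" using inj' tq tp r(1) p(1) by (auto dest: inj_onD)
        then have "code_at V E (hd q) (?f (tl q)) (?f q)" "code_at V E (hd p) (?f (tl q)) (?f q)"
        using w[OF qn] w[OF pn] r(2) by auto
        then have "hd q = hd p" by (rule code_at_unique)
        then have "q = p" using \<open>tl q = tl p\<close> nodes_not_Nil[OF qn] nodes_not_Nil[OF pn] by (metis list.collapse)
        then show False using p(1) S'S(4) by simp
        next
        case 2
        then have "tl q = p" "r = tl p" using inj' tq tp r(1) p(1) by (auto dest: inj_onD)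
        then show False using w[OF qn] qc r(2) by auto
        qed
      qed
      have "{?f q, ?f (tl q)} \<in> E \<inter> Pow ?W" using w[OF qn] qc tq r by auto
      then have "insert {?f q, ?f (tl q)} ?D \<subseteq> E \<inter> Pow ?W" using D by blast
      then have "card (insert {?f q, ?f (tl q)} ?D) \<le> card (E \<inter> Pow ?W)" using finE by (intro card_mono) auto
      then show False using dens cardD new S'S(5) by simp
    qed
  qed
  then show ?case using inj' S'S(3,4) by auto
qed

text \<open>The walk embeds the whole coded tree. Only the number of its edges is kept, because this
  is the event whose avoidance \<open>prob_no_dense\<close> bounds.\<close>

lemma code_at_dense:
  assumes finE: "finite E" and sparse: "sparse l V E" and size: "card (nodes c) = l + 1"
    and x: "x \<in> V" "code_at V E c x x"
  shows "\<exists>W\<subseteq>V. card W = l + 1 \<and> l \<le> card (E \<inter> Pow W)"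
proof -
  let ?f = "walk V E x"
  note w = walk[OF x]
  have tl: "tl p \<in> nodes c" if "p \<in> nodes c" "p \<noteq> [c]" for p using nodes_tl[OF that] by simp
  have inj: "inj_on ?f (nodes c)"
    by (rule walk_inj[OF finE sparse _ x]) (use size tl in auto)
  let ?W = "?f ` nodes c" and ?D = "(\<lambda>p. {?f p, ?f (tl p)}) ` (nodes c - {[c]})"
  have "card ?D = card (nodes c - {[c]})"
    by (rule card_image, rule inj_on_tree_edges[OF inj order_refl]) (rule tl)
  then have "card ?D = l" using size nodes.root[of c] finite_nodes by simp
  moreover have "?D \<subseteq> E \<inter> Pow ?W" using w tl by auto
  then have "card ?D \<le> card (E \<inter> Pow ?W)" using finE by (intro card_mono) auto
  moreover have "?W \<subseteq> V" using w by auto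
  moreover have "card ?W = l + 1" using card_image[OF inj] size by simp
  ultimately show ?thesis by blast
qed

text \<open>The probability of the sentence stays away from 0, since an isolated copy makes it true,
  and away from 1, since in a sparse graph it forces \<open>l\<close> edges on \<open>l + 1\<close>
  vertices.\<close>

lemma (in critical_p) not_fo_law:
  assumes M: "l \<le> tower i" and k: "i + 3 \<le> k"
  shows "\<not> fo_zero_one_law k p"
proof
  assume law: "fo_zero_one_law k p"
  obtain c where c: "c < 2 ^ tower i" "card (nodes c) = l + 1" using code_of_size[OF M] .
  have ct: "c < tower (Suc i)" using c(1) by simp
  define \<phi> where "\<phi> = Exists 0 (form c 0 0)"
  note phi = code_sentence(1,2)[OF ct, folded \<phi>_def]
  have models_\<phi>: "models V E \<phi> \<longleftrightarrow> (\<exists>x\<in>V. code_at V E c x x)" for V :: "nat set" and E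
    unfolding \<phi>_def by (rule code_sentence(3)[OF ct])
  let ?P = "\<lambda>n. gprob n (p n)"
  have lim: "(\<lambda>n. graph_prob n (p n) \<phi>) \<longlonglongrightarrow> 0 \<or> (\<lambda>n. graph_prob n (p n) \<phi>) \<longlonglongrightarrow> 1"
    using law phi(1,2) k unfolding fo_zero_one_law_def by auto
  obtain \<delta> where \<delta>: "0 < \<delta>" "eventually (\<lambda>n. \<delta> \<le> ?P n {E. 0 < ncopies n (l + 1) (code_copy c) E}) sequentially"
    using some_copy_lower[of "code_copy c"] copies_code_copy[of c] c(2) by auto
  have lower: "?P n {E. 0 < ncopies n (l + 1) (code_copy c) E} \<le> graph_prob n (p n) \<phi>" for n
    unfolding graph_prob_def
  proof (rule prob_random_graph_mono)
    fix E assume E: "E \<subseteq> all_edges n" "E \<in> {E. 0 < ncopies n (l + 1) (code_copy c) E}"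
    then obtain W where "W \<in> vsets n (l + 1)" "E \<in> isolated n W (code_copy c W)"
      by (auto simp: ncopies_def card_gt_0_iff)
    then show "E \<in> {E. models {1..n} E \<phi>}"
      using isolated_code_at[OF E(1), of W c] c(2) by (simp add: models_\<phi>)
  qed
  have upper: "?P n {E. \<not> dense n (l + 1) l E} \<le> 1 - graph_prob n (p n) \<phi> + ?P n {E. \<not> sparse l {1..n} E}" for n
  proof -
    have "?P n {E. \<not> dense n (l + 1) l E} \<le> ?P n ((UNIV - {E. models {1..n} E \<phi>}) \<union> {E. \<not> sparse l {1..n} E})"
    proof (rule prob_random_graph_mono)
      fix E assume E: "E \<subseteq> all_edges n" "E \<in> {E. \<not> dense n (l + 1) l E}"
      have "finite E" using E(1) finite_all_edges by (rule finite_subset)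
      then show "E \<in> (UNIV - {E. models {1..n} E \<phi>}) \<union> {E. \<not> sparse l {1..n} E}"
        using code_at_dense[of E l "{1..n}" c] c(2) E(2) models_\<phi>[of "{1..n}" E] by blast
    qed
    also have "\<dots> \<le> ?P n (UNIV - {E. models {1..n} E \<phi>}) + ?P n {E. \<not> sparse l {1..n} E}"
      by (rule measure_Un_le) auto
    also have "?P n (UNIV - {E. models {1..n} E \<phi>}) = 1 - graph_prob n (p n) \<phi>"
      unfolding graph_prob_def by (simp add: measure_pmf.prob_compl[simplified])
    finally show ?thesis .
  qed
  from lim show False
  proof
    assume "(\<lambda>n. graph_prob n (p n) \<phi>) \<longlonglongrightarrow> 0"
    then have "eventually (\<lambda>n. graph_prob n (p n) \<phi> < \<delta>) sequentially" using \<delta>(1) by (rule order_tendstoD)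
    with \<delta>(2) have "eventually (\<lambda>n. False) sequentially"
    proof eventually_elim
      case (elim n)
      then show ?case using lower[of n] by simp
    qed
    then show False by simp
  next
    assume 1: "(\<lambda>n. graph_prob n (p n) \<phi>) \<longlonglongrightarrow> 1"
    \<comment> \<open>The bound of \<open>prob_no_dense\<close> for \<open>l + 1\<close> vertices,
      where \<open>n ^ (l + 1) * p n ^ l\<close> is exactly 1.\<close>
    define \<epsilon> where "\<epsilon> = exp (- 2 * 2 ^ 2 ^ (l + 1) :: real)"
    have "(\<lambda>n. 1 - graph_prob n (p n) \<phi> + ?P n {E. \<not> sparse l {1..n} E}) \<longlonglongrightarrow> 1 - 1 + 0"
      by (intro tendsto_intros 1 not_sparse_tendsto_0)
    then have "eventually (\<lambda>n. 1 - graph_prob n (p n) \<phi> + ?P n {E. \<not> sparse l {1..n} E} < \<epsilon>) sequentially"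
      by (rule order_tendstoD) (simp add: \<epsilon>_def)
    moreover have "(\<lambda>n. p n ^ l) \<longlonglongrightarrow> 0" using power_p_tendsto_0[of 0 l] l by (simp add: add_nonneg_pos)
    then have "eventually (\<lambda>n. p n ^ l < 1 / 2) sequentially" by (rule order_tendstoD) simp
    moreover note eventually_ge_at_top[of 1]
    ultimately have "eventually (\<lambda>n. False) sequentially"
    proof eventually_elim
      case (elim n)
      have "\<epsilon> \<le> ?P n {E. \<not> dense n (l + 1) l E}"
        unfolding \<epsilon>_def using p_bounds elim(2) power_p_crit[OF elim(3)] by (intro prob_no_dense) auto
      then show ?case using upper[of n] elim(1) by simp
    qed
    then show False by simp
  qed
qed

theorem theorem8:
  fixes l :: nat and \<alpha> :: real
  assumes "l \<ge> 1" and "\<alpha> = 1 + 1 / real l"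
  shows "(\<forall>k\<ge>4. l \<ge> tower (k + log_star (k + 1) + 3) \<longrightarrow>
            mso_zero_one_law k (\<lambda>n. real n powr (- \<alpha>))) \<and>
         (\<forall>k\<ge>7. l \<le> 2 * tower (k - 4) \<longrightarrow>
            \<not> fo_zero_one_law k (\<lambda>n. real n powr (- \<alpha>)))"
proof -
  interpret critical_p l "\<lambda>n. real n powr (- \<alpha>)"
    by unfold_locales (use assms in simp_all)
  show ?thesis
  proof (intro conjI allI impI)
    fix k assume "4 \<le> k" "tower (k + log_star (k + 1) + 3) \<le> l"
    then show "mso_zero_one_law k (\<lambda>n. real n powr (- \<alpha>))" by (rule mso_law)
  next
    fix k :: nat assume k: "7 \<le> k" and l: "l \<le> 2 * tower (k - 4)"
    \<comment> \<open>Absorbs the factor 2 of the hypothesis into one more level of the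
      tower.\<close>
    have "2 * t \<le> 2 ^ t" if "1 \<le> t" for t :: nat
      using that by (induction t rule: dec_induct) auto
    moreover have "1 \<le> tower (k - 4)" using less_tower[of "k - 4"] by simp
    ultimately have "l \<le> tower (Suc (k - 4))" using l order_trans by fastforce
    then show "\<not> fo_zero_one_law k (\<lambda>n. real n powr (- \<alpha>))"
      using k by (intro not_fo_law[of "Suc (k - 4)"]) auto
  qed
qed

end
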